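(* Let $(t,z)\in[0,T)\times\mathbb R_+$. For each fixed $s\in(t,T]$, the random variable $\sup_{r\in[t,s]}U^{t,z}(r)$ has a (Lebesgue) density $u\mapsto p(s,u;t,z)$ under $\mathbb P$ and a density $u\mapsto p^{\mathbb Q_i}(s,u;t,z)$ under $\mathbb Q_i$ for $i=1,2$. Furthermore, the densities $u\mapsto p(s,u;t,z)$, $u\mapsto p^{\mathbb Q_1}(s,u;t,z)$ and $u\mapsto p^{\mathbb Q_2}(s,u;t,z)$ are locally bounded.
   Context: $T\in(0,\infty)$; $(\Omega,\mathcal F,\mathbb F=(\mathcal F_t)_{t\in[0,T]},\mathbb P)$ is a filtered probability space satisfying the usual conditions and supporting a scalar Brownian motion $W$. $\mathbb R_+=(0,\infty)$. Constants $0<m<M<\infty$; $\mu,\sigma,\delta\in[m,M]$, $\delta\in(0,1)$. Fix $n\ge1$ and types $(a_i,c_i)\in[m,M]^2$, $i=1,\dots,n$, and write $\nu^{(n)}(\frac a{2c})=\frac1n\sum_{i=1}^n\frac{a_i}{2c_i}$. $\Phi:\mathbb R\to\mathbb R$ is Lipschitz with $\Phi(0)\ge0$; $Z^{t,z}$ solves $dZ^{t,z}(s)=\Phi(Z^{t,z}(s))ds$ on $[t,T]$ with $Z^{t,z}(t)=z$. For $s\in[t,T]$, $$K^t(s)=\exp\big[-(\delta+\tfrac{\sigma^2}2)(s-t)+\sigma(W(s)-W(t))\big],\qquad U^{t,z}(s)=\mu\nu^{(n)}\big(\tfrac a{2c}\big)\int_t^s(K^t(r))^{-1}dr-(K^t(s))^{-1}Z^{t,z}(s).$$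 Given $t$, the probability measures $\mathbb Q_1,\mathbb Q_2$ are defined by $$\frac{d\mathbb Q_1}{d\mathbb P}\Big|_{\mathcal F_T}=\exp\Big(-\sigma(W(T)-W(t))-\tfrac{\sigma^2}2(T-t)\Big),\qquad \frac{d\mathbb Q_2}{d\mathbb P}\Big|_{\mathcal F_T}=\exp\Big(\sigma(W(T)-W(t))-\tfrac{\sigma^2}2(T-t)\Big).$$ *)

theory Defs
  imports "HOL-Probability.Probability"
begin

text \<open>Only the indices in \<open>{0..T}\<close> matter. The \<sigma>-algebras are carried by
  \<open>space\<close> and \<open>sets\<close> of \<open>F t\<close>; the measure component of \<open>F t\<close> is ignored.
  The assumption \<open>null_sets_F\<close> includes completeness of \<open>P\<close>.\<close>

locale usual_filtered_prob_space = prob_space P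
  for P :: "'a measure" +
  fixes F :: "real \<Rightarrow> 'a measure" and T :: real
  assumes T_pos: "0 < T"
    and subalgebra_F: "\<And>t. t \<in> {0..T} \<Longrightarrow> subalgebra P (F t)"
    and mono_F: "\<And>s t. 0 \<le> s \<Longrightarrow> s \<le> t \<Longrightarrow> t \<le> T \<Longrightarrow> sets (F s) \<subseteq> sets (F t)"
    and right_continuous_F: "\<And>t. 0 \<le> t \<Longrightarrow> t < T \<Longrightarrow> sets (F t) = (\<Inter>u\<in>{t<..T}. sets (F u))"
    and null_sets_F: "\<And>A N. N \<in> null_sets P \<Longrightarrow> A \<subseteq> N \<Longrightarrow> A \<in> sets (F 0)"

text \<open>Scalar Brownian motion with respect to the filtration \<open>F\<close>; paths are only required to
  be continuous almost surely.\<close>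

locale filtered_brownian_motion = usual_filtered_prob_space P F T
  for P :: "'a measure" and F :: "real \<Rightarrow> 'a measure" and T :: real +
  fixes W :: "real \<Rightarrow> 'a \<Rightarrow> real"
  assumes adapted_W: "\<And>t. t \<in> {0..T} \<Longrightarrow> W t \<in> borel_measurable (F t)"
    and W_0: "AE \<omega> in P. W 0 \<omega> = 0"
    and continuous_W: "AE \<omega> in P. continuous_on {0..T} (\<lambda>t. W t \<omega>)"
    and normal_increments_W: "\<And>s t. 0 \<le> s \<Longrightarrow> s < t \<Longrightarrow> t \<le> T \<Longrightarrow>
          distributed P lborel (\<lambda>\<omega>. W t \<omega> - W s \<omega>) (\<lambda>x. ennreal (normal_density 0 (sqrt (t - s)) x))"
    and indep_increments_W: "\<And>s t. 0 \<le> s \<Longrightarrow> s < t \<Longrightarrow> t \<le> T \<Longrightarrow>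
          indep_set (sets (F s)) (sets (vimage_algebra (space P) (\<lambda>\<omega>. W t \<omega> - W s \<omega>) borel))"

definition nu_mean :: "nat \<Rightarrow> (nat \<Rightarrow> real) \<Rightarrow> (nat \<Rightarrow> real) \<Rightarrow> real" where
  "nu_mean n a c = (1 / real n) * (\<Sum>i = 1..n. a i / (2 * c i))"

definition solves_Phi_ode :: "(real \<Rightarrow> real) \<Rightarrow> real \<Rightarrow> real \<Rightarrow> real \<Rightarrow> (real \<Rightarrow> real) \<Rightarrow> bool" where
  "solves_Phi_ode \<Phi> T t z Z \<longleftrightarrow>
     Z t = z \<and> (\<forall>s\<in>{t..T}. (Z has_real_derivative \<Phi> (Z s)) (at s within {t..T}))"

definition K_proc :: "real \<Rightarrow> real \<Rightarrow> (real \<Rightarrow> 'a \<Rightarrow> real) \<Rightarrow> real \<Rightarrow> real \<Rightarrow> 'a \<Rightarrow> real" where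
  "K_proc \<delta> \<sigma> W t s \<omega> = exp (- (\<delta> + \<sigma>\<^sup>2 / 2) * (s - t) + \<sigma> * (W s \<omega> - W t \<omega>))"

text \<open>The argument \<open>v\<close> stands for \<open>nu_mean n a c\<close>, and \<open>Z\<close> for the solution of the ODE
  started at \<open>(t, z)\<close>.\<close>

definition U_proc ::
  "real \<Rightarrow> real \<Rightarrow> real \<Rightarrow> real \<Rightarrow> (real \<Rightarrow> real) \<Rightarrow> (real \<Rightarrow> 'a \<Rightarrow> real) \<Rightarrow> real \<Rightarrow> real \<Rightarrow> 'a \<Rightarrow> real"
where
  "U_proc \<mu> \<delta> \<sigma> v Z W t s \<omega> =
     \<mu> * v * integral {t..s} (\<lambda>r. inverse (K_proc \<delta> \<sigma> W t r \<omega>))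
     - inverse (K_proc \<delta> \<sigma> W t s \<omega>) * Z s"

definition sup_U ::
  "real \<Rightarrow> real \<Rightarrow> real \<Rightarrow> real \<Rightarrow> (real \<Rightarrow> real) \<Rightarrow> (real \<Rightarrow> 'a \<Rightarrow> real) \<Rightarrow> real \<Rightarrow> real \<Rightarrow> 'a \<Rightarrow> real"
where
  "sup_U \<mu> \<delta> \<sigma> v Z W t s \<omega> = (SUP r\<in>{t..s}. U_proc \<mu> \<delta> \<sigma> v Z W t r \<omega>)"

text \<open>The measures are specified through their density on \<open>F T\<close>, and accordingly live on the
  \<sigma>-algebra \<open>F T\<close>.\<close>

definition Q1_measure ::
  "'a measure \<Rightarrow> (real \<Rightarrow> 'a measure) \<Rightarrow> real \<Rightarrow> (real \<Rightarrow> 'a \<Rightarrow> real) \<Rightarrow> real \<Rightarrow> real \<Rightarrow> 'a measure"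
where
  "Q1_measure P F T W \<sigma> t = density (restr_to_subalg P (F T))
     (\<lambda>\<omega>. ennreal (exp (- \<sigma> * (W T \<omega> - W t \<omega>) - \<sigma>\<^sup>2 / 2 * (T - t))))"

definition Q2_measure ::
  "'a measure \<Rightarrow> (real \<Rightarrow> 'a measure) \<Rightarrow> real \<Rightarrow> (real \<Rightarrow> 'a \<Rightarrow> real) \<Rightarrow> real \<Rightarrow> real \<Rightarrow> 'a measure"
where
  "Q2_measure P F T W \<sigma> t = density (restr_to_subalg P (F T))
     (\<lambda>\<omega>. ennreal (exp (\<sigma> * (W T \<omega> - W t \<omega>) - \<sigma>\<^sup>2 / 2 * (T - t))))"

definition has_density :: "'a measure \<Rightarrow> ('a \<Rightarrow> real) \<Rightarrow> (real \<Rightarrow> real) \<Rightarrow> bool" where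
  "has_density N X p \<longleftrightarrow> (\<forall>u. 0 \<le> p u) \<and> distributed N lborel X (\<lambda>u. ennreal (p u))"

definition locally_bounded :: "(real \<Rightarrow> real) \<Rightarrow> bool" where
  "locally_bounded p \<longleftrightarrow> (\<forall>u. \<exists>N. open N \<and> u \<in> N \<and> bounded (p ` N))"

end

theory Submission
  imports Defs "HOL-Real_Asymp.Real_Asymp"
begin

text \<open>
  The distribution function of the supremum $S$ of $U$ over $[t,s]$ is globally Lipschitz, so that
  $S$ has a bounded density. Replace $U$ by its Riemann-sum analogue $V_0,\dots,V_{4l}$, a function
  of $4l$ Gaussian increments, and let $l\to\infty$ at the end. If the maximum of $V$ lies in
  $(u,v)$, there are two cases.

  Early passage: $V$ exceeds $u$ at a time $i\le 2l$ and afterwards climbs by less than $v-u$. Since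
  the integral part of $U$ is nondecreasing, an exponential martingale then stays below a level
  $1+O(v-u)$ for $2l$ further steps; its square grows in mean, which makes this event have
  probability $O(v-u)$.

  Late passage: the maximum over $i\ge 2l$ lies in $(u,v)$. It has the form $kJ+X_{2l}\rho$ with
  $J$ the integral of $X=1/K$ up to step $2l$ and $\rho$ independent of the first $2l$ increments.
  Shifting the path by a multiple $r\in[0,1]$ of a hat function that vanishes at both ends
  increases $J$ and keeps $X_{2l}$; averaging the Cameron-Martin formula over $r$ bounds the
  probability by $v-u$ times the expected inverse slope, uniformly in $\rho$.

  The exponential weights defining the measures $\mathbb{Q}_i$ only change the drift of the
  increments, hence the exponent $b$ of $X_i$.
\<close>
subsection \<open>Sequences of independent centred Gaussian variables\<close>

text \<open>The two cases fail in different places. Soon after the start the integral part is almost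
  zero and the process is close to a deterministic value, so no shift of the path moves the maximum
  at a controlled rate; only the roughness of the Brownian path keeps mass from piling up there.
  Once the integral has run for a positive time, a shift moves all later values by a common amount,
  wherever the maximum is attained. Discretisation replaces stopping times and conditional
  expectations: the Markov property becomes the splitting off of increments, and Cameron-Martin
  becomes a finite change of variables. Its price is the overshoot of a level at first passage,
  which is controlled by a fourth moment of order \<open>h^2\<close> per step, so that it vanishes
  after summation over about \<open>1 / h\<close> steps. The constants depend on \<open>l\<close>
  and \<open>h\<close> only through the product \<open>l * h\<close>, which stays fixed under
  refinement; hence a single Lipschitz constant survives the limit.\<close>

locale gauss_seq =
  fixes h :: real
  assumes h_pos: "0 < h"
begin

definition G :: "real measure" where
  "G = density lborel (\<lambda>x. ennreal (normal_density 0 (sqrt h) x))"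

text \<open>An infinite sequence, although only finitely many coordinates ever matter: prepending
  with \<open>case_nat\<close> and gluing with \<open>comb_seq\<close> stay inside one space, so
  inductions over the number of steps never change the measure.\<close>

definition GS :: "(nat \<Rightarrow> real) measure" where
  "GS = (\<Pi>\<^sub>M i\<in>UNIV. G)"

lemma sets_G [measurable_cong, simp]: "sets G = sets borel"
  by (simp add: G_def)

lemma space_G [simp]: "space G = UNIV"
  by (simp add: G_def)

lemma measurable_G [simp]: "measurable G M = measurable borel M"
  by (rule measurable_cong_sets) auto

sublocale G: prob_space G
  unfolding G_def using h_pos by (intro prob_space_normal_density) auto

sublocale S: sequence_space G
  by standard

lemma sets_GS [measurable_cong]: "sets GS = sets (\<Pi>\<^sub>M i\<in>UNIV. borel)"
  unfolding GS_def by (intro sets_PiM_cong) auto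

lemma space_GS [simp]: "space GS = UNIV"
  by (simp add: GS_def space_PiM)

sublocale GS: prob_space GS
  unfolding GS_def by (rule S.P.prob_space_axioms)

lemma GS_component [measurable]: "(\<lambda>\<omega>. \<omega> i) \<in> borel_measurable GS"
  by (subst measurable_cong_sets[OF sets_GS refl]) measurable

lemma measurable_case_nat_pair [measurable]:
  "(\<lambda>(x, \<omega>). case_nat x \<omega>) \<in> G \<Otimes>\<^sub>M GS \<rightarrow>\<^sub>M GS"
  unfolding GS_def by measurable

lemma measurable_case_nat_GS: "(\<lambda>\<omega>. case_nat x \<omega>) \<in> GS \<rightarrow>\<^sub>M GS"
  using measurable_Pair2[OF measurable_case_nat_pair, of x] by simp

lemma measurable_GS_I:
  assumes "\<And>i. (\<lambda>x. f x i) \<in> borel_measurable M"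
  shows "f \<in> M \<rightarrow>\<^sub>M GS"
  by (subst measurable_cong_sets[OF refl sets_GS], rule measurable_PiM_single')
     (use assms in auto)

lemma nn_integral_GS_Suc:
  assumes [measurable]: "f \<in> borel_measurable GS"
  shows "(\<integral>\<^sup>+\<omega>. f \<omega> \<partial>GS) = (\<integral>\<^sup>+x. \<integral>\<^sup>+\<omega>. f (case_nat x \<omega>) \<partial>GS \<partial>G)"
proof -
  have "(\<integral>\<^sup>+\<omega>. f \<omega> \<partial>GS) = (\<integral>\<^sup>+\<omega>. f \<omega> \<partial>(distr (G \<Otimes>\<^sub>M GS) GS (\<lambda>(x, \<omega>). case_nat x \<omega>)))"
    unfolding GS_def by (subst S.PiM_iter) simp
  also have "\<dots> = (\<integral>\<^sup>+p. f (case p of (x, \<omega>) \<Rightarrow> case_nat x \<omega>) \<partial>(G \<Otimes>\<^sub>M GS))"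
    by (subst nn_integral_distr) auto
  also have "\<dots> = (\<integral>\<^sup>+x. \<integral>\<^sup>+\<omega>. f (case_nat x \<omega>) \<partial>GS \<partial>G)"
    by (subst GS.nn_integral_fst[symmetric]) auto
  finally show ?thesis .
qed

text \<open>Independence of the first \<open>n\<close> coordinates from the rest. The rest
  \<open>\<omega>'\<close> is in the outer integral, so that whatever depends on later increments is
  a constant for the inner one.\<close>

lemma nn_integral_GS_split:
  assumes [measurable]: "f \<in> borel_measurable GS"
  shows "(\<integral>\<^sup>+\<omega>. f \<omega> \<partial>GS) = (\<integral>\<^sup>+\<omega>'. \<integral>\<^sup>+\<omega>. f (comb_seq n \<omega> \<omega>') \<partial>GS \<partial>GS)"
proof -
  interpret pair_prob_space GS GS ..
  have [measurable]: "(\<lambda>(\<omega>, \<omega>'). comb_seq n \<omega> \<omega>') \<in> GS \<Otimes>\<^sub>M GS \<rightarrow>\<^sub>M GS"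
    unfolding GS_def by (rule measurable_comb_seq)
  have "(\<integral>\<^sup>+\<omega>. f \<omega> \<partial>GS) = (\<integral>\<^sup>+\<omega>. f \<omega> \<partial>(distr (GS \<Otimes>\<^sub>M GS) GS (\<lambda>(\<omega>, \<omega>'). comb_seq n \<omega> \<omega>')))"
    unfolding GS_def by (subst S.PiM_comb_seq) simp
  also have "\<dots> = (\<integral>\<^sup>+p. f (case p of (\<omega>, \<omega>') \<Rightarrow> comb_seq n \<omega> \<omega>') \<partial>(GS \<Otimes>\<^sub>M GS))"
    by (subst nn_integral_distr) auto
  also have "\<dots> = (\<integral>\<^sup>+\<omega>'. \<integral>\<^sup>+\<omega>. f (comb_seq n \<omega> \<omega>') \<partial>GS \<partial>GS)"
    by (subst nn_integral_snd[symmetric]) auto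
  finally show ?thesis .
qed

text \<open>One-dimensional Cameron-Martin formula: the exponential factor is the ratio of the
  normal densities at \<open>x + c\<close> and at \<open>x\<close>, and Lebesgue measure is
  translation invariant.\<close>

lemma nn_integral_G_shift:
  assumes [measurable]: "f \<in> borel_measurable borel"
  shows "(\<integral>\<^sup>+x. f (x + c) * ennreal (exp (- c * x / h - c\<^sup>2 / (2 * h))) \<partial>G) = (\<integral>\<^sup>+x. f x \<partial>G)"
proof -
  have eq: "normal_density 0 (sqrt h) x * exp (- c * x / h - c\<^sup>2 / (2 * h)) = normal_density 0 (sqrt h) (c + x)" for x
  proof -
    have "- (x\<^sup>2) / (2 * h) + (- c * x / h - c\<^sup>2 / (2 * h)) = - ((c + x)\<^sup>2) / (2 * h)"
      using h_pos by (simp add: field_simps power2_eq_square)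
    then show ?thesis
      using h_pos unfolding normal_density_def by (simp add: exp_add[symmetric] mult.assoc)
  qed
  have "(\<integral>\<^sup>+x. f (x + c) * ennreal (exp (- c * x / h - c\<^sup>2 / (2 * h))) \<partial>G) =
      (\<integral>\<^sup>+x. ennreal (normal_density 0 (sqrt h) x) * (f (x + c) * ennreal (exp (- c * x / h - c\<^sup>2 / (2 * h)))) \<partial>lborel)"
    unfolding G_def by (subst nn_integral_density) auto
  also have "\<dots> = (\<integral>\<^sup>+x. ennreal (normal_density 0 (sqrt h) (c + x)) * f (c + x) \<partial>lborel)"
  proof (intro nn_integral_cong)
    fix x
    have "ennreal (normal_density 0 (sqrt h) x) * ennreal (exp (- c * x / h - c\<^sup>2 / (2 * h))) = ennreal (normal_density 0 (sqrt h) (c + x))"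
      by (subst ennreal_mult[symmetric]) (auto simp only: eq normal_density_nonneg exp_ge_zero)
    then show "ennreal (normal_density 0 (sqrt h) x) * (f (x + c) * ennreal (exp (- c * x / h - c\<^sup>2 / (2 * h)))) =
       ennreal (normal_density 0 (sqrt h) (c + x)) * f (c + x)"
      by (metis add.commute mult.assoc mult.commute)
  qed
  also have "\<dots> = (\<integral>\<^sup>+x. ennreal (normal_density 0 (sqrt h) x) * f x \<partial>lborel)"
    by (subst (2) lborel_distr_plus[of c, symmetric]) (simp add: nn_integral_distr)
  also have "\<dots> = (\<integral>\<^sup>+x. f x \<partial>G)"
    unfolding G_def by (subst nn_integral_density) auto
  finally show ?thesis .
qed

text \<open>The moment generating function is the shift formula for the constant 1 with
  \<open>c = - \<alpha> * h\<close>, where completing the square is already done.\<close>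

lemma nn_integral_G_exp: "(\<integral>\<^sup>+x. ennreal (exp (\<alpha> * x)) \<partial>G) = ennreal (exp (\<alpha>\<^sup>2 * h / 2))"
proof -
  have "(\<integral>\<^sup>+x. ennreal (exp (\<alpha> * x)) \<partial>G) =
      (\<integral>\<^sup>+x. ennreal (exp (\<alpha>\<^sup>2 * h / 2)) * ennreal (exp (- (- \<alpha> * h) * x / h - (- \<alpha> * h)\<^sup>2 / (2 * h))) \<partial>G)"
    by (intro nn_integral_cong, subst ennreal_mult[symmetric])
       (use h_pos in \<open>auto simp: exp_add[symmetric] power2_eq_square field_simps\<close>)
  also have "\<dots> = ennreal (exp (\<alpha>\<^sup>2 * h / 2)) * (\<integral>\<^sup>+x. 1 \<partial>G)"
    using nn_integral_G_shift[of "\<lambda>_. 1" "- \<alpha> * h"] by (subst nn_integral_cmult) auto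
  finally show ?thesis by (simp add: G.emeasure_space_1[simplified])
qed

lemma has_bochner_integral_G_exp:
  "has_bochner_integral G (\<lambda>x. exp (\<alpha> * x)) (exp (\<alpha>\<^sup>2 * h / 2))"
  by (rule has_bochner_integral_nn_integral) (auto simp: nn_integral_G_exp)

text \<open>The density of a shift with finite support is a product over coordinates; the induction
  splits off coordinate 0 and hands the remaining shift \<open>d\<close> to the tail.\<close>

lemma nn_integral_GS_shift:
  assumes "f \<in> borel_measurable GS" and "\<And>i. n \<le> i \<Longrightarrow> c i = 0"
  shows "(\<integral>\<^sup>+\<omega>. f (\<lambda>i. \<omega> i + c i) * ennreal (exp (\<Sum>i<n. - c i * \<omega> i / h - (c i)\<^sup>2 / (2 * h))) \<partial>GS) = (\<integral>\<^sup>+\<omega>. f \<omega> \<partial>GS)"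
  using assms
proof (induction n arbitrary: f c)
  case 0
  then show ?case by simp
next
  case (Suc n)
  note [measurable] = Suc.prems(1)
  define d where "d = (\<lambda>i. c (Suc i))"
  have [measurable]: "(\<lambda>\<omega>. \<lambda>i. \<omega> i + c i) \<in> GS \<rightarrow>\<^sub>M GS"
    by (rule measurable_GS_I) auto
  have f1[measurable]: "(\<lambda>\<omega>. f (case_nat x \<omega>)) \<in> borel_measurable GS" for x
    using measurable_case_nat_GS[of x] by measurable
  have [measurable]: "(\<lambda>x. \<integral>\<^sup>+\<omega>. f (case_nat x \<omega>) \<partial>GS) \<in> borel_measurable borel"
  proof -
    have "(\<lambda>x. \<integral>\<^sup>+\<omega>. f (case_nat x \<omega>) \<partial>GS) \<in> borel_measurable G"
      by measurable
    then show ?thesis by (simp cong: measurable_cong_sets)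
  qed
  have shift: "(\<lambda>i. case_nat x \<omega> i + c i) = case_nat (x + c 0) (\<lambda>i. \<omega> i + d i)" for x \<omega>
    by (auto simp: d_def fun_eq_iff split: nat.split)
  have [measurable]: "(\<lambda>\<omega>. \<lambda>i. \<omega> i + d i) \<in> GS \<rightarrow>\<^sub>M GS"
    by (rule measurable_GS_I) auto
  have "(\<integral>\<^sup>+\<omega>. f (\<lambda>i. \<omega> i + c i) * ennreal (exp (\<Sum>i<Suc n. - c i * \<omega> i / h - (c i)\<^sup>2 / (2 * h))) \<partial>GS)
     = (\<integral>\<^sup>+x. \<integral>\<^sup>+\<omega>. f (case_nat (x + c 0) (\<lambda>i. \<omega> i + d i)) * ennreal (exp (\<Sum>i<n. - d i * \<omega> i / h - (d i)\<^sup>2 / (2 * h)))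
          * ennreal (exp (- c 0 * x / h - (c 0)\<^sup>2 / (2 * h))) \<partial>GS \<partial>G)"
  proof (subst nn_integral_GS_Suc, measurable, intro nn_integral_cong)
    fix x \<omega>
    have "(\<Sum>i<Suc n. - c i * case_nat x \<omega> i / h - (c i)\<^sup>2 / (2 * h)) =
        (\<Sum>i<n. - d i * \<omega> i / h - (d i)\<^sup>2 / (2 * h)) + (- c 0 * x / h - (c 0)\<^sup>2 / (2 * h))"
      by (simp add: sum.lessThan_Suc_shift d_def del: sum.lessThan_Suc)
    then show "f (\<lambda>i. case_nat x \<omega> i + c i) * ennreal (exp (\<Sum>i<Suc n. - c i * case_nat x \<omega> i / h - (c i)\<^sup>2 / (2 * h))) =
      f (case_nat (x + c 0) (\<lambda>i. \<omega> i + d i)) * ennreal (exp (\<Sum>i<n. - d i * \<omega> i / h - (d i)\<^sup>2 / (2 * h)))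
          * ennreal (exp (- c 0 * x / h - (c 0)\<^sup>2 / (2 * h)))"
      by (simp only: shift exp_add ennreal_mult exp_ge_zero mult.assoc)
  qed
  also have "\<dots> = (\<integral>\<^sup>+x. (\<integral>\<^sup>+\<omega>. f (case_nat (x + c 0) (\<lambda>i. \<omega> i + d i)) * ennreal (exp (\<Sum>i<n. - d i * \<omega> i / h - (d i)\<^sup>2 / (2 * h))) \<partial>GS)
          * ennreal (exp (- c 0 * x / h - (c 0)\<^sup>2 / (2 * h))) \<partial>G)"
    by (intro nn_integral_cong nn_integral_multc) (use measurable_case_nat_GS in measurable)
  also have "\<dots> = (\<integral>\<^sup>+x. (\<integral>\<^sup>+\<omega>. f (case_nat (x + c 0) \<omega>) \<partial>GS)
          * ennreal (exp (- c 0 * x / h - (c 0)\<^sup>2 / (2 * h))) \<partial>G)"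
    by (subst Suc.IH[OF f1]) (auto simp: d_def Suc.prems)
  also have "\<dots> = (\<integral>\<^sup>+x. \<integral>\<^sup>+\<omega>. f (case_nat x \<omega>) \<partial>GS \<partial>G)"
    by (rule nn_integral_G_shift) measurable
  also have "\<dots> = (\<integral>\<^sup>+\<omega>. f \<omega> \<partial>GS)"
    by (rule nn_integral_GS_Suc[symmetric]) measurable
  finally show ?case .
qed

lemma nn_integral_GS_exp:
  "(\<integral>\<^sup>+\<omega>. ennreal (exp (\<Sum>i<n. \<alpha> i * \<omega> i)) \<partial>GS) = ennreal (exp (h / 2 * (\<Sum>i<n. (\<alpha> i)\<^sup>2)))"
proof -
  define c where "c = (\<lambda>i. if i < n then - h * \<alpha> i else 0)"
  have "(\<Sum>i<n. - c i * \<omega> i / h - (c i)\<^sup>2 / (2 * h)) = (\<Sum>i<n. \<alpha> i * \<omega> i) - h / 2 * (\<Sum>i<n. (\<alpha> i)\<^sup>2)" for \<omega>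
    using h_pos by (simp add: c_def sum_subtractf[symmetric] sum_distrib_left power2_eq_square field_simps)
  then have "(\<integral>\<^sup>+\<omega>. ennreal (exp (\<Sum>i<n. \<alpha> i * \<omega> i)) \<partial>GS) = 
    (\<integral>\<^sup>+\<omega>. ennreal (exp (h / 2 * (\<Sum>i<n. (\<alpha> i)\<^sup>2))) * ennreal (exp (\<Sum>i<n. - c i * \<omega> i / h - (c i)\<^sup>2 / (2 * h))) \<partial>GS)"
    by (intro nn_integral_cong, subst ennreal_mult[symmetric]) (auto simp: exp_add[symmetric])
  also have "\<dots> = ennreal (exp (h / 2 * (\<Sum>i<n. (\<alpha> i)\<^sup>2)))"
    using nn_integral_GS_shift[of "\<lambda>_. 1" n c]
    by (subst nn_integral_cmult) (auto simp: c_def GS.emeasure_space_1[simplified])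
  finally show ?thesis .
qed

subsection \<open>An exponential martingale that stays below a level\<close>

lemma sets_GS_Collect: "Measurable.pred GS P \<Longrightarrow> {\<omega>. P \<omega>} \<in> sets GS"
  by (simp add: pred_def)

lemma emeasure_GS_Suc:
  assumes [measurable]: "A \<in> sets GS"
  shows "emeasure GS A = (\<integral>\<^sup>+y. emeasure GS {\<omega>. case_nat y \<omega> \<in> A} \<partial>G)"
proof -
  have "emeasure GS A = (\<integral>\<^sup>+\<omega>. indicator A \<omega> \<partial>GS)"
    by simp
  also have "\<dots> = (\<integral>\<^sup>+y. \<integral>\<^sup>+\<omega>. indicator A (case_nat y \<omega>) \<partial>GS \<partial>G)"
    by (rule nn_integral_GS_Suc) measurable
  also have "\<dots> = (\<integral>\<^sup>+y. emeasure GS {\<omega>. case_nat y \<omega> \<in> A} \<partial>G)"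
  proof (intro nn_integral_cong)
    fix y
    have "{\<omega>. case_nat y \<omega> \<in> A} \<in> sets GS"
      using measurable_sets[OF measurable_case_nat_GS[of y] assms] by (simp add: vimage_def)
    then have "(\<integral>\<^sup>+\<omega>. indicator {\<omega>. case_nat y \<omega> \<in> A} \<omega> \<partial>GS) = emeasure GS {\<omega>. case_nat y \<omega> \<in> A}"
      by simp
    then show "(\<integral>\<^sup>+\<omega>. indicator A (case_nat y \<omega>) \<partial>GS) = emeasure GS {\<omega>. case_nat y \<omega> \<in> A}"
      by (simp add: indicator_def)
  qed
  finally show ?thesis .
qed

text \<open>Stochastic exponential of the random walk: every factor has mean 1, while its square has
  mean \<open>exp (\<theta>^2 * h)\<close>. This growth of the square drives the estimate
  below.\<close>

definition expmart :: "real \<Rightarrow> nat \<Rightarrow> (nat \<Rightarrow> real) \<Rightarrow> real" where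
  "expmart \<theta> m \<omega> = exp (\<theta> * (\<Sum>j<m. \<omega> j) - \<theta>\<^sup>2 * real m * h / 2)"

lemma expmart_measurable [measurable]: "expmart \<theta> m \<in> borel_measurable GS"
  unfolding expmart_def by measurable

lemma expmart_0 [simp]: "expmart \<theta> 0 \<omega> = 1"
  by (simp add: expmart_def)

lemma expmart_Suc_case_nat:
  "expmart \<theta> (Suc m) (case_nat y \<omega>) = exp (\<theta> * y - \<theta>\<^sup>2 * h / 2) * expmart \<theta> m \<omega>"
  by (simp add: expmart_def sum.lessThan_Suc_shift exp_add[symmetric] field_simps del: sum.lessThan_Suc)

text \<open>The mean of \<open>(\<zeta>^2 - 1)^4\<close> for a single factor \<open>\<zeta>\<close>
  of the martingale. The coefficients 28, 15, 6, 1 are \<open>m * (m - 1) / 2\<close> for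
  \<open>m = 8, 6, 4, 2\<close>. Since \<open>1 - 4 + 6 - 4 + 1 = 0\<close> and
  \<open>28 - 60 + 36 - 4 = 0\<close>, the value is of order \<open>h^2\<close>.\<close>

definition overshoot_moment :: "real \<Rightarrow> real" where
  "overshoot_moment \<theta> = exp (28 * (\<theta>\<^sup>2 * h)) - 4 * exp (15 * (\<theta>\<^sup>2 * h)) + 6 * exp (6 * (\<theta>\<^sup>2 * h)) - 4 * exp (\<theta>\<^sup>2 * h) + 1"

lemma has_bochner_integral_zeta_pow:
  "has_bochner_integral G (\<lambda>y. (exp (\<theta> * y - \<theta>\<^sup>2 * h / 2)) ^ m) (exp ((real m * (real m - 1) / 2) * (\<theta>\<^sup>2 * h)))"
proof -
  have "has_bochner_integral G (\<lambda>y. exp (- (real m * \<theta>\<^sup>2 * h / 2)) * exp ((real m * \<theta>) * y))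
     (exp (- (real m * \<theta>\<^sup>2 * h / 2)) * exp ((real m * \<theta>)\<^sup>2 * h / 2))"
    by (rule has_bochner_integral_mult_right) (rule has_bochner_integral_G_exp)
  moreover have "(\<lambda>y. exp (- (real m * \<theta>\<^sup>2 * h / 2)) * exp ((real m * \<theta>) * y)) = (\<lambda>y. (exp (\<theta> * y - \<theta>\<^sup>2 * h / 2)) ^ m)"
    by (simp add: fun_eq_iff exp_add[symmetric] exp_of_nat_mult[symmetric] algebra_simps)
  moreover have "exp (- (real m * \<theta>\<^sup>2 * h / 2)) * exp ((real m * \<theta>)\<^sup>2 * h / 2) = exp ((real m * (real m - 1) / 2) * (\<theta>\<^sup>2 * h))"
    by (simp add: exp_add[symmetric] algebra_simps power2_eq_square diff_divide_distrib)
  ultimately show ?thesis by simp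
qed

lemma has_bochner_integral_overshoot_moment:
  "has_bochner_integral G (\<lambda>y. ((exp (\<theta> * y - \<theta>\<^sup>2 * h / 2))\<^sup>2 - 1) ^ 4) (overshoot_moment \<theta>)"
proof -
  let ?z = "\<lambda>y. exp (\<theta> * y - \<theta>\<^sup>2 * h / 2)"
  note I = has_bochner_integral_zeta_pow[of \<theta>]
  have "has_bochner_integral G (\<lambda>y. ?z y ^ 8 - 4 * ?z y ^ 6 + 6 * ?z y ^ 4 - 4 * ?z y ^ 2 + ?z y ^ 0) (overshoot_moment \<theta>)"
    unfolding overshoot_moment_def
    by (rule has_bochner_integral_cong[THEN iffD1, OF refl refl _
       has_bochner_integral_add[OF has_bochner_integral_diff[OF has_bochner_integral_add[OF has_bochner_integral_diff
       [OF I[of 8] has_bochner_integral_mult_right[OF I[of 6], of 4]] has_bochner_integral_mult_right[OF I[of 4], of 6]]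
        has_bochner_integral_mult_right[OF I[of 2], of 4]] I[of 0]]]) simp
  moreover have "(z\<^sup>2 - 1) ^ 4 = z ^ 8 - 4 * z ^ 6 + 6 * z ^ 4 - 4 * z ^ 2 + z ^ 0" for z :: real
    by algebra
  ultimately show ?thesis by simp
qed

lemma overshoot_moment_nonneg: "0 \<le> overshoot_moment \<theta>"
  using has_bochner_integral_integral_eq[OF has_bochner_integral_overshoot_moment[of \<theta>], symmetric] by simp

text \<open>The bound is preserved by the induction step: for \<open>x \<le> 1 / 2\<close> it is at least 1, and for
  \<open>x > 1 / 2\<close> the mean growth of the square of the martingale pays for \<open>\<beta>\<close>. The constant \<open>K\<close>
  absorbs the overshoot at the first passage above 1, up to the fourth-moment error term.\<close>

lemma emeasure_expmart_stay_below:
  assumes A: "4 / 3 \<le> A" and \<beta>: "0 \<le> \<beta>" "\<beta> \<le> A * \<theta>\<^sup>2 * h / 4" and K: "0 < K"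
    and "real n * \<beta> \<le> 1" "0 < x" "x \<le> 1"
  shows "emeasure GS {\<omega>. \<forall>m\<le>n. x * expmart \<theta> m \<omega> \<le> 1} \<le>
    ennreal (A * (1 - x\<^sup>2) + 1 - real n * \<beta> + K + real n * (A ^ 4 * overshoot_moment \<theta> / K ^ 3))"
  using assms(5-)
proof (induction n arbitrary: x)
  case 0
  have "x\<^sup>2 \<le> 1" using 0 by (simp add: power_le_one)
  then have "1 \<le> A * (1 - x\<^sup>2) + 1 + K" using A K by simp
  then show ?case
    by (intro order.trans[OF GS.emeasure_le_1]) (auto simp: ennreal_ge_1)
next
  case (Suc n)
  let ?e = "A ^ 4 * overshoot_moment \<theta> / K ^ 3"
  have e: "0 \<le> ?e" using overshoot_moment_nonneg[of \<theta>] A K by simp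
  have x2: "x\<^sup>2 \<le> 1" using Suc.prems by (simp add: power_le_one)
  have n\<beta>: "real n * \<beta> \<le> 1" using Suc.prems(1) \<beta>(1) by (simp add: algebra_simps)
  show ?case
  proof (cases "x \<le> 1 / 2")
    case True
    have "x\<^sup>2 \<le> (1/2)\<^sup>2" using True Suc.prems by (intro power_mono) auto
    then have "3 / 4 \<le> 1 - x\<^sup>2" by (simp add: power2_eq_square)
    then have "1 \<le> A * (1 - x\<^sup>2)" using A mult_mono[of "4/3" A "3/4" "1 - x\<^sup>2"] by simp
    then have "1 \<le> A * (1 - x\<^sup>2) + 1 - real (Suc n) * \<beta> + K + real (Suc n) * ?e"
      using Suc.prems(1) K e mult_nonneg_nonneg[of "real (Suc n)" ?e] by linarith
    then show ?thesis
      by (intro order.trans[OF GS.emeasure_le_1]) (auto simp: ennreal_ge_1)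
  next
    case False
    define z where "z = (\<lambda>y. exp (\<theta> * y - \<theta>\<^sup>2 * h / 2))"
    define w where "w = (\<lambda>x. A * (1 - x\<^sup>2) + 1 - real n * \<beta> + K + real n * ?e)"
    \<comment> \<open>\<open>w\<close> is the bound with \<open>n\<close> steps left, evaluated
      after one step. It may become negative when that step leads above 1; the fourth-power term
      makes up for this, so \<open>g\<close> dominates the conditional probability for every
      \<open>y\<close>. Its mean is exactly one more summand \<open>?e\<close>.\<close>
    define g where "g = (\<lambda>y. w (x * z y) + A ^ 4 / K ^ 3 * ((z y)\<^sup>2 - 1) ^ 4)"
    have z_pos: "0 < z y" for y by (simp add: z_def)
    have g_nonneg: "0 \<le> g y" and bound: "emeasure GS {\<omega>. \<forall>m\<le>Suc n. x * expmart \<theta> m (case_nat y \<omega>) \<le> 1} \<le> ennreal (g y)" for y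
    proof -
      have pos4: "0 \<le> A ^ 4 / K ^ 3 * ((z y)\<^sup>2 - 1) ^ 4" using A K by simp
      have "0 \<le> g y \<and> emeasure GS {\<omega>. \<forall>m\<le>Suc n. x * expmart \<theta> m (case_nat y \<omega>) \<le> 1} \<le> ennreal (g y)"
      proof (cases "x * z y \<le> 1")
        case True
        have "(x * z y)\<^sup>2 \<le> 1" using True Suc.prems z_pos[of y] by (simp add: power_le_one)
        then have "0 \<le> A * (1 - (x * z y)\<^sup>2)" using A by simp
        then have w0: "0 \<le> w (x * z y)" unfolding w_def using n\<beta> K e mult_nonneg_nonneg[of "real n" ?e] by linarith
        have "{\<omega>. \<forall>m\<le>Suc n. x * expmart \<theta> m (case_nat y \<omega>) \<le> 1} \<subseteq> {\<omega>. \<forall>m\<le>n. (x * z y) * expmart \<theta> m \<omega> \<le> 1}"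
        proof safe
          fix \<omega> m assume "\<forall>m\<le>Suc n. x * expmart \<theta> m (case_nat y \<omega>) \<le> 1" "m \<le> n"
          then have "x * expmart \<theta> (Suc m) (case_nat y \<omega>) \<le> 1" by simp
          then show "x * z y * expmart \<theta> m \<omega> \<le> 1"
            by (simp only: expmart_Suc_case_nat z_def mult.assoc)
        qed
        then have "emeasure GS {\<omega>. \<forall>m\<le>Suc n. x * expmart \<theta> m (case_nat y \<omega>) \<le> 1} \<le> emeasure GS {\<omega>. \<forall>m\<le>n. (x * z y) * expmart \<theta> m \<omega> \<le> 1}"
          by (rule emeasure_mono) (rule sets_GS_Collect, measurable)
        also have "\<dots> \<le> ennreal (w (x * z y))"
          unfolding w_def using Suc.IH[OF n\<beta> _ True] Suc.prems z_pos[of y] by simp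
        also have "\<dots> \<le> ennreal (g y)" using pos4 by (intro ennreal_leI) (simp add: g_def)
        finally show ?thesis using pos4 w0 by (simp add: g_def)
      next
        case False
        have empty: "{\<omega>. \<forall>m\<le>Suc n. x * expmart \<theta> m (case_nat y \<omega>) \<le> 1} = {}"
          using False by (auto simp: expmart_Suc_case_nat z_def intro!: exI[of _ "Suc 0"])
        define d where "d = A * ((x * z y)\<^sup>2 - 1)"
        have d0: "0 \<le> d" using False A unfolding d_def by (intro mult_nonneg_nonneg) auto
        have dle: "d \<le> A * ((z y)\<^sup>2 - 1)"
          unfolding d_def using A x2 mult_right_mono[of "x\<^sup>2" 1 "(z y)\<^sup>2"] by (intro mult_left_mono) (auto simp: power_mult_distrib)
        \<comment> \<open>A jump is of order \<open>sqrt h\<close>, so a power above 2 is required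
          for an error that is \<open>o(h)\<close> per step; the fourth power keeps the error term a
          polynomial in \<open>z y\<close> with explicit moments.\<close>
        have "d - K \<le> d ^ 4 / K ^ 3"
        proof (cases "d \<le> K")
          case True then show ?thesis using K d0 by (smt (verit) divide_nonneg_nonneg zero_le_power)
        next
          case False
          then have "K ^ 3 * d \<le> d ^ 3 * d" using K by (intro mult_right_mono power_mono) auto
          also have "d ^ 3 * d = d ^ 4" by algebra
          finally have "d \<le> d ^ 4 / K ^ 3" using K by (simp add: field_simps)
          then show ?thesis using K by linarith
        qed
        also have "\<dots> \<le> (A * ((z y)\<^sup>2 - 1)) ^ 4 / K ^ 3"
          using K d0 dle by (intro divide_right_mono power_mono) auto
        finally have "d - K \<le> A ^ 4 / K ^ 3 * ((z y)\<^sup>2 - 1) ^ 4" by (simp add: power_mult_distrib)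
        moreover have "w (x * z y) = - d + 1 - real n * \<beta> + K + real n * ?e"
          by (simp add: w_def d_def algebra_simps)
        ultimately have "0 \<le> g y"
          unfolding g_def using n\<beta> mult_nonneg_nonneg[of "real n" ?e] e by linarith
        then show ?thesis unfolding empty by simp
      qed
      then show "0 \<le> g y" "emeasure GS {\<omega>. \<forall>m\<le>Suc n. x * expmart \<theta> m (case_nat y \<omega>) \<le> 1} \<le> ennreal (g y)" by auto
    qed
    have "has_bochner_integral G (\<lambda>y. (A + 1 - real n * \<beta> + K + real n * ?e) - A * x\<^sup>2 * (z y) ^ 2 + A ^ 4 / K ^ 3 * ((z y)\<^sup>2 - 1) ^ 4)
       ((A + 1 - real n * \<beta> + K + real n * ?e) - A * x\<^sup>2 * exp (\<theta>\<^sup>2 * h) + A ^ 4 / K ^ 3 * overshoot_moment \<theta>)"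
    proof (rule has_bochner_integral_add[OF has_bochner_integral_diff[OF _ has_bochner_integral_mult_right] has_bochner_integral_mult_right])
      show "has_bochner_integral G (\<lambda>y. A + 1 - real n * \<beta> + K + real n * ?e) (A + 1 - real n * \<beta> + K + real n * ?e)"
        using has_bochner_integral_mult_right[OF has_bochner_integral_zeta_pow[of \<theta> 0], of "A + 1 - real n * \<beta> + K + real n * ?e"]
        by simp
      show "has_bochner_integral G (\<lambda>y. (z y) ^ 2) (exp (\<theta>\<^sup>2 * h))"
        using has_bochner_integral_zeta_pow[of \<theta> 2] by (simp add: z_def)
      show "has_bochner_integral G (\<lambda>y. ((z y)\<^sup>2 - 1) ^ 4) (overshoot_moment \<theta>)"
        unfolding z_def by (rule has_bochner_integral_overshoot_moment)
    qed
    moreover have "(\<lambda>y. (A + 1 - real n * \<beta> + K + real n * ?e) - A * x\<^sup>2 * (z y) ^ 2 + A ^ 4 / K ^ 3 * ((z y)\<^sup>2 - 1) ^ 4) = g"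
      by (simp add: g_def w_def fun_eq_iff power_mult_distrib algebra_simps)
    ultimately have g_int: "has_bochner_integral G g ((A + 1 - real n * \<beta> + K + real n * ?e) - A * x\<^sup>2 * exp (\<theta>\<^sup>2 * h) + A ^ 4 / K ^ 3 * overshoot_moment \<theta>)"
      by simp
    have "emeasure GS {\<omega>. \<forall>m\<le>Suc n. x * expmart \<theta> m \<omega> \<le> 1}
       = (\<integral>\<^sup>+y. emeasure GS {\<omega>. case_nat y \<omega> \<in> {\<omega>. \<forall>m\<le>Suc n. x * expmart \<theta> m \<omega> \<le> 1}} \<partial>G)"
      by (rule emeasure_GS_Suc) (rule sets_GS_Collect, measurable)
    also have "\<dots> \<le> (\<integral>\<^sup>+y. ennreal (g y) \<partial>G)"
      using bound by (intro nn_integral_mono) simp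
    also have "\<dots> = ennreal ((A + 1 - real n * \<beta> + K + real n * ?e) - A * x\<^sup>2 * exp (\<theta>\<^sup>2 * h) + A ^ 4 / K ^ 3 * overshoot_moment \<theta>)"
      using g_int g_nonneg by (subst nn_integral_eq_integral) (auto simp: has_bochner_integral_iff)
    also have "\<dots> \<le> ennreal (A * (1 - x\<^sup>2) + 1 - real (Suc n) * \<beta> + K + real (Suc n) * ?e)"
    proof (rule ennreal_leI)
      have "(1/2)\<^sup>2 \<le> x\<^sup>2" using False by (intro power_mono) auto
      then have "1 / 4 \<le> x\<^sup>2" by (simp add: power2_eq_square)
      moreover have exp1: "\<theta>\<^sup>2 * h \<le> exp (\<theta>\<^sup>2 * h) - 1"
        using exp_ge_add_one_self[of "\<theta>\<^sup>2 * h"] by linarith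
      ultimately have "A * (1/4) * (\<theta>\<^sup>2 * h) \<le> A * x\<^sup>2 * (exp (\<theta>\<^sup>2 * h) - 1)"
        using A h_pos exp1 by (intro mult_mono) auto
      then have "\<beta> + A * x\<^sup>2 \<le> A * x\<^sup>2 * exp (\<theta>\<^sup>2 * h)" using \<beta> by (simp add: algebra_simps)
      then show "(A + 1 - real n * \<beta> + K + real n * ?e) - A * x\<^sup>2 * exp (\<theta>\<^sup>2 * h) + A ^ 4 / K ^ 3 * overshoot_moment \<theta>
         \<le> A * (1 - x\<^sup>2) + 1 - real (Suc n) * \<beta> + K + real (Suc n) * ?e"
        by (simp add: algebra_simps add_divide_distrib)
    qed
    finally show ?thesis .
  qed
qed

end

subsection \<open>The discretised functional\<close>

lemma sum_lessThan_add: "(\<Sum>j<m + n. f j) = (\<Sum>j<m. f j) + (\<Sum>j<n. f (m + j))"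
  for f :: "nat \<Rightarrow> 'a::comm_monoid_add"
  by (induction n) (simp_all add: add.assoc)

locale gauss_walk = gauss_seq +
  fixes b \<sigma> k :: real
  assumes \<sigma>_pos: "0 < \<sigma>" and k_pos: "0 < k"
begin

definition X :: "nat \<Rightarrow> (nat \<Rightarrow> real) \<Rightarrow> real" where
  "X i \<omega> = exp (b * (real i * h) - \<sigma> * (\<Sum>j<i. \<omega> j))"

definition V :: "(nat \<Rightarrow> real) \<Rightarrow> nat \<Rightarrow> (nat \<Rightarrow> real) \<Rightarrow> real" where
  "V z i \<omega> = k * h * (\<Sum>j<i. X j \<omega>) - X i \<omega> * z i"

lemma X_measurable [measurable]: "X i \<in> borel_measurable GS"
  unfolding X_def by measurable

lemma V_measurable [measurable]: "V z i \<in> borel_measurable GS"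
  unfolding V_def by measurable

lemma X_pos: "0 < X i \<omega>"
  by (simp add: X_def)

lemma X_0 [simp]: "X 0 \<omega> = 1"
  by (simp add: X_def)

lemma V_0 [simp]: "V z 0 \<omega> = - z 0"
  by (simp add: V_def)

lemma X_Suc_case_nat: "X (Suc i) (case_nat y \<omega>) = exp (b * h - \<sigma> * y) * X i \<omega>"
  by (simp add: X_def sum.lessThan_Suc_shift exp_add[symmetric] algebra_simps del: sum.lessThan_Suc)

text \<open>The Markov structure: prepending an increment acts on \<open>V\<close> as an affine map
  with positive slope and shifts the weights \<open>z\<close>. \<open>V_comb_seq\<close> is the
  version for \<open>n\<close> increments at once.\<close>

lemma V_Suc_case_nat:
  "V z (Suc i) (case_nat y \<omega>) = k * h + exp (b * h - \<sigma> * y) * V (\<lambda>i. z (Suc i)) i \<omega>"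
proof -
  have "(\<Sum>j<Suc i. X j (case_nat y \<omega>)) = 1 + exp (b * h - \<sigma> * y) * (\<Sum>j<i. X j \<omega>)"
    by (simp add: X_Suc_case_nat sum.lessThan_Suc_shift sum_distrib_left del: sum.lessThan_Suc)
  then show ?thesis by (simp add: V_def X_Suc_case_nat algebra_simps)
qed

lemma X_comb_seq: "X (n + i) (comb_seq n \<omega> \<omega>') = X n \<omega> * X i \<omega>'"
proof -
  have "(\<Sum>j<n + i. comb_seq n \<omega> \<omega>' j) = (\<Sum>j<n. \<omega> j) + (\<Sum>j<i. \<omega>' j)"
    using comb_seq_add[of n \<omega> \<omega>'] by (subst sum_lessThan_add) (simp add: comb_seq_less add.commute)
  then show ?thesis by (simp add: X_def exp_add[symmetric] algebra_simps)
qed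

lemma X_comb_seq_less: "i \<le> n \<Longrightarrow> X i (comb_seq n \<omega> \<omega>') = X i \<omega>"
  by (simp add: X_def comb_seq_less)

lemma V_comb_seq:
  "V z (n + i) (comb_seq n \<omega> \<omega>') = k * h * (\<Sum>j<n. X j \<omega>) + X n \<omega> * V (\<lambda>i. z (n + i)) i \<omega>'"
proof -
  have "(\<Sum>j<n + i. X j (comb_seq n \<omega> \<omega>')) = (\<Sum>j<n. X j \<omega>) + X n \<omega> * (\<Sum>j<i. X j \<omega>')"
    by (simp add: sum_lessThan_add X_comb_seq X_comb_seq_less sum_distrib_left)
  then show ?thesis by (simp only: V_def X_comb_seq) (simp add: algebra_simps)
qed

section \<open>Early passage: the process rarely stays below a level just above its current
  value\<close>

text \<open>Dropping the nonnegative integral part and bounding \<open>z i\<close> by its growth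
  leaves \<open>1 - y < exp ((b + \<Lambda>) * (real i * h) - \<sigma> * (\<Sum>j<i. \<omega>
  j))\<close>. The \<open>p\<close>-th power is taken because the compensator of the martingale is
  quadratic in \<open>p\<close> and the drift only linear: for large \<open>p\<close> the drift is
  absorbed, and \<open>(1 - y) ^ p * expmart (real p * \<sigma>) i \<omega>\<close> stays below
  1.\<close>

lemma emeasure_stay_below:
  assumes A: "4 / 3 \<le> A" and \<beta>: "0 \<le> \<beta>" "\<beta> \<le> A * (real p * \<sigma>)\<^sup>2 * h / 4" and K: "0 < K"
    and n\<beta>: "real n * \<beta> \<le> 1"
    and p: "1 \<le> p" "2 * (b + \<Lambda>) \<le> real p * \<sigma>\<^sup>2"
    and z: "0 < zmin" "zmin \<le> z 0" "\<And>i. i \<le> n \<Longrightarrow> z i \<le> exp (\<Lambda> * (real i * h)) * z 0"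
    and x: "0 < x" and J: "u \<le> J - x * z 0" and uv: "u \<le> v"
  shows "emeasure GS {\<omega>. \<forall>i\<le>n. J + x * V z i \<omega> < v} \<le>
    ennreal (2 * real p * A * (v - u) / zmin / x + (1 - real n * \<beta> + K + real n * (A ^ 4 * overshoot_moment (real p * \<sigma>) / K ^ 3)))"
    (is "_ \<le> ennreal (?D + ?R)")
proof -
  define y where "y = (v - u) / (x * zmin)"
  have y0: "0 \<le> y" using uv x z by (simp add: y_def)
  have D: "?D = A * (2 * real p * y)" by (simp add: y_def field_simps)
  have R0: "0 \<le> ?R" using overshoot_moment_nonneg[of "real p * \<sigma>"] K A n\<beta> by simp
  show ?thesis
  proof (cases "y < 1")
    case False
    \<comment> \<open>For \<open>1 \<le> y\<close> the asserted bound already exceeds 1.\<close>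
    have "1 \<le> 2 * real p * y" using False p mult_mono[of 1 "2 * real p" 1 y] by simp
    then have "1 * 1 \<le> A * (2 * real p * y)" using A by (intro mult_mono) auto
    then show ?thesis using R0 unfolding D
      by (intro order.trans[OF GS.emeasure_le_1]) (auto simp: ennreal_ge_1)
  next
    case True
    have sub: "{\<omega>. \<forall>i\<le>n. J + x * V z i \<omega> < v} \<subseteq> {\<omega>. \<forall>m\<le>n. (1 - y) ^ p * expmart (real p * \<sigma>) m \<omega> \<le> 1}"
    proof safe
      fix \<omega> i assume *: "\<forall>i\<le>n. J + x * V z i \<omega> < v" and i: "i \<le> n"
      have "0 \<le> x * (k * h * (\<Sum>j<i. X j \<omega>))"
        using x k_pos h_pos X_pos by (intro mult_nonneg_nonneg sum_nonneg) (auto intro: less_imp_le)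
      then have "J - x * (X i \<omega> * z i) < v"
        using *[rule_format, OF i] by (simp add: V_def algebra_simps)
      then have "x * z 0 - (v - u) < x * (X i \<omega> * z i)" using J by linarith
      then have "z 0 - (v - u) / x < X i \<omega> * z i" using x by (simp add: field_simps)
      also have "\<dots> \<le> X i \<omega> * (exp (\<Lambda> * (real i * h)) * z 0)"
        using X_pos[of i \<omega>] z(3)[OF i] by (intro mult_left_mono) auto
      finally have "1 - (v - u) / (x * z 0) < X i \<omega> * exp (\<Lambda> * (real i * h))"
        using z x by (simp add: field_simps)
      moreover have "(v - u) / (x * z 0) \<le> y"
        unfolding y_def using uv x z by (intro divide_left_mono mult_left_mono mult_pos_pos) auto
      ultimately have "1 - y < X i \<omega> * exp (\<Lambda> * (real i * h))" by linarith
      also have "\<dots> = exp ((b + \<Lambda>) * (real i * h) - \<sigma> * (\<Sum>j<i. \<omega> j))"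
        by (simp add: X_def exp_add[symmetric] algebra_simps)
      finally have "(1 - y) ^ p \<le> exp ((b + \<Lambda>) * (real i * h) - \<sigma> * (\<Sum>j<i. \<omega> j)) ^ p"
        using True by (intro power_mono) auto
      also have "\<dots> = exp (real p * ((b + \<Lambda>) * (real i * h) - \<sigma> * (\<Sum>j<i. \<omega> j)))"
        by (simp add: exp_of_nat_mult)
      finally have "(1 - y) ^ p * expmart (real p * \<sigma>) i \<omega> \<le>
          exp (real p * ((b + \<Lambda>) * (real i * h) - \<sigma> * (\<Sum>j<i. \<omega> j))) * expmart (real p * \<sigma>) i \<omega>"
        by (intro mult_right_mono) (auto simp: expmart_def)
      also have "\<dots> = exp ((real p * (real i * h)) * ((b + \<Lambda>) - real p * \<sigma>\<^sup>2 / 2))"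
        by (simp add: expmart_def exp_add[symmetric] algebra_simps power2_eq_square)
      also have "\<dots> \<le> 1"
        using p h_pos by (simp add: mult_nonneg_nonpos)
      finally show "(1 - y) ^ p * expmart (real p * \<sigma>) i \<omega> \<le> 1" .
    qed
    have "emeasure GS {\<omega>. \<forall>i\<le>n. J + x * V z i \<omega> < v} \<le> emeasure GS {\<omega>. \<forall>m\<le>n. (1 - y) ^ p * expmart (real p * \<sigma>) m \<omega> \<le> 1}"
      by (rule emeasure_mono[OF sub]) (rule sets_GS_Collect, measurable)
    also have "\<dots> \<le> ennreal (A * (1 - ((1 - y) ^ p)\<^sup>2) + 1 - real n * \<beta> + K + real n * (A ^ 4 * overshoot_moment (real p * \<sigma>) / K ^ 3))"
      using True y0 by (intro emeasure_expmart_stay_below A \<beta> K n\<beta>) (auto intro: power_le_one)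
    also have "\<dots> \<le> ennreal (?D + ?R)"
    proof (rule ennreal_leI)
      \<comment> \<open>Bernoulli makes the start deficit \<open>1 - ((1 - y) ^ p)^2\<close> linear
        in \<open>y\<close>, hence in \<open>v - u\<close>.\<close>
      have "1 + real (2 * p) * (- y) \<le> (1 + (- y)) ^ (2 * p)"
        using True by (intro Bernoulli_inequality) auto
      then have "1 - ((1 - y) ^ p)\<^sup>2 \<le> 2 * real p * y"
        by (simp add: power_mult[symmetric] mult.commute)
      then have "A * (1 - ((1 - y) ^ p)\<^sup>2) \<le> ?D"
        unfolding D using A by (intro mult_left_mono) auto
      then show "A * (1 - ((1 - y) ^ p)\<^sup>2) + 1 - real n * \<beta> + K + real n * (A ^ 4 * overshoot_moment (real p * \<sigma>) / K ^ 3) \<le> ?D + ?R"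
        by linarith
    qed
    finally show ?thesis .
  qed
qed

text \<open>Up to the passage above \<open>u\<close>, \<open>D / X i * exp (\<kappa> * h * (m - i))\<close> is a supermartingale.\<close>

lemma emeasure_early_passage:
  fixes D R :: real
  assumes D: "0 \<le> D" and R: "0 \<le> R" and \<kappa>: "\<sigma>\<^sup>2 / 2 - b \<le> \<kappa>" "0 \<le> \<kappa>"
    and stay: "\<And>J x z. 0 < x \<Longrightarrow> u \<le> J - x * z 0 \<Longrightarrow> zmin \<le> z 0 \<Longrightarrow>
        (\<And>i. z (Suc i) \<le> exp (\<Lambda> * h) * z i) \<Longrightarrow>
        emeasure GS {\<omega>. \<forall>i\<le>n. J + x * V z i \<omega> < v} \<le> ennreal (D / x + R)"
    and "0 < x" "\<And>i. zmin \<le> z i" "\<And>i. z (Suc i) \<le> exp (\<Lambda> * h) * z i"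
  shows "emeasure GS {\<omega>. (\<exists>i\<le>m. u < J + x * V z i \<omega>) \<and> (\<forall>i\<le>m + n. J + x * V z i \<omega> < v)}
     \<le> ennreal (D / x * exp (\<kappa> * h * real m) + R)"
  using assms(6-)
proof (induction m arbitrary: J x z)
  case 0
  show ?case
  proof (cases "u < J - x * z 0")
    case True
    have "emeasure GS {\<omega>. (\<exists>i\<le>0. u < J + x * V z i \<omega>) \<and> (\<forall>i\<le>0 + n. J + x * V z i \<omega> < v)} 
      \<le> emeasure GS {\<omega>. \<forall>i\<le>n. J + x * V z i \<omega> < v}"
      by (rule emeasure_mono, force) (rule sets_GS_Collect, measurable)
    also have "\<dots> \<le> ennreal (D / x + R)" using 0 True by (intro stay) auto
    finally show ?thesis by simp
  qed simp
next
  case (Suc m)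
  show ?case
  proof (cases "u < J - x * z 0")
    case True
    have "emeasure GS {\<omega>. (\<exists>i\<le>Suc m. u < J + x * V z i \<omega>) \<and> (\<forall>i\<le>Suc m + n. J + x * V z i \<omega> < v)} 
      \<le> emeasure GS {\<omega>. \<forall>i\<le>n. J + x * V z i \<omega> < v}"
      by (rule emeasure_mono, force) (rule sets_GS_Collect, measurable)
    also have "\<dots> \<le> ennreal (D / x + R)" using Suc.prems True by (intro stay) auto
    also have "\<dots> \<le> ennreal (D / x * exp (\<kappa> * h * real (Suc m)) + R)"
    proof (intro ennreal_leI add_right_mono)
      show "D / x \<le> D / x * exp (\<kappa> * h * real (Suc m))"
        using mult_left_mono[of 1 "exp (\<kappa> * h * real (Suc m))" "D / x"] D Suc.prems(1) \<kappa> h_pos by simp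
    qed
    finally show ?thesis by simp
  next
    case False
    let ?z = "\<lambda>i. z (Suc i)"
    let ?E = "{\<omega>. (\<exists>i\<le>Suc m. u < J + x * V z i \<omega>) \<and> (\<forall>i\<le>Suc m + n. J + x * V z i \<omega> < v)}"
    \<comment> \<open>Given the first increment \<open>y\<close>, the event is of the same form with
      \<open>J + x * (k * h)\<close> and \<open>f y\<close> in place of \<open>J\<close> and
      \<open>x\<close>, so the induction hypothesis applies to each \<open>y\<close>
      separately.\<close>
    define f where "f = (\<lambda>y. x * exp (b * h - \<sigma> * y))"
    have f_pos: "0 < f y" for y using Suc.prems by (simp add: f_def)
    define c where "c = D / x * exp (\<kappa> * h * real m) * exp (- b * h)"
    have c0: "0 \<le> c" using D Suc.prems by (simp add: c_def)
    have bound: "emeasure GS {\<omega>. case_nat y \<omega> \<in> ?E} \<le> ennreal (c * exp (\<sigma> * y) + R)" for y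
    proof -
      have "{\<omega>. case_nat y \<omega> \<in> ?E} \<subseteq>
        {\<omega>. (\<exists>i\<le>m. u < (J + x * (k * h)) + f y * V ?z i \<omega>) \<and> (\<forall>i\<le>m + n. (J + x * (k * h)) + f y * V ?z i \<omega> < v)}"
      proof (safe, goal_cases)
        case (1 \<omega> i)
        \<comment> \<open>Passage at index 0 is excluded in this case, so the passage index has a
          predecessor in the shifted walk.\<close>
        then obtain i' where i': "i = Suc i'" using False by (cases i) auto
        then show ?case using 1 by (intro exI[of _ i']) (auto simp: V_Suc_case_nat f_def algebra_simps)
      next
        case (2 \<omega> i' i)
        then have "J + x * V z (Suc i) (case_nat y \<omega>) < v" by simp
        then show ?case by (simp add: V_Suc_case_nat f_def algebra_simps)
      qed
      then have "emeasure GS {\<omega>. case_nat y \<omega> \<in> ?E} \<le>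
        emeasure GS {\<omega>. (\<exists>i\<le>m. u < (J + x * (k * h)) + f y * V ?z i \<omega>) \<and> (\<forall>i\<le>m + n. (J + x * (k * h)) + f y * V ?z i \<omega> < v)}"
        by (rule emeasure_mono) (rule sets_GS_Collect, measurable)
      also have "\<dots> \<le> ennreal (D / f y * exp (\<kappa> * h * real m) + R)"
        using Suc.prems f_pos by (intro Suc.IH) auto
      also have "D / f y * exp (\<kappa> * h * real m) = c * exp (\<sigma> * y)"
        by (simp add: c_def f_def exp_diff exp_minus field_simps)
      finally show ?thesis .
    qed
    have "emeasure GS ?E = (\<integral>\<^sup>+y. emeasure GS {\<omega>. case_nat y \<omega> \<in> ?E} \<partial>G)"
      by (rule emeasure_GS_Suc) (rule sets_GS_Collect, measurable)
    also have "\<dots> \<le> (\<integral>\<^sup>+y. ennreal c * ennreal (exp (\<sigma> * y)) + ennreal R \<partial>G)"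
      using bound c0 R by (intro nn_integral_mono) (simp add: ennreal_plus ennreal_mult)
    also have "\<dots> = ennreal c * ennreal (exp (\<sigma>\<^sup>2 * h / 2)) + ennreal R"
      by (subst nn_integral_add, simp, simp, subst nn_integral_cmult)
         (simp_all add: nn_integral_G_exp G.emeasure_space_1[simplified])
    also have "\<dots> = ennreal (c * exp (\<sigma>\<^sup>2 * h / 2) + R)"
      using c0 R by (simp add: ennreal_plus ennreal_mult)
    also have "\<dots> \<le> ennreal (D / x * exp (\<kappa> * h * real (Suc m)) + R)"
    proof (intro ennreal_leI add_right_mono)
      \<comment> \<open>The mean of \<open>exp (\<sigma> * y - b * h)\<close> is
        \<open>exp ((\<sigma>^2 / 2 - b) * h)\<close>, and \<open>\<kappa>\<close> pays for it once
        per step.\<close>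
      have "(\<sigma>\<^sup>2 / 2 - b) * h \<le> \<kappa> * h" using \<kappa> h_pos by (intro mult_right_mono) auto
      then have "\<kappa> * h * real m + (- b * h) + \<sigma>\<^sup>2 * h / 2 \<le> \<kappa> * h * real (Suc m)"
        by (simp add: algebra_simps)
      then have "exp (\<kappa> * h * real m) * exp (- b * h) * exp (\<sigma>\<^sup>2 * h / 2) \<le> exp (\<kappa> * h * real (Suc m))"
        by (simp only: exp_add[symmetric] exp_le_cancel_iff)
      then show "c * exp (\<sigma>\<^sup>2 * h / 2) \<le> D / x * exp (\<kappa> * h * real (Suc m))"
        unfolding c_def using D Suc.prems(1) by (simp only: mult.assoc) (intro mult_left_mono, auto)
    qed
    finally show ?thesis .
  qed
qed

end

section \<open>Late passage: shifting the path along a hat function\<close>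

text \<open>The set lies within distance \<open>w / d\<close> of any of its points. Centring at an
  arbitrary point costs the factor 2 and avoids infima. This turns a lower bound on a slope into a
  bound on the set of admissible shift parameters.\<close>

lemma emeasure_lborel_le_of_diameter:
  fixes A :: "real set"
  assumes "0 < d" "0 \<le> w" and sep: "\<And>x y. x \<in> A \<Longrightarrow> y \<in> A \<Longrightarrow> x < y \<Longrightarrow> d * (y - x) \<le> w"
  shows "emeasure lborel A \<le> ennreal (2 * w / d)"
proof (cases "A = {}")
  case False
  then obtain a where a: "a \<in> A" by auto
  have "A \<subseteq> {a - w / d..a + w / d}"
  proof
    fix x assume x: "x \<in> A"
    have "y \<le> w / d" if "d * y \<le> w" for y
      using that assms(1) by (simp add: field_simps)
    then have "x < a \<Longrightarrow> a - x \<le> w / d" "a < x \<Longrightarrow> x - a \<le> w / d" "0 \<le> w / d"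
      using sep[OF x a] sep[OF a x] assms(1,2) by auto
    then show "x \<in> {a - w / d..a + w / d}"
      by (cases x a rule: linorder_cases) auto
  qed
  then have "emeasure lborel A \<le> emeasure lborel {a - w / d..a + w / d}"
    by (rule emeasure_mono) simp
  also have "\<dots> = ennreal (2 * w / d)"
    using assms(1,2) by (subst emeasure_lborel_Icc) (auto simp: field_simps)
  finally show ?thesis .
qed simp

lemma exp_diff_ge:
  fixes x y :: real
  assumes "0 \<le> x" "x \<le> y"
  shows "y - x \<le> exp y - exp x"
proof -
  have "y - x \<le> exp (y - x) - 1" using exp_ge_add_one_self[of "y - x"] by linarith
  also have "\<dots> \<le> exp x * (exp (y - x) - 1)"
    using mult_right_mono[of 1 "exp x" "exp (y - x) - 1"] assms by simp
  also have "\<dots> = exp y - exp x" by (simp add: exp_diff field_simps)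
  finally show ?thesis .
qed

lemma ennreal_distrib:
  "0 \<le> p \<Longrightarrow> 0 \<le> x \<Longrightarrow> 0 \<le> y \<Longrightarrow> ennreal (p * (x + y)) = ennreal p * (ennreal x + ennreal y)"
  by (simp add: ennreal_mult)

definition hat :: "nat \<Rightarrow> nat \<Rightarrow> real" where
  "hat l j = real (min j (2 * l - j))"

text \<open>The increments of \<open>- hat l\<close>. The sign is chosen because \<open>X\<close>
  decreases in the path: a positive multiple raises each \<open>X j\<close> by the factor
  \<open>exp (\<sigma> * r * h * hat l j)\<close>. The steps vanish from \<open>2 * l\<close> on, as
  the shift formula requires.\<close>

definition hat_step :: "nat \<Rightarrow> nat \<Rightarrow> real" where
  "hat_step l j = (if j < l then -1 else if j < 2 * l then 1 else 0)"

lemma hat_nonneg: "0 \<le> hat l j"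
  by (simp add: hat_def)

lemma sum_hat_step: "j \<le> 2 * l \<Longrightarrow> (\<Sum>i<j. hat_step l i) = - hat l j"
  by (induction j) (auto simp: hat_def hat_step_def min_def of_nat_diff)

lemma sum_hat: "(\<Sum>j<2 * l. hat l j) = (real l)\<^sup>2"
proof -
  have "(\<Sum>j<2 * l. hat l j) = (\<Sum>j<l. hat l j) + (\<Sum>j<l. hat l (l + j))"
    using sum_lessThan_add[of "hat l" l l] by (simp add: mult_2)
  \<comment> \<open>The values of the hat at \<open>j\<close> and at \<open>l + j\<close> add up to
    \<open>l\<close>.\<close>
  also have "\<dots> = (\<Sum>j<l. real l)"
    unfolding sum.distrib[symmetric] by (intro sum.cong) (auto simp: hat_def min_def of_nat_diff)
  finally show ?thesis by (simp add: power2_eq_square)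
qed

context gauss_walk
begin

lemma X_hat_shift:
  assumes "j \<le> 2 * l"
  shows "X j (\<lambda>i. \<omega> i + r * (h * hat_step l i)) = X j \<omega> * exp (\<sigma> * r * h * hat l j)"
proof -
  have "(\<Sum>i<j. \<omega> i + r * (h * hat_step l i)) = (\<Sum>i<j. \<omega> i) - r * h * hat l j"
    using sum_hat_step[OF assms] by (simp add: sum.distrib sum_distrib_left[symmetric] mult.assoc)
  then show ?thesis by (simp only: X_def) (simp add: exp_add[symmetric] algebra_simps)
qed

text \<open>The ingredient for the expected inverse slope. The integrand is the exponential of a
  linear form in \<open>2 * l\<close> Gaussian variables with coefficients at most
  \<open>1 + \<sigma>\<close> in modulus, which is why \<open>l\<close> enters the bound only
  through \<open>real l * h\<close>.\<close>

lemma nn_integral_exp_div_X_le: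
  assumes j: "j \<le> 2 * l" and s: "\<bar>s\<bar> \<le> 1"
  shows "(\<integral>\<^sup>+\<omega>. ennreal (exp (s * (\<Sum>i<2 * l. hat_step l i * \<omega> i)) / X j \<omega>) \<partial>GS)
     \<le> ennreal (exp (real l * h * (2 * \<bar>b\<bar> + (1 + \<sigma>)\<^sup>2)))"
proof -
  define \<alpha> where "\<alpha> = (\<lambda>i. s * hat_step l i + (if i < j then \<sigma> else 0))"
  have "(\<Sum>i<j. \<omega> i) = (\<Sum>i<2 * l. if i < j then \<omega> i else 0)" for \<omega> :: "nat \<Rightarrow> real"
    using j by (subst sum.inter_filter[symmetric]) (auto intro!: sum.cong)
  then have "(\<Sum>i<2 * l. \<alpha> i * \<omega> i) = s * (\<Sum>i<2 * l. hat_step l i * \<omega> i) + \<sigma> * (\<Sum>i<j. \<omega> i)" for \<omega> :: "nat \<Rightarrow> real"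
    unfolding sum_distrib_left by (simp only: sum.distrib[symmetric]) (auto simp: \<alpha>_def algebra_simps intro!: sum.cong)
  then have eq: "exp (s * (\<Sum>i<2 * l. hat_step l i * \<omega> i)) / X j \<omega> = exp (- b * (real j * h)) * exp (\<Sum>i<2 * l. \<alpha> i * \<omega> i)" for \<omega>
    by (simp add: X_def exp_diff[symmetric] exp_add[symmetric])
  have "\<bar>\<alpha> i\<bar> \<le> 1 + \<sigma>" for i
    using s \<sigma>_pos by (auto simp: \<alpha>_def hat_step_def)
  then have "(\<alpha> i)\<^sup>2 \<le> (1 + \<sigma>)\<^sup>2" for i
    using power_mono[of "\<bar>\<alpha> i\<bar>" "1 + \<sigma>" 2] by simp
  then have le: "(\<Sum>i<2 * l. (\<alpha> i)\<^sup>2) \<le> real (2 * l) * (1 + \<sigma>)\<^sup>2"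
    using sum_bounded_above[of "{..<2 * l}" "\<lambda>i. (\<alpha> i)\<^sup>2"] by simp
  have "(\<integral>\<^sup>+\<omega>. ennreal (exp (s * (\<Sum>i<2 * l. hat_step l i * \<omega> i)) / X j \<omega>) \<partial>GS)
    = ennreal (exp (- b * (real j * h)) * exp (h / 2 * (\<Sum>i<2 * l. (\<alpha> i)\<^sup>2)))"
    by (simp add: eq ennreal_mult nn_integral_cmult nn_integral_GS_exp)
  also have "\<dots> \<le> ennreal (exp (real l * h * (2 * \<bar>b\<bar> + (1 + \<sigma>)\<^sup>2)))"
  proof (rule ennreal_leI)
    have "- b * (real j * h) \<le> \<bar>b\<bar> * (real (2 * l) * h)"
      using j h_pos by (intro mult_mono) auto
    moreover have "h / 2 * (\<Sum>i<2 * l. (\<alpha> i)\<^sup>2) \<le> h / 2 * (real (2 * l) * (1 + \<sigma>)\<^sup>2)"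
      using h_pos le by (intro mult_left_mono) auto
    ultimately show "exp (- b * (real j * h)) * exp (h / 2 * (\<Sum>i<2 * l. (\<alpha> i)\<^sup>2)) \<le> exp (real l * h * (2 * \<bar>b\<bar> + (1 + \<sigma>)\<^sup>2))"
      unfolding exp_add[symmetric] exp_le_cancel_iff by (simp add: algebra_simps)
  qed
  finally show ?thesis .
qed

lemma emeasure_affine_functional:
  assumes l: "1 \<le> l" and uv: "u \<le> v"
  shows "emeasure GS {\<omega>. u < k * h * (\<Sum>j<2 * l. X j \<omega>) + X (2 * l) \<omega> * \<rho> \<and> k * h * (\<Sum>j<2 * l. X j \<omega>) + X (2 * l) \<omega> * \<rho> < v}
    \<le> ennreal (4 * exp (real l * h * (2 * \<bar>b\<bar> + (1 + \<sigma>)\<^sup>2)) / (k * \<sigma> * (real l * h)\<^sup>2) * (v - u))"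
    (is "emeasure GS ?E \<le> ennreal (4 * ?C / _ * _)")
proof -
  let ?c = "\<lambda>r i. r * (h * hat_step l i)"
  let ?f = "\<lambda>\<omega>. k * h * (\<Sum>j<2 * l. X j \<omega>) + X (2 * l) \<omega> * \<rho>"
  define W where "W = (\<lambda>\<omega>. \<Sum>i<2 * l. hat_step l i * \<omega> i)"
  \<comment> \<open>Dominates the density weight for all \<open>r\<close> in \<open>[0,1]\<close> at
    once, since \<open>exp \<bar>w\<bar> \<le> exp (- w) + exp w\<close>. Being free of
    \<open>r\<close>, it leaves the average over \<open>r\<close>; the factors \<open>- 1\<close>
    and \<open>1\<close> are the two values of \<open>s\<close> inserted into the preceding
    lemma.\<close>
  define H where "H = (\<lambda>\<omega>. exp (- 1 * W \<omega>) + exp (1 * W \<omega>))"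
  \<comment> \<open>A lower bound, valid for all \<open>r \<ge> 0\<close>, for the derivative in
    \<open>r\<close> of the shifted functional: \<open>exp (\<sigma> * r * h * hat l j)\<close> has
    derivative at least \<open>\<sigma> * h * hat l j\<close>.\<close>
  define \<Delta> where "\<Delta> = (\<lambda>\<omega>. k * \<sigma> * h\<^sup>2 * (\<Sum>j<2 * l. hat l j * X j \<omega>))"
  have [measurable]: "W \<in> borel_measurable GS" unfolding W_def by measurable
  have [measurable]: "H \<in> borel_measurable GS" unfolding H_def by measurable
  have E[measurable]: "?E \<in> sets GS" by (rule sets_GS_Collect) measurable
  have [measurable]: "(\<lambda>(r, \<omega>). \<lambda>i. \<omega> i + ?c r i) \<in> lborel \<Otimes>\<^sub>M GS \<rightarrow>\<^sub>M GS"
    unfolding split_beta' by (rule measurable_GS_I) measurable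
  have l2: "0 < (real l)\<^sup>2" using l by simp
  have S_pos: "0 < (\<Sum>j<2 * l. hat l j * X j \<omega>)" for \<omega>
  proof -
    have "0 < hat l 1" using l by (simp add: hat_def)
    then have "0 < hat l 1 * X 1 \<omega>" using X_pos by simp
    moreover have "0 \<le> hat l j * X j \<omega>" for j using hat_nonneg[of l j] X_pos[of j \<omega>] by simp
    ultimately show ?thesis using l by (intro sum_pos2[of _ 1]) auto
  qed
  have \<Delta>_pos: "0 < \<Delta> \<omega>" for \<omega>
    unfolding \<Delta>_def using k_pos \<sigma>_pos h_pos S_pos by simp
  have shift: "emeasure GS ?E \<le> (\<integral>\<^sup>+\<omega>. indicator ?E (\<lambda>i. \<omega> i + ?c r i) * ennreal (H \<omega>) \<partial>GS)" if r: "r \<in> {0..1}" for r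
  proof -
    have "emeasure GS ?E = (\<integral>\<^sup>+\<omega>. indicator ?E \<omega> \<partial>GS)" by simp
    also have "\<dots> = (\<integral>\<^sup>+\<omega>. indicator ?E (\<lambda>i. \<omega> i + ?c r i) *
        ennreal (exp (\<Sum>i<2 * l. - ?c r i * \<omega> i / h - (?c r i)\<^sup>2 / (2 * h))) \<partial>GS)"
      by (rule nn_integral_GS_shift[symmetric]) (auto simp: hat_step_def)
    also have "\<dots> \<le> (\<integral>\<^sup>+\<omega>. indicator ?E (\<lambda>i. \<omega> i + ?c r i) * ennreal (H \<omega>) \<partial>GS)"
    proof (intro nn_integral_mono mult_left_mono ennreal_leI)
      fix \<omega>
      have "(\<Sum>i<2 * l. - ?c r i * \<omega> i / h - (?c r i)\<^sup>2 / (2 * h)) \<le> (\<Sum>i<2 * l. - r * (hat_step l i * \<omega> i))"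
        using h_pos by (intro sum_mono) (auto simp: field_simps)
      also have "\<dots> = - r * W \<omega>" by (simp add: W_def sum_distrib_left sum_negf)
      also have "\<dots> \<le> \<bar>W \<omega>\<bar>"
        using r mult_right_mono[of r 1 "\<bar>W \<omega>\<bar>"] abs_mult[of r "W \<omega>"] by auto
      finally have "exp (\<Sum>i<2 * l. - ?c r i * \<omega> i / h - (?c r i)\<^sup>2 / (2 * h)) \<le> exp \<bar>W \<omega>\<bar>" by simp
      also have "\<dots> \<le> H \<omega>" by (auto simp: H_def abs_if)
      finally show "exp (\<Sum>i<2 * l. - ?c r i * \<omega> i / h - (?c r i)\<^sup>2 / (2 * h)) \<le> H \<omega>" .
    qed auto
    finally show ?thesis .
  qed
  \<comment> \<open>For fixed \<open>\<omega>\<close> the functional increases in \<open>r\<close>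
    at rate at least \<open>\<Delta> \<omega>\<close> while confined to an interval of length
    \<open>v - u\<close>. The term with \<open>\<rho>\<close> does not move, because the hat
    vanishes at \<open>2 * l\<close>.\<close>
  have slope: "emeasure lborel {r \<in> {0..1}. (\<lambda>i. \<omega> i + ?c r i) \<in> ?E} \<le> ennreal (2 * (v - u) / \<Delta> \<omega>)" for \<omega>
  proof (rule emeasure_lborel_le_of_diameter[OF \<Delta>_pos])
    fix r r' assume r: "r \<in> {r \<in> {0..1}. (\<lambda>i. \<omega> i + ?c r i) \<in> ?E}" "r' \<in> {r \<in> {0..1}. (\<lambda>i. \<omega> i + ?c r i) \<in> ?E}" and "r < r'"
    have f: "?f (\<lambda>i. \<omega> i + ?c q i) = k * h * (\<Sum>j<2 * l. X j \<omega> * exp (\<sigma> * q * h * hat l j)) + X (2 * l) \<omega> * \<rho>" for q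
      by (simp add: X_hat_shift hat_def)
    have "\<Delta> \<omega> * (r' - r) = k * h * (\<Sum>j<2 * l. X j \<omega> * (\<sigma> * r' * h * hat l j - \<sigma> * r * h * hat l j))"
      by (simp add: \<Delta>_def sum_distrib_left sum_distrib_right power2_eq_square algebra_simps)
    also have "\<dots> \<le> k * h * (\<Sum>j<2 * l. X j \<omega> * (exp (\<sigma> * r' * h * hat l j) - exp (\<sigma> * r * h * hat l j)))"
      using k_pos h_pos r \<open>r < r'\<close> \<sigma>_pos hat_nonneg[of l] X_pos
      by (intro mult_left_mono sum_mono exp_diff_ge mult_right_mono mult_nonneg_nonneg) (auto intro: less_imp_le)
    also have "\<dots> = ?f (\<lambda>i. \<omega> i + ?c r' i) - ?f (\<lambda>i. \<omega> i + ?c r i)"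
      unfolding f by (simp add: right_diff_distrib sum_subtractf)
    also have "\<dots> \<le> v - u" using r by auto
    finally show "\<Delta> \<omega> * (r' - r) \<le> v - u" .
  qed (use uv in auto)
  \<comment> \<open>Cauchy-Schwarz applied to \<open>hat = sqrt (hat * X) * sqrt (hat / X)\<close>
    replaces the reciprocal of a sum, whose mean is not explicit, by a sum of reciprocals of
    exponentials.\<close>
  have inv: "1 / \<Delta> \<omega> \<le> 1 / (k * \<sigma> * h\<^sup>2 * (real l) ^ 4) * (\<Sum>j<2 * l. hat l j / X j \<omega>)" for \<omega>
  proof -
    have "(\<Sum>j<2 * l. sqrt (hat l j * X j \<omega>) * sqrt (hat l j / X j \<omega>))\<^sup>2 \<le>
        (\<Sum>j<2 * l. (sqrt (hat l j * X j \<omega>))\<^sup>2) * (\<Sum>j<2 * l. (sqrt (hat l j / X j \<omega>))\<^sup>2)"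
      by (rule Cauchy_Schwarz_ineq_sum)
    also have "(\<Sum>j<2 * l. sqrt (hat l j * X j \<omega>) * sqrt (hat l j / X j \<omega>)) = (\<Sum>j<2 * l. hat l j)"
      using X_pos[of _ \<omega>] hat_nonneg[of l]
      by (intro sum.cong) (auto simp: real_sqrt_mult[symmetric] less_imp_neq[THEN not_sym] power2_eq_square[symmetric])
    finally have "(real l) ^ 4 \<le> (\<Sum>j<2 * l. hat l j * X j \<omega>) * (\<Sum>j<2 * l. hat l j / X j \<omega>)"
      using X_pos[of _ \<omega>] hat_nonneg[of l] by (simp add: sum_hat power_mult[symmetric] less_imp_le)
    then have "1 / (\<Sum>j<2 * l. hat l j * X j \<omega>) \<le> (\<Sum>j<2 * l. hat l j / X j \<omega>) / (real l) ^ 4"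
      using S_pos[of \<omega>] l by (simp add: field_simps)
    then have "1 / (k * \<sigma> * h\<^sup>2) * (1 / (\<Sum>j<2 * l. hat l j * X j \<omega>)) \<le> 1 / (k * \<sigma> * h\<^sup>2) * ((\<Sum>j<2 * l. hat l j / X j \<omega>) / (real l) ^ 4)"
      using k_pos \<sigma>_pos h_pos by (intro mult_left_mono) auto
    then show ?thesis by (simp add: \<Delta>_def)
  qed
  define \<gamma> where "\<gamma> = 2 * (v - u) * (1 / (k * \<sigma> * h\<^sup>2 * (real l) ^ 4))"
  have \<gamma>: "0 \<le> \<gamma>" using uv k_pos \<sigma>_pos by (simp add: \<gamma>_def)
  interpret pair_sigma_finite lborel GS ..
  \<comment> \<open>The probability does not depend on \<open>r\<close> and so equals its average
    over \<open>[0,1]\<close>. After Fubini the inner integral is the Lebesgue measure of the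
    parameters \<open>r\<close> that \<open>slope\<close> bounds.\<close>
  have "emeasure GS ?E = (\<integral>\<^sup>+r. emeasure GS ?E * indicator {0..1::real} r \<partial>lborel)"
    by (subst nn_integral_cmult) auto
  also have "\<dots> \<le> (\<integral>\<^sup>+r. (\<integral>\<^sup>+\<omega>. indicator ?E (\<lambda>i. \<omega> i + ?c r i) * ennreal (H \<omega>) \<partial>GS) * indicator {0..1} r \<partial>lborel)"
    using shift by (intro nn_integral_mono) (auto simp: indicator_def)
  also have "\<dots> = (\<integral>\<^sup>+r. \<integral>\<^sup>+\<omega>. indicator ?E (\<lambda>i. \<omega> i + ?c r i) * ennreal (H \<omega>) * indicator {0..1} r \<partial>GS \<partial>lborel)"
  proof (intro nn_integral_cong nn_integral_multc[symmetric])
    fix r :: real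
    have [measurable]: "(\<lambda>\<omega>. \<lambda>i. \<omega> i + ?c r i) \<in> GS \<rightarrow>\<^sub>M GS"
      by (rule measurable_GS_I) measurable
    show "(\<lambda>\<omega>. indicator ?E (\<lambda>i. \<omega> i + ?c r i) * ennreal (H \<omega>)) \<in> borel_measurable GS"
      by measurable
  qed
  also have "\<dots> = (\<integral>\<^sup>+\<omega>. \<integral>\<^sup>+r. indicator ?E (\<lambda>i. \<omega> i + ?c r i) * ennreal (H \<omega>) * indicator {0..1} r \<partial>lborel \<partial>GS)"
    by (rule Fubini'[symmetric]) (simp add: split_beta')
  also have "\<dots> \<le> (\<integral>\<^sup>+\<omega>. ennreal (\<gamma> * (\<Sum>j<2 * l. hat l j / X j \<omega>) * H \<omega>) \<partial>GS)"
  proof (intro nn_integral_mono)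
    fix \<omega>
    have [measurable]: "(\<lambda>r::real. \<lambda>i. \<omega> i + ?c r i) \<in> borel \<rightarrow>\<^sub>M GS"
      by (rule measurable_GS_I) measurable
    have m: "{r \<in> {0..1::real}. (\<lambda>i. \<omega> i + ?c r i) \<in> ?E} \<in> sets borel"
      by (simp only: Collect_conj_eq) measurable
    have "(\<integral>\<^sup>+r. indicator ?E (\<lambda>i. \<omega> i + ?c r i) * ennreal (H \<omega>) * indicator {0..1} r \<partial>lborel)
      = (\<integral>\<^sup>+r. indicator {r \<in> {0..1}. (\<lambda>i. \<omega> i + ?c r i) \<in> ?E} r * ennreal (H \<omega>) \<partial>lborel)"
      by (intro nn_integral_cong) (auto simp: indicator_def)
    also have "\<dots> = emeasure lborel {r \<in> {0..1}. (\<lambda>i. \<omega> i + ?c r i) \<in> ?E} * ennreal (H \<omega>)"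
      using m by (subst nn_integral_multc) auto
    also have "\<dots> \<le> ennreal (2 * (v - u) / \<Delta> \<omega>) * ennreal (H \<omega>)"
      by (intro mult_right_mono slope) auto
    also have "\<dots> = ennreal (2 * (v - u) * (1 / \<Delta> \<omega>) * H \<omega>)"
      using uv \<Delta>_pos[of \<omega>] by (subst ennreal_mult[symmetric]) (auto simp: H_def)
    also have "\<dots> \<le> ennreal (\<gamma> * (\<Sum>j<2 * l. hat l j / X j \<omega>) * H \<omega>)"
    proof (intro ennreal_leI mult_right_mono)
      show "2 * (v - u) * (1 / \<Delta> \<omega>) \<le> \<gamma> * (\<Sum>j<2 * l. hat l j / X j \<omega>)"
        unfolding \<gamma>_def mult.assoc using uv inv[of \<omega>] by (intro mult_left_mono) auto
    qed (simp add: H_def)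
    finally show "(\<integral>\<^sup>+r. indicator ?E (\<lambda>i. \<omega> i + ?c r i) * ennreal (H \<omega>) * indicator {0..1} r \<partial>lborel)
      \<le> ennreal (\<gamma> * (\<Sum>j<2 * l. hat l j / X j \<omega>) * H \<omega>)" .
  qed
  also have "\<dots> = (\<integral>\<^sup>+\<omega>. (\<Sum>j<2 * l. ennreal (\<gamma> * hat l j) * (ennreal (exp (- 1 * W \<omega>) / X j \<omega>) + ennreal (exp (1 * W \<omega>) / X j \<omega>))) \<partial>GS)"
  proof (intro nn_integral_cong)
    fix \<omega>
    have pos: "0 \<le> exp y / X j \<omega>" for y j
      using X_pos[of j \<omega>] by simp
    have eq: "\<gamma> * (\<Sum>j<2 * l. hat l j / X j \<omega>) * H \<omega> = (\<Sum>j<2 * l. \<gamma> * hat l j * (exp (- 1 * W \<omega>) / X j \<omega> + exp (1 * W \<omega>) / X j \<omega>))"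
      unfolding H_def sum_distrib_left sum_distrib_right
      by (intro sum.cong refl) (simp add: add_divide_distrib[symmetric])
    have "ennreal (\<gamma> * (\<Sum>j<2 * l. hat l j / X j \<omega>) * H \<omega>) = (\<Sum>j<2 * l. ennreal (\<gamma> * hat l j * (exp (- 1 * W \<omega>) / X j \<omega> + exp (1 * W \<omega>) / X j \<omega>)))"
      unfolding eq using \<gamma> hat_nonneg pos by (intro sum_ennreal[symmetric]) simp
    also have "\<dots> = (\<Sum>j<2 * l. ennreal (\<gamma> * hat l j) * (ennreal (exp (- 1 * W \<omega>) / X j \<omega>) + ennreal (exp (1 * W \<omega>) / X j \<omega>)))"
    proof (intro sum.cong refl)
      fix j
      show "ennreal (\<gamma> * hat l j * (exp (- 1 * W \<omega>) / X j \<omega> + exp (1 * W \<omega>) / X j \<omega>)) =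
        ennreal (\<gamma> * hat l j) * (ennreal (exp (- 1 * W \<omega>) / X j \<omega>) + ennreal (exp (1 * W \<omega>) / X j \<omega>))"
        by (rule ennreal_distrib) (use \<gamma> hat_nonneg[of l j] pos in simp_all)
    qed
    finally show "ennreal (\<gamma> * (\<Sum>j<2 * l. hat l j / X j \<omega>) * H \<omega>) =
      (\<Sum>j<2 * l. ennreal (\<gamma> * hat l j) * (ennreal (exp (- 1 * W \<omega>) / X j \<omega>) + ennreal (exp (1 * W \<omega>) / X j \<omega>)))" .
  qed
  also have "\<dots> = (\<Sum>j<2 * l. ennreal (\<gamma> * hat l j) * ((\<integral>\<^sup>+\<omega>. ennreal (exp (- 1 * W \<omega>) / X j \<omega>) \<partial>GS) + (\<integral>\<^sup>+\<omega>. ennreal (exp (1 * W \<omega>) / X j \<omega>) \<partial>GS)))"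
    by (subst nn_integral_sum, measurable) (simp add: nn_integral_cmult nn_integral_add)
  also have "\<dots> \<le> (\<Sum>j<2 * l. ennreal (\<gamma> * hat l j) * (ennreal ?C + ennreal ?C))"
    unfolding W_def by (intro sum_mono mult_left_mono add_mono nn_integral_exp_div_X_le) auto
  also have "\<dots> = (\<Sum>j<2 * l. ennreal (\<gamma> * hat l j * (2 * ?C)))"
    using \<gamma> hat_nonneg by (intro sum.cong refl, subst ennreal_plus[symmetric]) (auto simp: ennreal_mult[symmetric])
  also have "\<dots> = ennreal (\<Sum>j<2 * l. \<gamma> * hat l j * (2 * ?C))"
    using \<gamma> hat_nonneg by (intro sum_ennreal) auto
  also have "(\<Sum>j<2 * l. \<gamma> * hat l j * (2 * ?C)) = \<gamma> * (2 * ?C) * (\<Sum>j<2 * l. hat l j)"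
    unfolding sum_distrib_left by (intro sum.cong refl) simp
  also have "\<dots> = 4 * ?C / (k * \<sigma> * (real l * h)\<^sup>2) * (v - u)"
    using l h_pos k_pos \<sigma>_pos unfolding sum_hat \<gamma>_def
    by (simp add: power_mult_distrib power4_eq_xxxx power2_eq_square divide_simps)
  finally show ?thesis .
qed

text \<open>All later values are images of quantities formed from later increments under one affine
  map with positive slope \<open>X (2 * l) \<omega>\<close>. Their maximum is therefore the image of
  the maximum \<open>\<rho>\<close>, a constant once the later increments are frozen.\<close>

lemma emeasure_late_passage:
  assumes l: "1 \<le> l" and uv: "u \<le> v"
  shows "emeasure GS {\<omega>. (\<exists>i\<le>n. u < V z (2 * l + i) \<omega>) \<and> (\<forall>i\<le>n. V z (2 * l + i) \<omega> < v)}
    \<le> ennreal (4 * exp (real l * h * (2 * \<bar>b\<bar> + (1 + \<sigma>)\<^sup>2)) / (k * \<sigma> * (real l * h)\<^sup>2) * (v - u))"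
    (is "emeasure GS ?E \<le> ?C")
proof -
  have [measurable]: "?E \<in> sets GS" by (rule sets_GS_Collect) measurable
  have "emeasure GS ?E = (\<integral>\<^sup>+\<omega>. indicator ?E \<omega> \<partial>GS)" by simp
  also have "\<dots> = (\<integral>\<^sup>+\<omega>'. \<integral>\<^sup>+\<omega>. indicator ?E (comb_seq (2 * l) \<omega> \<omega>') \<partial>GS \<partial>GS)"
    by (rule nn_integral_GS_split) measurable
  also have "\<dots> \<le> (\<integral>\<^sup>+\<omega>'. ?C \<partial>GS)"
  proof (intro nn_integral_mono)
    fix \<omega>'
    define I where "I = (\<lambda>i. V (\<lambda>i. z (2 * l + i)) i \<omega>') ` {..n}"
    define \<rho> where "\<rho> = Max I"
    have I: "finite I" "I \<noteq> {}" by (auto simp: I_def)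
    let ?A = "{\<omega>. u < k * h * (\<Sum>j<2 * l. X j \<omega>) + X (2 * l) \<omega> * \<rho> \<and> k * h * (\<Sum>j<2 * l. X j \<omega>) + X (2 * l) \<omega> * \<rho> < v}"
    have A: "?A \<in> sets GS" by (rule sets_GS_Collect) measurable
    have "indicator ?E (comb_seq (2 * l) \<omega> \<omega>') \<le> (indicator ?A \<omega> :: ennreal)" for \<omega>
    proof (rule indicator_leI)
      assume "comb_seq (2 * l) \<omega> \<omega>' \<in> ?E"
      then have *: "\<exists>i\<le>n. u < k * h * (\<Sum>j<2 * l. X j \<omega>) + X (2 * l) \<omega> * V (\<lambda>i. z (2 * l + i)) i \<omega>'"
        "\<forall>i\<le>n. k * h * (\<Sum>j<2 * l. X j \<omega>) + X (2 * l) \<omega> * V (\<lambda>i. z (2 * l + i)) i \<omega>' < v"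
        by (auto simp: V_comb_seq)
      from *(1) obtain i where i: "i \<le> n" "u < k * h * (\<Sum>j<2 * l. X j \<omega>) + X (2 * l) \<omega> * V (\<lambda>i. z (2 * l + i)) i \<omega>'"
        by auto
      have "V (\<lambda>i. z (2 * l + i)) i \<omega>' \<le> \<rho>"
        unfolding \<rho>_def using I i by (intro Max_ge) (auto simp: I_def)
      then have "X (2 * l) \<omega> * V (\<lambda>i. z (2 * l + i)) i \<omega>' \<le> X (2 * l) \<omega> * \<rho>"
        using X_pos[of "2 * l" \<omega>] by (intro mult_left_mono) auto
      moreover have "\<rho> \<in> I" unfolding \<rho>_def using I by (rule Max_in)
      ultimately show "\<omega> \<in> ?A" using *(2) i(2) by (auto simp: I_def)
    qed
    then have "(\<integral>\<^sup>+\<omega>. indicator ?E (comb_seq (2 * l) \<omega> \<omega>') \<partial>GS) \<le> (\<integral>\<^sup>+\<omega>. indicator ?A \<omega> \<partial>GS)"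
      by (intro nn_integral_mono)
    also have "\<dots> = emeasure GS ?A" using A by simp
    also have "\<dots> \<le> ?C" by (rule emeasure_affine_functional[OF l uv])
    finally show "(\<integral>\<^sup>+\<omega>. indicator ?E (comb_seq (2 * l) \<omega> \<omega>') \<partial>GS) \<le> ?C" .
  qed
  also have "\<dots> = ?C" by (simp add: GS.emeasure_space_1[simplified])
  finally show ?thesis .
qed

section \<open>Joining both cases, uniformly in the grid\<close>

lemma emeasure_max_V:
  fixes K zmin A \<kappa> :: real and l p :: nat
  assumes l: "1 \<le> l" and uv: "u \<le> v" and K: "0 < K"
    and A: "4 / 3 \<le> A" "2 / (real l * h * (real p * \<sigma>)\<^sup>2) \<le> A"
    and p: "1 \<le> p" "2 * (b + \<Lambda>) \<le> real p * \<sigma>\<^sup>2"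
    and \<kappa>: "\<sigma>\<^sup>2 / 2 - b \<le> \<kappa>" "0 \<le> \<kappa>"
    and z: "0 < zmin" "\<And>i. zmin \<le> z i" "\<And>i. z (Suc i) \<le> exp (\<Lambda> * h) * z i"
  shows "emeasure GS {\<omega>. (\<exists>i\<le>4 * l. u < V z i \<omega>) \<and> (\<forall>i\<le>4 * l. V z i \<omega> < v)} \<le>
    ennreal ((2 * real p * A / zmin * exp (2 * \<kappa> * (real l * h)) +
        4 * exp (real l * h * (2 * \<bar>b\<bar> + (1 + \<sigma>)\<^sup>2)) / (k * \<sigma> * (real l * h)\<^sup>2)) * (v - u) +
       (K + real (2 * l) * (A ^ 4 * overshoot_moment (real p * \<sigma>) / K ^ 3)))"
proof -
  let ?R = "K + real (2 * l) * (A ^ 4 * overshoot_moment (real p * \<sigma>) / K ^ 3)"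
  let ?D = "2 * real p * A * (v - u) / zmin"
  let ?C = "4 * exp (real l * h * (2 * \<bar>b\<bar> + (1 + \<sigma>)\<^sup>2)) / (k * \<sigma> * (real l * h)\<^sup>2)"
  have R: "0 \<le> ?R" using K A overshoot_moment_nonneg by simp
  have D: "0 \<le> ?D" using A uv z by simp
  have C: "0 \<le> ?C" using k_pos \<sigma>_pos by simp
  \<comment> \<open>Chosen so that \<open>real (2 * l) * \<beta> = 1\<close> cancels the constant 1
    in the staying bound after \<open>2 * l\<close> steps. The second lower bound on
    \<open>A\<close> is the condition \<open>\<beta> \<le> A * (real p * \<sigma>)^2 * h / 4\<close>
    solved for \<open>A\<close>.\<close>
  define \<beta> where "\<beta> = 1 / real (2 * l)"
  have n\<beta>: "real (2 * l) * \<beta> = 1" "0 \<le> \<beta>" using l by (auto simp: \<beta>_def)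
  have "0 < real l * h * (real p * \<sigma>)\<^sup>2" using l p h_pos \<sigma>_pos by simp
  then have \<beta>: "\<beta> \<le> A * (real p * \<sigma>)\<^sup>2 * h / 4"
    using A(2) l unfolding \<beta>_def by (simp add: field_simps)
  have stay: "emeasure GS {\<omega>. \<forall>i\<le>2 * l. J + x * V z' i \<omega> < v} \<le> ennreal (?D / x + ?R)"
    if "0 < x" "u \<le> J - x * z' 0" "zmin \<le> z' 0" and z': "\<And>i. z' (Suc i) \<le> exp (\<Lambda> * h) * z' i" for J x z'
  proof -
    have "z' i \<le> exp (\<Lambda> * (real i * h)) * z' 0" for i
    proof (induction i)
      case (Suc i)
      have "z' (Suc i) \<le> exp (\<Lambda> * h) * z' i" by (rule z')
      also have "\<dots> \<le> exp (\<Lambda> * h) * (exp (\<Lambda> * (real i * h)) * z' 0)" using Suc by simp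
      also have "\<dots> = exp (\<Lambda> * (real (Suc i) * h)) * z' 0" by (simp add: exp_add[symmetric] algebra_simps)
      finally show ?case .
    qed simp
    then have "emeasure GS {\<omega>. \<forall>i\<le>2 * l. J + x * V z' i \<omega> < v} \<le>
       ennreal (?D / x + (1 - real (2 * l) * \<beta> + K + real (2 * l) * (A ^ 4 * overshoot_moment (real p * \<sigma>) / K ^ 3)))"
      using that z(1) n\<beta> by (intro emeasure_stay_below[OF A(1) _ \<beta> K _ p _ _ _ _ _ uv]) auto
    then show ?thesis using n\<beta> by simp
  qed
  let ?E = "{\<omega>. (\<exists>i\<le>4 * l. u < V z i \<omega>) \<and> (\<forall>i\<le>4 * l. V z i \<omega> < v)}"
  \<comment> \<open>Written with \<open>J = 0\<close> and \<open>x = 1\<close> to match the passage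
    lemma. A passage by index \<open>2 * l\<close> leaves \<open>2 * l\<close> of the
    \<open>4 * l\<close> steps for the staying estimate.\<close>
  let ?E1 = "{\<omega>. (\<exists>i\<le>2 * l. u < 0 + 1 * V z i \<omega>) \<and> (\<forall>i\<le>2 * l + 2 * l. 0 + 1 * V z i \<omega> < v)}"
  let ?E2 = "{\<omega>. (\<exists>i\<le>2 * l. u < V z (2 * l + i) \<omega>) \<and> (\<forall>i\<le>2 * l. V z (2 * l + i) \<omega> < v)}"
  have "?E \<subseteq> ?E1 \<union> ?E2"
  proof
    fix \<omega> assume \<omega>: "\<omega> \<in> ?E"
    then obtain i where i: "i \<le> 4 * l" "u < V z i \<omega>" by auto
    show "\<omega> \<in> ?E1 \<union> ?E2"
    proof (cases "i \<le> 2 * l")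
      case True
      then show ?thesis using \<omega> i by auto
    next
      case False
      then obtain i' where "i = 2 * l + i'" by (metis nat_le_linear le_Suc_ex)
      then have "\<exists>i\<le>2 * l. u < V z (2 * l + i) \<omega>" using i by (intro exI[of _ i']) auto
      then show ?thesis using \<omega> by auto
    qed
  qed
  moreover have E1: "?E1 \<in> sets GS" by (rule sets_GS_Collect) measurable
  moreover have E2: "?E2 \<in> sets GS" by (rule sets_GS_Collect) measurable
  ultimately have "emeasure GS ?E \<le> emeasure GS (?E1 \<union> ?E2)"
    by (intro emeasure_mono sets.Un)
  also have "\<dots> \<le> emeasure GS ?E1 + emeasure GS ?E2"
    using E1 E2 by (rule emeasure_subadditive)
  also have "\<dots> \<le> ennreal (?D / 1 * exp (\<kappa> * h * real (2 * l)) + ?R) + ennreal (?C * (v - u))"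
    using z stay by (intro add_mono emeasure_late_passage l uv emeasure_early_passage[OF D R \<kappa>]) auto
  also have "\<dots> = ennreal (?D * exp (2 * \<kappa> * (real l * h)) + ?R + ?C * (v - u))"
  proof -
    have "0 \<le> ?D * exp (2 * \<kappa> * (real l * h)) + ?R" by (intro add_nonneg_nonneg[OF mult_nonneg_nonneg[OF D] R]) simp
    moreover have "0 \<le> ?C * (v - u)" using C uv by (intro mult_nonneg_nonneg) auto
    moreover have "?D / 1 * exp (\<kappa> * h * real (2 * l)) = ?D * exp (2 * \<kappa> * (real l * h))"
      by (simp add: mult_ac)
    ultimately show ?thesis by (simp only: ennreal_plus[symmetric])
  qed
  also have "?D * exp (2 * \<kappa> * (real l * h)) + ?R + ?C * (v - u) =
     (2 * real p * A / zmin * exp (2 * \<kappa> * (real l * h)) + ?C) * (v - u) + ?R"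
    by (simp add: algebra_simps)
  finally show ?thesis .
qed

end

text \<open>\<open>C\<close> is fixed before \<open>\<epsilon>\<close> and \<open>l\<close>; the
  proof takes \<open>K = \<epsilon> / 2\<close> and lets the fourth-moment error use up the other
  half. The weights \<open>z\<close> are quantified inside the eventuality because grid values
  change with \<open>l\<close>.\<close>

lemma emeasure_max_V_uniform:
  fixes L \<sigma> k b \<Lambda> zmin :: real
  assumes "0 < L" "0 < \<sigma>" "0 < k" "0 < zmin"
  obtains C where "0 \<le> C"
    and "\<And>\<epsilon>. 0 < \<epsilon> \<Longrightarrow> \<forall>\<^sub>F l in sequentially. \<forall>z u v.
      (\<forall>i. zmin \<le> z i) \<longrightarrow> (\<forall>i. z (Suc i) \<le> exp (\<Lambda> * (L / real (4 * l))) * z i) \<longrightarrow> u \<le> v \<longrightarrow>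
      emeasure (gauss_seq.GS (L / real (4 * l)))
        {\<omega>. (\<exists>i\<le>4 * l. u < gauss_walk.V (L / real (4 * l)) b \<sigma> k z i \<omega>) \<and>
             (\<forall>i\<le>4 * l. gauss_walk.V (L / real (4 * l)) b \<sigma> k z i \<omega> < v)} \<le> ennreal (C * (v - u) + \<epsilon>)"
proof -
  obtain p0 :: nat where p0: "2 * (b + \<Lambda>) / \<sigma>\<^sup>2 \<le> real p0" using real_arch_simple by blast
  define p where "p = Suc p0"
  have p: "1 \<le> p" "2 * (b + \<Lambda>) \<le> real p * \<sigma>\<^sup>2"
  proof -
    have "2 * (b + \<Lambda>) / \<sigma>\<^sup>2 \<le> real p" using p0 by (simp add: p_def)
    then show "2 * (b + \<Lambda>) \<le> real p * \<sigma>\<^sup>2" using assms(2) by (simp add: field_simps)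
  qed (simp add: p_def)
  \<comment> \<open>Here \<open>L / 4\<close> is \<open>real l * h\<close>, the same for every
    grid.\<close>
  define A where "A = max (4 / 3) (2 / (L / 4 * (real p * \<sigma>)\<^sup>2))"
  define \<kappa> where "\<kappa> = \<bar>b\<bar> + \<sigma>\<^sup>2 / 2"
  define C where "C = 2 * real p * A / zmin * exp (2 * \<kappa> * (L / 4)) + 4 * exp (L / 4 * (2 * \<bar>b\<bar> + (1 + \<sigma>)\<^sup>2)) / (k * \<sigma> * (L / 4)\<^sup>2)"
  have A: "4 / 3 \<le> A" "2 / (L / 4 * (real p * \<sigma>)\<^sup>2) \<le> A" by (auto simp: A_def)
  have A0: "0 \<le> A" using A(1) by linarith
  have "0 \<le> C" unfolding C_def using assms A0 by (intro add_nonneg_nonneg mult_nonneg_nonneg divide_nonneg_nonneg) auto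
  moreover have "\<forall>\<^sub>F l in sequentially. \<forall>z u v.
      (\<forall>i. zmin \<le> z i) \<longrightarrow> (\<forall>i. z (Suc i) \<le> exp (\<Lambda> * (L / real (4 * l))) * z i) \<longrightarrow> u \<le> v \<longrightarrow>
      emeasure (gauss_seq.GS (L / real (4 * l)))
        {\<omega>. (\<exists>i\<le>4 * l. u < gauss_walk.V (L / real (4 * l)) b \<sigma> k z i \<omega>) \<and>
             (\<forall>i\<le>4 * l. gauss_walk.V (L / real (4 * l)) b \<sigma> k z i \<omega> < v)} \<le> ennreal (C * (v - u) + \<epsilon>)"
    if \<epsilon>: "0 < \<epsilon>" for \<epsilon>
  proof -
    define c where "c = (real p * \<sigma>)\<^sup>2 * L / 4"
    have c: "0 < c" using assms p by (simp add: c_def)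
    \<comment> \<open>On the grid with \<open>4 * l\<close> steps
      \<open>(real p * \<sigma>)^2 * h = c / real l\<close>, so \<open>e (real l)\<close> is the
      overshoot moment. It is of order \<open>1 / l^2\<close>, which beats the number of
      steps.\<close>
    define e where "e = (\<lambda>x::real. exp (28 * (c / x)) - 4 * exp (15 * (c / x)) + 6 * exp (6 * (c / x)) - 4 * exp (c / x) + 1)"
    have "((\<lambda>x. x * e x) \<longlongrightarrow> 0) at_top"
      unfolding e_def using c by real_asymp
    then have "(\<lambda>l. real l * e (real l)) \<longlonglongrightarrow> 0"
      using filterlim_compose filterlim_real_sequentially by blast
    then have "(\<lambda>l. 2 * A ^ 4 / (\<epsilon> / 2) ^ 3 * (real l * e (real l))) \<longlonglongrightarrow> 2 * A ^ 4 / (\<epsilon> / 2) ^ 3 * 0"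
      by (intro tendsto_intros)
    then have "\<forall>\<^sub>F l in sequentially. 2 * A ^ 4 / (\<epsilon> / 2) ^ 3 * (real l * e (real l)) < \<epsilon> / 2"
      by (rule order_tendstoD) (use \<epsilon> in simp)
    then show ?thesis
      using eventually_ge_at_top[of 1]
    proof eventually_elim
      case (elim l)
      define h where "h = L / real (4 * l)"
      interpret gauss_walk h b \<sigma> k
        by unfold_locales (use assms elim in \<open>auto simp: h_def\<close>)
      have lh: "real l * h = L / 4" using elim by (simp add: h_def)
      have "(real p * \<sigma>)\<^sup>2 * h = c / real l" using elim by (simp add: h_def c_def)
      then have def: "overshoot_moment (real p * \<sigma>) = e (real l)"
        by (simp add: overshoot_moment_def e_def)
      show ?case
        unfolding h_def[symmetric]
      proof (intro allI impI)
        fix z :: "nat \<Rightarrow> real" and u v :: real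
        assume z: "\<forall>i. zmin \<le> z i" "\<forall>i. z (Suc i) \<le> exp (\<Lambda> * h) * z i" and uv: "u \<le> v"
        have "emeasure GS {\<omega>. (\<exists>i\<le>4 * l. u < V z i \<omega>) \<and> (\<forall>i\<le>4 * l. V z i \<omega> < v)} \<le>
          ennreal ((2 * real p * A / zmin * exp (2 * \<kappa> * (real l * h)) +
            4 * exp (real l * h * (2 * \<bar>b\<bar> + (1 + \<sigma>)\<^sup>2)) / (k * \<sigma> * (real l * h)\<^sup>2)) * (v - u) +
            (\<epsilon> / 2 + real (2 * l) * (A ^ 4 * overshoot_moment (real p * \<sigma>) / (\<epsilon> / 2) ^ 3)))"
          using elim \<epsilon> z uv assms A p by (intro emeasure_max_V) (auto simp: lh \<kappa>_def)
        also have "\<dots> \<le> ennreal (C * (v - u) + \<epsilon>)"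
        proof -
          have "real (2 * l) * (A ^ 4 * e (real l) / (\<epsilon> / 2) ^ 3) = 2 * A ^ 4 / (\<epsilon> / 2) ^ 3 * (real l * e (real l))"
            by simp
          then have "\<epsilon> / 2 + real (2 * l) * (A ^ 4 * e (real l) / (\<epsilon> / 2) ^ 3) \<le> \<epsilon>"
            using elim(1) by linarith
          then show ?thesis
            unfolding lh def C_def[symmetric] by (intro ennreal_leI add_left_mono)
        qed
        finally show "emeasure GS {\<omega>. (\<exists>i\<le>4 * l. u < V z i \<omega>) \<and> (\<forall>i\<le>4 * l. V z i \<omega> < v)} \<le> ennreal (C * (v - u) + \<epsilon>)" .
      qed
    qed
  qed
  ultimately show ?thesis by (rule that)
qed

subsection \<open>Bounded densities\<close>

text \<open>Fatou's lemma for sets: the tail intersections \<open>D N\<close> increase to the lower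
  limit of the \<open>B n\<close>, and each lies in some \<open>B n\<close> of measure at most
  \<open>c\<close>.\<close>

lemma emeasure_le_of_eventually:
  assumes A: "\<And>x. x \<in> A \<Longrightarrow> \<forall>\<^sub>F n in sequentially. x \<in> B n"
    and B: "\<And>n. B n \<in> sets M" and le: "\<forall>\<^sub>F n in sequentially. emeasure M (B n) \<le> c"
  shows "emeasure M A \<le> c"
proof -
  define D where "D = (\<lambda>N. \<Inter>n\<in>{N..}. B n)"
  have D: "D N \<in> sets M" for N unfolding D_def using B by auto
  have "A \<subseteq> (\<Union>N. D N)"
  proof
    fix x assume "x \<in> A"
    then obtain N where "\<And>n. N \<le> n \<Longrightarrow> x \<in> B n"
      using A by (auto simp: eventually_sequentially)
    then show "x \<in> (\<Union>N. D N)" by (auto simp: D_def)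
  qed
  then have "emeasure M A \<le> emeasure M (\<Union>N. D N)"
    using D by (intro emeasure_mono) auto
  also have "\<dots> = (SUP N. emeasure M (D N))"
    using D by (intro SUP_emeasure_incseq[symmetric]) (auto simp: D_def incseq_def)
  also have "\<dots> \<le> c"
  proof (rule SUP_least)
    fix N
    obtain N' where N': "\<And>n. N' \<le> n \<Longrightarrow> emeasure M (B n) \<le> c"
      using le by (auto simp: eventually_sequentially)
    have "emeasure M (D N) \<le> emeasure M (B (max N N'))"
      using B by (intro emeasure_mono) (auto simp: D_def)
    also have "\<dots> \<le> c" by (rule N') simp
    finally show "emeasure M (D N) \<le> c" .
  qed
  finally show ?thesis .
qed

text \<open>Open sets are exhausted by grid cells of shrinking mesh; outer regularity of Lebesgue
  measure then carries the bound to Borel sets.\<close>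

lemma emeasure_le_lborel_of_intervals:
  fixes M :: "real measure"
  assumes sets: "sets M = sets borel" and C: "0 \<le> C"
    and le: "\<And>u v. u \<le> v \<Longrightarrow> emeasure M {u<..v} \<le> ennreal (C * (v - u))"
    and A: "A \<in> sets borel"
  shows "emeasure M A \<le> ennreal C * emeasure lborel A"
proof -
  have op: "emeasure M U \<le> ennreal C * emeasure lborel U" if "open U" for U
  proof -
    \<comment> \<open>Half-open cells tile the line: each \<open>x\<close> lies in exactly one,
      whose index is a ceiling, so the cells inside \<open>U\<close> are disjoint and their measures
      add up.\<close>
    define I where "I = (\<lambda>n (i::int). {of_int i / real (Suc n)<..(of_int i + 1) / real (Suc n)})"
    define J where "J = (\<lambda>n. {i. I n i \<subseteq> U})"
    have mem: "x \<in> I n i \<longleftrightarrow> i = \<lceil>x * real (Suc n)\<rceil> - 1" for x n i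
      unfolding I_def by (simp add: field_simps ceiling_eq_iff) linarith
    have disj: "disjoint_family_on (I n) (J n)" for n
      by (auto simp: disjoint_family_on_def mem)
    show ?thesis
    proof (rule emeasure_le_of_eventually[where B = "\<lambda>n. \<Union>i\<in>J n. I n i"])
      fix x assume "x \<in> U"
      then obtain e where e: "0 < e" "ball x e \<subseteq> U" using \<open>open U\<close> openE by blast
      have "\<forall>\<^sub>F n in sequentially. inverse (real (Suc n)) < e"
        using LIMSEQ_inverse_real_of_nat e(1) by (rule order_tendstoD)
      then show "\<forall>\<^sub>F n in sequentially. x \<in> (\<Union>i\<in>J n. I n i)"
      proof eventually_elim
        case (elim n)
        define i where "i = \<lceil>x * real (Suc n)\<rceil> - 1"
        have x: "x \<in> I n i" by (simp add: mem i_def)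
        have "I n i \<subseteq> ball x e"
        proof
          fix y assume "y \<in> I n i"
          then have "\<bar>x - y\<bar> < inverse (real (Suc n))"
            using x unfolding I_def by (auto simp: field_simps abs_less_iff)
          then show "y \<in> ball x e" using elim by (simp add: dist_real_def)
        qed
        then show ?case using x e(2) by (auto simp: J_def)
      qed
    next
      show "(\<Union>i\<in>J n. I n i) \<in> sets M" for n
        unfolding sets by (intro sets.countable_UN') (auto simp: I_def)
      have "emeasure M (\<Union>i\<in>J n. I n i) \<le> ennreal C * emeasure lborel U" for n
      proof -
        have "emeasure M (\<Union>i\<in>J n. I n i) = (\<integral>\<^sup>+i. emeasure M (I n i) \<partial>count_space (J n))"
          using disj by (intro emeasure_UN_countable) (auto simp: I_def sets)
        also have "\<dots> \<le> (\<integral>\<^sup>+i. ennreal C * emeasure lborel (I n i) \<partial>count_space (J n))"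
        proof (intro nn_integral_mono)
          fix i :: int
          have w: "(of_int i + 1) / real (Suc n) - of_int i / real (Suc n) = 1 / real (Suc n)"
            by (simp add: field_simps)
          have "emeasure M (I n i) \<le> ennreal (C * (1 / real (Suc n)))"
            unfolding I_def w[symmetric] by (rule le) (simp add: divide_right_mono)
          also have "\<dots> = ennreal C * emeasure lborel (I n i)"
            unfolding I_def using C
            by (subst emeasure_lborel_Ioc) (simp_all add: w ennreal_mult[symmetric] divide_right_mono del: of_nat_Suc)
          finally show "emeasure M (I n i) \<le> ennreal C * emeasure lborel (I n i)" .
        qed
        also have "\<dots> = ennreal C * (\<integral>\<^sup>+i. emeasure lborel (I n i) \<partial>count_space (J n))"
          by (intro nn_integral_cmult) simp
        also have "(\<integral>\<^sup>+i. emeasure lborel (I n i) \<partial>count_space (J n)) = emeasure lborel (\<Union>i\<in>J n. I n i)"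
          using disj by (intro emeasure_UN_countable[symmetric]) (auto simp: I_def)
        also have "ennreal C * \<dots> \<le> ennreal C * emeasure lborel U"
          using \<open>open U\<close> by (intro mult_left_mono emeasure_mono) (auto simp: J_def)
        finally show ?thesis .
      qed
      then show "\<forall>\<^sub>F n in sequentially. emeasure M (\<Union>i\<in>J n. I n i) \<le> ennreal C * emeasure lborel U"
        by simp
    qed
  qed
  show ?thesis
  proof (rule ennreal_le_epsilon)
    fix e :: real assume e: "0 < e"
    obtain U where U: "open U" "A \<subseteq> U" "emeasure lborel (U - A) < e / (C + 1)"
      using outer_regular_lborel[OF A, of "e / (C + 1)"] C e by auto
    have "emeasure M A \<le> emeasure M U"
      using U sets by (intro emeasure_mono) auto
    also have "\<dots> \<le> ennreal C * emeasure lborel (A \<union> (U - A))"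
      using op[OF U(1)] U(2) by (simp add: Un_absorb1)
    also have "\<dots> \<le> ennreal C * (emeasure lborel A + emeasure lborel (U - A))"
      using A U(1) by (intro mult_left_mono emeasure_subadditive) auto
    also have "\<dots> \<le> ennreal C * emeasure lborel A + ennreal C * ennreal (e / (C + 1))"
      unfolding distrib_left using U(3) by (intro add_left_mono mult_left_mono) auto
    also have "ennreal C * ennreal (e / (C + 1)) \<le> ennreal e"
      using C e by (subst ennreal_mult[symmetric]) (auto intro!: ennreal_leI simp: field_simps)
    finally show "emeasure M A \<le> ennreal C * emeasure lborel A + ennreal e"
      by (simp add: add_left_mono)
  qed
qed

text \<open>The hypothesis concerns open intervals because strict inequalities are what survives a
  limit of approximations. Half-open intervals follow by enlarging the right end, and the resulting
  domination by Lebesgue measure gives a Radon-Nikodym density.\<close>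

lemma has_bounded_density_of_intervals:
  fixes Y :: "'a \<Rightarrow> real"
  assumes Y[measurable]: "Y \<in> borel_measurable N" and C: "0 \<le> C"
    and le: "\<And>u v. u < v \<Longrightarrow> emeasure N {\<omega> \<in> space N. u < Y \<omega> \<and> Y \<omega> < v} \<le> ennreal (C * (v - u))"
  obtains p where "has_density N Y p" "locally_bounded p"
proof -
  define D where "D = distr N borel Y"
  have Ioc: "emeasure D {u<..v} \<le> ennreal (C * (v - u))" if "u \<le> v" for u v
  proof (rule ennreal_le_epsilon)
    fix e :: real assume e: "0 < e"
    define d where "d = e / (C + 1)"
    have d: "0 < d" "C * d \<le> e" using e C by (auto simp: d_def field_simps)
    have "emeasure D {u<..v} = emeasure N {\<omega> \<in> space N. u < Y \<omega> \<and> Y \<omega> \<le> v}"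
      unfolding D_def by (subst emeasure_distr) (auto intro!: arg_cong[where f = "emeasure N"])
    also have "\<dots> \<le> emeasure N {\<omega> \<in> space N. u < Y \<omega> \<and> Y \<omega> < v + d}"
      using d by (intro emeasure_mono) auto
    also have "\<dots> \<le> ennreal (C * (v + d - u))"
      using d that by (intro le) auto
    also have "\<dots> \<le> ennreal (C * (v - u) + e)"
      using d by (intro ennreal_leI) (simp add: algebra_simps)
    also have "\<dots> = ennreal (C * (v - u)) + ennreal e"
      using C that e by (intro ennreal_plus) auto
    finally show "emeasure D {u<..v} \<le> ennreal (C * (v - u)) + ennreal e" .
  qed
  have bound: "emeasure D A \<le> ennreal C * emeasure lborel A" if "A \<in> sets borel" for A
    using that C Ioc by (intro emeasure_le_lborel_of_intervals) (auto simp: D_def)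
  have ac: "absolutely_continuous lborel D"
    unfolding absolutely_continuous_def
  proof
    fix A :: "real set" assume "A \<in> null_sets lborel"
    then show "A \<in> null_sets D" using bound[of A] by (auto simp: null_sets_def D_def)
  qed
  define f where "f = RN_deriv lborel D"
  have f[measurable]: "f \<in> borel_measurable borel"
    unfolding f_def using borel_measurable_RN_deriv[of lborel D] by simp
  have D: "density lborel f = D"
    unfolding f_def using ac by (intro sigma_finite_measure.density_RN_deriv[OF sigma_finite_lborel]) (auto simp: D_def)
  have "AE x in lborel. f x \<le> ennreal C"
  proof -
    \<comment> \<open>The restriction to \<open>\<bar>x\<bar> \<le> real n\<close> makes the measure
      finite, so that it can be cancelled from the two-sided estimate.\<close>
    have null: "{x. \<bar>x\<bar> \<le> real n \<and> ennreal (C + 1 / real (Suc n)) \<le> f x} \<in> null_sets lborel" (is "?A \<in> _") for n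
    proof -
      have A[measurable]: "?A \<in> sets borel" by measurable
      have "emeasure lborel ?A \<le> emeasure lborel {- real n..real n}"
        by (intro emeasure_mono) auto
      then have fin: "emeasure lborel ?A < \<infinity>"
        by (rule order.strict_trans1) simp
      have "ennreal (C + 1 / real (Suc n)) * emeasure lborel ?A = (\<integral>\<^sup>+x. ennreal (C + 1 / real (Suc n)) * indicator ?A x \<partial>lborel)"
        by (subst nn_integral_cmult_indicator) auto
      also have "\<dots> \<le> (\<integral>\<^sup>+x. f x * indicator ?A x \<partial>lborel)"
        by (intro nn_integral_mono) (auto simp: indicator_def)
      also have "\<dots> = emeasure D ?A"
        unfolding D[symmetric] by (subst emeasure_density) auto
      also have "\<dots> \<le> ennreal C * emeasure lborel ?A" by (rule bound) simp
      finally have le: "ennreal (C + 1 / real (Suc n)) * emeasure lborel ?A \<le> ennreal C * emeasure lborel ?A" .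
      have m: "emeasure lborel ?A = ennreal (measure lborel ?A)"
        using fin by (intro emeasure_eq_ennreal_measure) auto
      define q where "q = measure lborel ?A"
      define d where "d = C + 1 / real (Suc n)"
      have q: "0 \<le> q" and d: "0 < d - C" "0 \<le> d" using C by (auto simp: q_def d_def add_nonneg_nonneg)
      have "ennreal d * ennreal q \<le> ennreal C * ennreal q"
        using le m unfolding q_def d_def by simp
      then have "d * q \<le> C * q"
        using C q d by (simp add: ennreal_mult[symmetric])
      then have "(d - C) * q \<le> 0" by (simp add: algebra_simps)
      then have "q = 0" using d q by (simp add: mult_le_0_iff)
      then have "measure lborel ?A = 0" unfolding q_def .
      then show ?thesis using m A by (simp add: null_sets_def)
    qed
    have "AE x in lborel. \<forall>n. x \<notin> {x. \<bar>x\<bar> \<le> real n \<and> ennreal (C + 1 / real (Suc n)) \<le> f x}"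
      unfolding AE_all_countable using null AE_not_in by blast
    then show ?thesis
    proof eventually_elim
      case (elim x)
      show ?case
      proof (rule ennreal_le_epsilon)
        fix e :: real assume "0 < e"
        obtain n1 where n1: "\<bar>x\<bar> \<le> real n1" using real_arch_simple by blast
        obtain n2 where n2: "1 / real (Suc n2) < e" using \<open>0 < e\<close> reals_Archimedean by (auto simp: inverse_eq_divide)
        define n where "n = max n1 n2"
        have "1 / real (Suc n) \<le> 1 / real (Suc n2)" by (intro divide_left_mono) (auto simp: n_def)
        then have "C + 1 / real (Suc n) \<le> C + e" using n2 by linarith
        moreover have "\<bar>x\<bar> \<le> real n" using n1 by (simp add: n_def)
        then have "f x < ennreal (C + 1 / real (Suc n))" using elim[THEN spec, of n] by (auto simp: not_le)
        ultimately have "f x \<le> ennreal (C + e)" by (meson ennreal_leI less_imp_le order.trans)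
        then show "f x \<le> ennreal C + ennreal e" using C \<open>0 < e\<close> by simp
      qed
    qed
  qed
  then have fp: "AE x in lborel. f x = ennreal (min C (enn2real (f x)))"
  proof eventually_elim
    case (elim x)
    then have "enn2real (f x) \<le> C" using C enn2real_mono[of "f x" "ennreal C"] by simp
    moreover have "f x < top" using elim by (rule order.strict_trans1) simp
    ultimately show ?case by (simp add: min_absorb2)
  qed
  \<comment> \<open>The derivative is bounded by \<open>C\<close> only almost everywhere; truncation
    gives a version that is bounded at every point.\<close>
  define p where "p = (\<lambda>x. min C (enn2real (f x)))"
  have "distr N lborel Y = D"
    unfolding D_def by (rule distr_cong) auto
  also have "\<dots> = density lborel (\<lambda>x. ennreal (p x))"
    unfolding D[symmetric] p_def using fp by (intro density_cong) auto
  finally have "has_density N Y p"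
    unfolding has_density_def distributed_def using C by (auto simp: p_def)
  moreover have "locally_bounded p"
    unfolding locally_bounded_def
  proof
    fix u
    have "bounded (range p)"
      unfolding bounded_iff using C by (intro exI[of _ C]) (auto simp: p_def min_def)
    then show "\<exists>N. open N \<and> u \<in> N \<and> bounded (p ` N)" by (intro exI[of _ UNIV]) auto
  qed
  ultimately show ?thesis by (rule that)
qed

subsection \<open>Grid approximation and the equation for Z\<close>

lemma riemann_sum_error:
  fixes f :: "real \<Rightarrow> real"
  assumes f: "continuous_on {t..s} f" and h: "0 \<le> h" and i: "t + real i * h \<le> s"
    and osc: "\<And>x y. x \<in> {t..s} \<Longrightarrow> y \<in> {t..s} \<Longrightarrow> \<bar>x - y\<bar> \<le> h \<Longrightarrow> \<bar>f x - f y\<bar> \<le> e" and e: "0 \<le> e"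
  shows "\<bar>h * (\<Sum>j<i. f (t + real j * h)) - integral {t..t + real i * h} f\<bar> \<le> real i * h * e"
  using i
proof (induction i)
  case (Suc i)
  define c where "c = t + real i * h"
  define d where "d = t + real (Suc i) * h"
  have cd: "t \<le> c" "c \<le> d" "d \<le> s" "d - c = h"
    using h Suc.prems by (auto simp: c_def d_def algebra_simps)
  have int: "f integrable_on {t..d}" "f integrable_on {c..d}"
    using cd by (auto intro!: integrable_continuous_real continuous_on_subset[OF f])
  have "((\<lambda>x. f x - f c) has_integral (integral {c..d} f - (d - c) * f c)) {c..d}"
    using has_integral_diff[OF integrable_integral[OF int(2)] has_integral_const_real[of "f c" c d]] cd by simp
  then have "norm (integral {c..d} f - (d - c) * f c) \<le> e * measure lborel {c..d}"
    by (rule has_integral_bound_real[OF e finite.emptyI]) (use cd in \<open>auto intro!: osc\<close>)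
  then have "\<bar>h * f c - integral {c..d} f\<bar> \<le> h * e"
    using cd by (simp add: abs_minus_commute mult.commute)
  moreover have "integral {t..c} f + integral {c..d} f = integral {t..d} f"
    using cd int by (intro Henstock_Kurzweil_Integration.integral_combine) auto
  moreover have "\<bar>h * (\<Sum>j<i. f (t + real j * h)) - integral {t..c} f\<bar> \<le> real i * h * e"
    unfolding c_def using Suc h by (intro Suc.IH) (simp add: algebra_simps)
  moreover have "h * (\<Sum>j<Suc i. f (t + real j * h)) = h * (\<Sum>j<i. f (t + real j * h)) + h * f c"
    by (simp add: c_def algebra_simps)
  moreover have "real (Suc i) * h * e = real i * h * e + h * e"
    by (simp add: algebra_simps)
  ultimately show ?case unfolding d_def[symmetric] by linarith
qed simp

lemma grid_max_tendsto_SUP: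
  fixes f g :: "real \<Rightarrow> real" and s t k :: real
  assumes ts: "t < s" and f: "continuous_on {t..s} f" and g: "continuous_on {t..s} g" and k: "0 < k"
  shows "(\<lambda>n. Max ((\<lambda>i. k * ((s - t) / real n) * (\<Sum>j<i. f (t + real j * ((s - t) / real n))) - g (t + real i * ((s - t) / real n))) ` {..n}))
     \<longlonglongrightarrow> (SUP r\<in>{t..s}. k * integral {t..r} f - g r)"
proof -
  define U where "U = (\<lambda>r. k * integral {t..r} f - g r)"
  define h where "h = (\<lambda>n. (s - t) / real n)"
  define V where "V = (\<lambda>n i. k * h n * (\<Sum>j<i. f (t + real j * h n)) - g (t + real i * h n))"
  define M where "M = (\<lambda>n. Max (V n ` {..n}))"
  have U: "continuous_on {t..s} U"
    unfolding U_def by (intro continuous_intros indefinite_integral_continuous_1 integrable_continuous_real f g)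
  obtain r0 where r0: "r0 \<in> {t..s}" "\<And>r. r \<in> {t..s} \<Longrightarrow> U r \<le> U r0"
    using continuous_attains_sup[OF _ _ U] ts by auto
  have SUP: "(SUP r\<in>{t..s}. U r) = U r0"
    using r0 by (intro cSup_eq_maximum) auto
  have uc: "uniformly_continuous_on {t..s} f" "uniformly_continuous_on {t..s} U"
    using f U by (auto intro: compact_uniformly_continuous)
  have "M \<longlonglongrightarrow> U r0"
  proof (rule LIMSEQ_I)
    fix e :: real assume e: "0 < e"
    define e' where "e' = e / (4 * (k * (s - t) + 1))"
    have pos: "0 < k * (s - t)" using k ts by simp
    have e': "0 < e'" "k * (s - t) * e' \<le> e / 4"
      using e pos by (auto simp: e'_def field_simps)
    obtain d1 where d1: "0 < d1" "\<And>x y. x \<in> {t..s} \<Longrightarrow> y \<in> {t..s} \<Longrightarrow> \<bar>x - y\<bar> < d1 \<Longrightarrow> \<bar>f x - f y\<bar> < e'"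
      using uc(1) e'(1) unfolding uniformly_continuous_on_def by (metis dist_real_def)
    obtain d2 where d2: "0 < d2" "\<And>x y. x \<in> {t..s} \<Longrightarrow> y \<in> {t..s} \<Longrightarrow> \<bar>x - y\<bar> < d2 \<Longrightarrow> \<bar>U x - U y\<bar> < e / 4"
      using uc(2) e unfolding uniformly_continuous_on_def by (metis dist_real_def divide_pos_pos zero_less_numeral)
    have "h \<longlonglongrightarrow> 0" unfolding h_def by real_asymp
    then have "\<forall>\<^sub>F n in sequentially. h n < min d1 d2"
      using d1 d2 by (intro order_tendstoD) auto
    then obtain N where N: "\<And>n. N \<le> n \<Longrightarrow> h n < min d1 d2"
      by (auto simp: eventually_sequentially)
    \<comment> \<open>Starting at \<open>Suc N\<close> excludes \<open>n = 0\<close>, where division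
      by zero makes the mesh 0.\<close>
    have "norm (M n - U r0) < e" if n: "Suc N \<le> n" for n
    proof -
      have hn: "0 < h n" "h n < d1" "h n < d2" "real n * h n = s - t"
        using N[of n] n ts by (auto simp: h_def)
      have grid: "t + real i * h n \<in> {t..s}" if "i \<le> n" for i
      proof -
        have "real i * h n \<le> real n * h n" using that hn by (intro mult_right_mono) auto
        then show ?thesis using hn by auto
      qed
      have close: "\<bar>V n i - U (t + real i * h n)\<bar> \<le> e / 4" if i: "i \<le> n" for i
      proof -
        have "\<bar>h n * (\<Sum>j<i. f (t + real j * h n)) - integral {t..t + real i * h n} f\<bar> \<le> real i * h n * e'"
          using grid[OF i] hn e' d1(2) by (intro riemann_sum_error[OF f]) (auto intro: less_imp_le)
        also have "\<dots> \<le> (s - t) * e'" using grid[OF i] e' by (intro mult_right_mono) auto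
        finally have "k * \<bar>h n * (\<Sum>j<i. f (t + real j * h n)) - integral {t..t + real i * h n} f\<bar> \<le> k * ((s - t) * e')"
          using k by (intro mult_left_mono) auto
        moreover have "V n i - U (t + real i * h n) = k * (h n * (\<Sum>j<i. f (t + real j * h n)) - integral {t..t + real i * h n} f)"
          by (simp add: V_def U_def algebra_simps)
        moreover have "k * ((s - t) * e') = k * (s - t) * e'" by simp
        ultimately show ?thesis using e' k by (simp only: abs_mult abs_of_pos)
      qed
      have "M n \<le> U r0 + e / 4"
      proof -
        have "V n i \<le> U r0 + e / 4" if "i \<le> n" for i
          using close[OF that] r0(2)[OF grid[OF that]] by linarith
        then show ?thesis unfolding M_def by (subst Max_le_iff) auto
      qed
      moreover have "U r0 - e / 2 \<le> M n"
      proof -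
        \<comment> \<open>The last grid point not beyond the maximiser \<open>r0\<close>, hence
          within one mesh width of it.\<close>
        define i where "i = nat \<lfloor>(r0 - t) / h n\<rfloor>"
        have q: "0 \<le> (r0 - t) / h n" using r0(1) hn by auto
        have i: "real i \<le> (r0 - t) / h n" "(r0 - t) / h n < real i + 1"
          using q by (auto simp: i_def)
        have "(r0 - t) / h n \<le> real n" using r0(1) hn by (simp add: field_simps)
        then have i_le: "i \<le> n" using i(1) by linarith
        have "\<bar>(t + real i * h n) - r0\<bar> < d2"
          using i hn by (auto simp: field_simps abs_less_iff)
        then have "\<bar>U (t + real i * h n) - U r0\<bar> < e / 4"
          using d2(2)[OF grid[OF i_le] r0(1)] by simp
        moreover have "V n i \<le> M n" unfolding M_def using i_le by (intro Max_ge) auto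
        ultimately show ?thesis using close[OF i_le] by linarith
      qed
      ultimately show ?thesis using e unfolding real_norm_def by linarith
    qed
    then show "\<exists>no. \<forall>n\<ge>no. norm (M n - U r0) < e" by blast
  qed
  then show ?thesis
    unfolding SUP[symmetric] unfolding M_def V_def U_def h_def .
qed

text \<open>Multiplicative growth of \<open>Z\<close> is what allows its grid values to be absorbed
  into the drift of the exponential, and the positive lower bound keeps the diffusion coefficient of
  \<open>U\<close> away from zero.\<close>

lemma solves_Phi_ode_bounds:
  fixes Z \<Phi> :: "real \<Rightarrow> real"
  assumes Z: "solves_Phi_ode \<Phi> T t z Z" and L: "L-lipschitz_on UNIV \<Phi>" and \<Phi>0: "0 \<le> \<Phi> 0" and z: "0 < z" and tT: "t < T"
  obtains zmin \<Lambda> where "0 < zmin" "0 \<le> \<Lambda>" "\<And>r. r \<in> {t..T} \<Longrightarrow> zmin \<le> Z r"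
    "\<And>x y. t \<le> x \<Longrightarrow> x \<le> y \<Longrightarrow> y \<le> T \<Longrightarrow> Z y \<le> exp (\<Lambda> * (y - x)) * Z x"
    "continuous_on {t..T} Z"
proof -
  have Zt: "Z t = z" and der: "\<And>r. r \<in> {t..T} \<Longrightarrow> (Z has_real_derivative \<Phi> (Z r)) (at r within {t..T})"
    using Z by (auto simp: solves_Phi_ode_def)
  have cont: "continuous_on {t..T} Z"
    using der by (rule DERIV_continuous_on)
  have der': "(Z has_real_derivative \<Phi> (Z r)) (at r)" if "t < r" "r < T" for r
    using der[of r] that by (simp add: at_within_Icc_at)
  have L0: "0 \<le> L" using L by (rule lipschitz_on_nonneg)
  have lip: "\<bar>\<Phi> y - \<Phi> 0\<bar> \<le> L * \<bar>y\<bar>" for y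
    using lipschitz_onD[OF L, of y 0] by (simp add: dist_real_def)
  \<comment> \<open>While \<open>Z > 0\<close>, \<open>\<Phi> (Z r) \<ge> - L * Z r\<close>, so
    \<open>Z r * exp (L * (r - t))\<close> is nondecreasing. Positivity is asked only strictly
    between \<open>t\<close> and \<open>y\<close>, so that the estimate can be used at the first
    zero of \<open>Z\<close> to refute it.\<close>
  have lower: "Z t \<le> Z y * exp (L * (y - t))" if y: "t \<le> y" "y \<le> T" and pos: "\<And>r. t < r \<Longrightarrow> r < y \<Longrightarrow> 0 < Z r" for y
  proof -
    have "Z t * exp (L * (t - t)) \<le> Z y * exp (L * (y - t))"
    proof (rule DERIV_nonneg_imp_increasing_open[OF y(1), of "\<lambda>r. Z r * exp (L * (r - t))"])
      fix r assume r: "t < r" "r < y"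
      have "((\<lambda>r. Z r * exp (L * (r - t))) has_real_derivative (\<Phi> (Z r) + L * Z r) * exp (L * (r - t))) (at r)"
        using r y by (auto intro!: derivative_eq_intros der' simp: algebra_simps)
      moreover have "0 \<le> \<Phi> (Z r) + L * Z r"
        using lip[of "Z r"] \<Phi>0 pos[OF r] by (simp add: abs_le_iff)
      ultimately show "\<exists>d. ((\<lambda>r. Z r * exp (L * (r - t))) has_real_derivative d) (at r) \<and> 0 \<le> d"
        by (intro exI[of _ "(\<Phi> (Z r) + L * Z r) * exp (L * (r - t))"]) simp
    qed (use y in \<open>auto intro!: continuous_intros continuous_on_subset[OF cont]\<close>)
    then show ?thesis by simp
  qed
  have pos: "0 < Z r" if r: "r \<in> {t..T}" for r
  proof (rule ccontr)
    assume "\<not> 0 < Z r"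
    define B where "B = {r \<in> {t..T}. Z r \<le> 0}"
    have "closed {r \<in> {t..T}. Z r \<le> 0}"
      by (rule continuous_on_closed_Collect_le[OF cont]) (auto intro: continuous_intros)
    then have B: "B \<noteq> {}" "bdd_below B" "closed B"
      using r \<open>\<not> 0 < Z r\<close> unfolding B_def by (auto intro!: bdd_belowI[of _ t])
    define r1 where "r1 = Inf B"
    have "r1 \<in> B" unfolding r1_def by (rule closed_contains_Inf[OF B])
    then have r1: "t \<le> r1" "r1 \<le> T" "Z r1 \<le> 0" by (auto simp: B_def)
    have "0 < Z q" if "t < q" "q < r1" for q
    proof (rule ccontr)
      assume "\<not> 0 < Z q"
      then have "q \<in> B" using that r1 by (auto simp: B_def)
      then have "r1 \<le> q" unfolding r1_def using B by (intro cInf_lower)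
      then show False using that by simp
    qed
    then have "Z t \<le> Z r1 * exp (L * (r1 - t))" using r1 by (intro lower)
    also have "\<dots> \<le> 0" using r1 by (simp add: mult_le_0_iff)
    finally show False using Zt z by simp
  qed
  define zmin where "zmin = z * exp (- L * (T - t))"
  have zmin: "0 < zmin" using z by (simp add: zmin_def)
  have ge: "zmin \<le> Z r" if r: "r \<in> {t..T}" for r
  proof -
    have "z \<le> Z r * exp (L * (r - t))" using lower[of r] pos r Zt by auto
    also have "\<dots> \<le> Z r * exp (L * (T - t))" using pos[OF r] r L0 by (auto intro!: mult_left_mono)
    also have "z = zmin * exp (L * (T - t))" by (simp add: zmin_def exp_minus)
    finally show ?thesis by simp
  qed
  \<comment> \<open>The constant \<open>\<Phi> 0\<close> is turned into a multiple of
    \<open>Z\<close> by means of \<open>zmin \<le> Z r\<close>.\<close>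
  define \<Lambda> where "\<Lambda> = \<Phi> 0 / zmin + L"
  have \<Lambda>: "0 \<le> \<Lambda>" using \<Phi>0 zmin L0 by (simp add: \<Lambda>_def)
  have "Z y \<le> exp (\<Lambda> * (y - x)) * Z x" if xy: "t \<le> x" "x \<le> y" "y \<le> T" for x y
  proof -
    have "Z y * exp (- \<Lambda> * (y - x)) \<le> Z x * exp (- \<Lambda> * (x - x))"
    proof (rule DERIV_nonpos_imp_decreasing_open[OF xy(2), of "\<lambda>r. Z r * exp (- \<Lambda> * (r - x))"])
      fix r assume r: "x < r" "r < y"
      have "((\<lambda>r. Z r * exp (- \<Lambda> * (r - x))) has_real_derivative (\<Phi> (Z r) - \<Lambda> * Z r) * exp (- \<Lambda> * (r - x))) (at r)"
        using r xy by (auto intro!: derivative_eq_intros der' simp: algebra_simps)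
      moreover have "\<Phi> (Z r) - \<Lambda> * Z r \<le> 0"
      proof -
        have Zr: "zmin \<le> Z r" "0 < Z r" using r xy ge[of r] pos[of r] by auto
        have "\<Phi> (Z r) \<le> \<Phi> 0 + L * Z r" using lip[of "Z r"] Zr by (simp add: abs_le_iff)
        moreover have "\<Phi> 0 \<le> \<Phi> 0 / zmin * Z r"
          using mult_left_mono[OF Zr(1), of "\<Phi> 0 / zmin"] \<Phi>0 zmin by simp
        ultimately show ?thesis by (simp add: \<Lambda>_def algebra_simps)
      qed
      ultimately show "\<exists>d. ((\<lambda>r. Z r * exp (- \<Lambda> * (r - x))) has_real_derivative d) (at r) \<and> d \<le> 0"
        by (intro exI[of _ "(\<Phi> (Z r) - \<Lambda> * Z r) * exp (- \<Lambda> * (r - x))"]) (simp add: mult_nonpos_nonneg)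
    qed (use xy in \<open>auto intro!: continuous_intros continuous_on_subset[OF cont]\<close>)
    then have le: "Z y * exp (- \<Lambda> * (y - x)) \<le> Z x" by simp
    have "Z y = Z y * exp (- \<Lambda> * (y - x)) * exp (\<Lambda> * (y - x))"
      by (simp add: mult.assoc exp_add[symmetric])
    also have "\<dots> \<le> Z x * exp (\<Lambda> * (y - x))"
      using le by (intro mult_right_mono) auto
    finally show ?thesis by (simp only: mult.commute)
  qed
  then show ?thesis by (intro that[OF zmin \<Lambda> ge _ cont])
qed

subsection \<open>Transfer to Brownian motion\<close>

context filtered_brownian_motion
begin

lemma space_F: "r \<in> {0..T} \<Longrightarrow> space (F r) = space P"
  using subalgebra_F by (auto simp: subalgebra_def)

lemma W_measurable_F: "0 \<le> r \<Longrightarrow> r \<le> q \<Longrightarrow> q \<le> T \<Longrightarrow> W r \<in> borel_measurable (F q)"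
  using adapted_W[of r] mono_F[of r q] space_F[of r] space_F[of q]
  by (auto simp: measurable_def)

lemma measurable_F_imp_P: "r \<in> {0..T} \<Longrightarrow> f \<in> measurable (F r) N \<Longrightarrow> f \<in> measurable P N"
  using subalgebra_F by (rule measurable_from_subalg)

text \<open>Conditioning on \<open>F q\<close> as a Fubini formula: the identity map into
  \<open>F q\<close> represents the past as a random element, and independence says that its joint
  law with the increment is a product, which is checked on rectangles.\<close>

lemma nn_integral_increment:
  assumes qv: "0 \<le> q" "q < v" "v \<le> T"
    and g: "g \<in> borel_measurable (F q \<Otimes>\<^sub>M borel)"
  shows "(\<integral>\<^sup>+\<omega>. g (\<omega>, W v \<omega> - W q \<omega>) \<partial>P) = (\<integral>\<^sup>+\<omega>. \<integral>\<^sup>+x. g (\<omega>, x) \<partial>gauss_seq.G (v - q) \<partial>P)"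
proof -
  interpret GG: gauss_seq "v - q" by unfold_locales (use qv in simp)
  let ?I = "\<lambda>\<omega>. W v \<omega> - W q \<omega>"
  have sp: "space (F q) = space P" using qv by (intro space_F) auto
  have id: "(\<lambda>\<omega>. \<omega>) \<in> measurable P (F q)"
    by (rule measurable_F_imp_P[OF _ measurable_ident_sets]) (use qv in auto)
  have I[measurable]: "?I \<in> borel_measurable P"
    using qv by (intro borel_measurable_diff measurable_F_imp_P[OF _ adapted_W]) auto
  interpret A: prob_space "distr P (F q) (\<lambda>\<omega>. \<omega>)" by (rule prob_space_distr[OF id])
  interpret B: prob_space "distr P borel ?I" by (rule prob_space_distr[OF I])
  have joint: "distr P (F q) (\<lambda>\<omega>. \<omega>) \<Otimes>\<^sub>M distr P borel ?I = distr P (F q \<Otimes>\<^sub>M borel) (\<lambda>\<omega>. (\<omega>, ?I \<omega>))"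
  proof (rule pair_measure_eqI)
    fix A B assume "A \<in> sets (distr P (F q) (\<lambda>\<omega>. \<omega>))" "B \<in> sets (distr P borel ?I)"
    then have A: "A \<in> sets (F q)" and B: "B \<in> sets borel" by auto
    have A': "A \<subseteq> space P" using sets.sets_into_space[OF A] unfolding sp .
    have vim: "?I -` B \<inter> space P \<in> sets (vimage_algebra (space P) ?I borel)"
      using B by (rule in_vimage_algebra)
    have pair: "(\<lambda>\<omega>. (\<omega>, ?I \<omega>)) \<in> measurable P (F q \<Otimes>\<^sub>M borel)"
      by (rule measurable_Pair[OF id I])
    have "emeasure (distr P (F q \<Otimes>\<^sub>M borel) (\<lambda>\<omega>. (\<omega>, ?I \<omega>))) (A \<times> B) = emeasure P (A \<inter> (?I -` B \<inter> space P))"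
      using A B A' by (subst emeasure_distr[OF pair]) (auto intro!: arg_cong[where f = "emeasure P"])
    also have "\<dots> = ennreal (prob A * prob (?I -` B \<inter> space P))"
      using indep_setD[OF indep_increments_W[OF qv] A vim] by (simp add: emeasure_eq_measure)
    also have "\<dots> = emeasure (distr P (F q) (\<lambda>\<omega>. \<omega>)) A * emeasure (distr P borel ?I) B"
      using A B A' emeasure_distr[OF id A] emeasure_distr[OF I B]
      by (simp add: emeasure_eq_measure ennreal_mult Int_absorb2)
    finally show "emeasure (distr P (F q) (\<lambda>\<omega>. \<omega>)) A * emeasure (distr P borel ?I) B =
      emeasure (distr P (F q \<Otimes>\<^sub>M borel) (\<lambda>\<omega>. (\<omega>, ?I \<omega>))) (A \<times> B)" ..
  qed (simp_all add: A.sigma_finite_measure_axioms B.sigma_finite_measure_axioms cong: sets_pair_measure_cong)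
  have "distr P borel ?I = distr P lborel ?I" by (rule distr_cong) auto
  also have "\<dots> = GG.G"
    unfolding GG.G_def by (rule distributed_distr_eq_density[OF normal_increments_W[OF qv]])
  finally have DI: "distr P borel ?I = GG.G" .
  have "(\<integral>\<^sup>+\<omega>. g (\<omega>, ?I \<omega>) \<partial>P) = (\<integral>\<^sup>+p. g p \<partial>distr P (F q \<Otimes>\<^sub>M borel) (\<lambda>\<omega>. (\<omega>, ?I \<omega>)))"
    using id I g by (subst nn_integral_distr) auto
  also have "\<dots> = (\<integral>\<^sup>+p. g p \<partial>(distr P (F q) (\<lambda>\<omega>. \<omega>) \<Otimes>\<^sub>M GG.G))"
    unfolding joint[symmetric] DI ..
  also have "\<dots> = (\<integral>\<^sup>+\<omega>. \<integral>\<^sup>+x. g (\<omega>, x) \<partial>GG.G \<partial>distr P (F q) (\<lambda>\<omega>. \<omega>))"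
    using g by (intro GG.G.nn_integral_fst[symmetric]) (simp cong: measurable_cong_sets sets_pair_measure_cong)
  also have "\<dots> = (\<integral>\<^sup>+\<omega>. \<integral>\<^sup>+x. g (\<omega>, x) \<partial>GG.G \<partial>P)"
  proof -
    have "g \<in> borel_measurable (F q \<Otimes>\<^sub>M GG.G)"
      using g by (simp cong: measurable_cong_sets sets_pair_measure_cong)
    then have "(\<lambda>\<omega>. \<integral>\<^sup>+x. g (\<omega>, x) \<partial>GG.G) \<in> borel_measurable (F q)"
      by (rule GG.G.borel_measurable_nn_integral_fst)
    then show ?thesis by (subst nn_integral_distr[OF id]) simp_all
  qed
  finally show ?thesis .
qed

section \<open>Exponential change of measure and removal of the drift\<close>

text \<open>Girsanov density process. The parameters \<open>- \<sigma>\<close>,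
  \<open>\<sigma>\<close> and 0 at time \<open>T\<close> give the two new measures and
  \<open>P\<close> itself, so all three are treated together.\<close>

definition tilt :: "real \<Rightarrow> real \<Rightarrow> real \<Rightarrow> 'a \<Rightarrow> ennreal" where
  "tilt \<theta> t r \<omega> = ennreal (exp (\<theta> * (W r \<omega> - W t \<omega>) - \<theta>\<^sup>2 / 2 * (r - t)))"

lemma tilt_measurable: "0 \<le> t \<Longrightarrow> t \<le> r \<Longrightarrow> r \<le> q \<Longrightarrow> q \<le> T \<Longrightarrow> tilt \<theta> t r \<in> borel_measurable (F q)"
  unfolding tilt_def using W_measurable_F[of r q] W_measurable_F[of t q] by measurable

lemma tilt_mult: "tilt \<theta> t v \<omega> = tilt \<theta> t q \<omega> * ennreal (exp (\<theta> * (W v \<omega> - W q \<omega>) - \<theta>\<^sup>2 / 2 * (v - q)))"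
  unfolding tilt_def by (subst ennreal_mult[symmetric]) (auto simp: exp_add[symmetric] field_simps)

lemma nn_integral_tilt:
  assumes t: "0 \<le> t" "t \<le> q" "q \<le> v" "v \<le> T" and Y: "Y \<in> borel_measurable (F q)"
  shows "(\<integral>\<^sup>+\<omega>. Y \<omega> * tilt \<theta> t v \<omega> \<partial>P) = (\<integral>\<^sup>+\<omega>. Y \<omega> * tilt \<theta> t q \<omega> \<partial>P)"
proof (cases "q = v")
  case False
  then have qv: "q < v" using t by simp
  interpret GG: gauss_seq "v - q" by unfold_locales (use qv in simp)
  note [measurable] = Y tilt_measurable[of t q q \<theta>]
  let ?g = "\<lambda>(\<omega>, x). Y \<omega> * tilt \<theta> t q \<omega> * ennreal (exp (\<theta> * x - \<theta>\<^sup>2 / 2 * (v - q)))"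
  have one: "(\<integral>\<^sup>+x. ennreal (exp (\<theta> * x - \<theta>\<^sup>2 / 2 * (v - q))) \<partial>GG.G) = 1"
  proof -
    have "(\<integral>\<^sup>+x. ennreal (exp (\<theta> * x - \<theta>\<^sup>2 / 2 * (v - q))) \<partial>GG.G) =
      (\<integral>\<^sup>+x. ennreal (exp (- (\<theta>\<^sup>2 / 2 * (v - q)))) * ennreal (exp (\<theta> * x)) \<partial>GG.G)"
      by (intro nn_integral_cong) (simp add: ennreal_mult[symmetric] exp_add[symmetric])
    also have "\<dots> = ennreal (exp (- (\<theta>\<^sup>2 / 2 * (v - q)))) * ennreal (exp (\<theta>\<^sup>2 * (v - q) / 2))"
      by (subst nn_integral_cmult) (simp_all add: GG.nn_integral_G_exp)
    also have "\<dots> = 1" by (simp add: ennreal_mult[symmetric] exp_add[symmetric])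
    finally show ?thesis .
  qed
  have "(\<integral>\<^sup>+\<omega>. Y \<omega> * tilt \<theta> t v \<omega> \<partial>P) = (\<integral>\<^sup>+\<omega>. ?g (\<omega>, W v \<omega> - W q \<omega>) \<partial>P)"
    by (simp add: tilt_mult[of \<theta> t v _ q] mult.assoc)
  also have "\<dots> = (\<integral>\<^sup>+\<omega>. \<integral>\<^sup>+x. ?g (\<omega>, x) \<partial>GG.G \<partial>P)"
    using t qv by (intro nn_integral_increment) measurable
  also have "\<dots> = (\<integral>\<^sup>+\<omega>. Y \<omega> * tilt \<theta> t q \<omega> \<partial>P)"
    using one by (simp add: nn_integral_cmult)
  finally show ?thesis .
qed simp

text \<open>Under the tilt \<open>W\<close> acquires drift \<open>\<theta>\<close>, which is
  subtracted. The entries from \<open>n\<close> on are set to 0 to obtain a point of the sequence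
  space.\<close>

definition drift_free :: "real \<Rightarrow> real \<Rightarrow> real \<Rightarrow> nat \<Rightarrow> 'a \<Rightarrow> nat \<Rightarrow> real" where
  "drift_free \<theta> t h n \<omega> i = (if i < n then W (t + real (Suc i) * h) \<omega> - W (t + real i * h) \<omega> - \<theta> * h else 0)"

lemma sum_drift_free:
  "i \<le> n \<Longrightarrow> (\<Sum>j<i. drift_free \<theta> t h n \<omega> j) = W (t + real i * h) \<omega> - W t \<omega> - real i * (\<theta> * h)"
  by (induction i) (auto simp: drift_free_def algebra_simps)

text \<open>Discrete Girsanov theorem. The induction splits off the last increment, the one
  independent of the \<open>\<sigma>\<close>-algebra \<open>F q\<close> that carries all the others;
  the truncation on the right mirrors the zeros of \<open>drift_free\<close>.\<close>

lemma nn_integral_drift_free: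
  assumes h: "0 < h" and t: "0 \<le> t" "t + real n * h \<le> T"
    and f: "f \<in> borel_measurable (gauss_seq.GS h)"
  shows "(\<integral>\<^sup>+\<omega>. f (drift_free \<theta> t h n \<omega>) * tilt \<theta> t (t + real n * h) \<omega> \<partial>P) =
    (\<integral>\<^sup>+x. f (\<lambda>i. if i < n then x i else 0) \<partial>gauss_seq.GS h)"
  using t(2) f
proof (induction n arbitrary: f)
  case 0
  interpret GG: gauss_seq h by unfold_locales (rule h)
  show ?case
    by (simp add: drift_free_def[abs_def] tilt_def emeasure_space_1 GG.GS.emeasure_space_1[simplified])
next
  case (Suc n)
  interpret GG: gauss_seq h by unfold_locales (rule h)
  interpret pair_sigma_finite GG.GS GG.G ..
  note [measurable] = Suc.prems(2)
  define q where "q = t + real n * h"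
  define v where "v = t + real (Suc n) * h"
  have qv: "0 \<le> q" "q < v" "v \<le> T" "t \<le> q" and vq: "v - q = h"
    using h t(1) Suc.prems(1) by (auto simp: q_def v_def algebra_simps)
  have le: "t + real n * h \<le> T" using qv by (simp add: q_def)
  have [measurable]: "tilt \<theta> t q \<in> borel_measurable (F q)"
    using qv t by (intro tilt_measurable) auto
  have W_m: "W (t + real i * h) \<in> borel_measurable (F q)" if "i \<le> n" for i
    using that qv t h by (intro W_measurable_F) (auto simp: q_def)
  have Y_m[measurable]: "(\<lambda>\<omega>. drift_free \<theta> t h n \<omega> i) \<in> borel_measurable (F q)" for i
  proof (cases "i < n")
    case True
    then have "(\<lambda>\<omega>. W (t + real (Suc i) * h) \<omega> - W (t + real i * h) \<omega> - \<theta> * h) \<in> borel_measurable (F q)"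
      by (intro borel_measurable_diff W_m) auto
    then show ?thesis using True unfolding drift_free_def by simp
  qed (simp add: drift_free_def)
  have [measurable]: "(\<lambda>(\<omega>, x). (drift_free \<theta> t h n \<omega>)(n := x - \<theta> * h)) \<in> F q \<Otimes>\<^sub>M borel \<rightarrow>\<^sub>M GG.GS"
    unfolding split_beta' by (rule GG.measurable_GS_I) (simp add: fun_upd_def)
  have upd[measurable]: "(\<lambda>(y, x). y(n := x)) \<in> GG.GS \<Otimes>\<^sub>M GG.G \<rightarrow>\<^sub>M GG.GS"
    unfolding split_beta' by (rule GG.measurable_GS_I) (simp add: fun_upd_def)
  have upd2[measurable]: "(\<lambda>x. y(n := x)) \<in> borel \<rightarrow>\<^sub>M GG.GS" for y
    by (rule GG.measurable_GS_I) (simp add: fun_upd_def)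
  have trunc[measurable]: "(\<lambda>x i. if i < n then x i else 0) \<in> GG.GS \<rightarrow>\<^sub>M GG.GS"
    by (rule GG.measurable_GS_I) simp
  have trunc2[measurable]: "(\<lambda>x i. if i < Suc n then x i else 0) \<in> GG.GS \<rightarrow>\<^sub>M GG.GS"
    by (rule GG.measurable_GS_I) simp
  define f1 where "f1 = (\<lambda>y. \<integral>\<^sup>+x. f (y(n := x)) \<partial>GG.G)"
  have [measurable]: "f1 \<in> borel_measurable GG.GS" unfolding f1_def by measurable
  let ?g = "\<lambda>(\<omega>, x). f ((drift_free \<theta> t h n \<omega>)(n := x - \<theta> * h)) * tilt \<theta> t q \<omega> * ennreal (exp (\<theta> * x - \<theta>\<^sup>2 / 2 * h))"
  have shift: "(\<integral>\<^sup>+x. f (y(n := x - \<theta> * h)) * ennreal (exp (\<theta> * x - \<theta>\<^sup>2 / 2 * h)) \<partial>GG.G) = f1 y" for y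
  proof -
    have "- (- \<theta> * h) * x / h - (- \<theta> * h)\<^sup>2 / (2 * h) = \<theta> * x - \<theta>\<^sup>2 / 2 * h" for x
      using h by (simp add: power2_eq_square)
    then show ?thesis
      using GG.nn_integral_G_shift[of "\<lambda>x. f (y(n := x))" "- \<theta> * h"] by (simp add: f1_def)
  qed
  have "(\<integral>\<^sup>+\<omega>. f (drift_free \<theta> t h (Suc n) \<omega>) * tilt \<theta> t v \<omega> \<partial>P) = (\<integral>\<^sup>+\<omega>. ?g (\<omega>, W v \<omega> - W q \<omega>) \<partial>P)"
  proof (intro nn_integral_cong)
    fix \<omega>
    have "drift_free \<theta> t h (Suc n) \<omega> = (drift_free \<theta> t h n \<omega>)(n := W v \<omega> - W q \<omega> - \<theta> * h)"
      by (auto simp: fun_eq_iff drift_free_def q_def v_def)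
    then show "f (drift_free \<theta> t h (Suc n) \<omega>) * tilt \<theta> t v \<omega> = ?g (\<omega>, W v \<omega> - W q \<omega>)"
      by (simp add: tilt_mult[of \<theta> t v _ q] vq mult.assoc)
  qed
  also have "\<dots> = (\<integral>\<^sup>+\<omega>. \<integral>\<^sup>+x. ?g (\<omega>, x) \<partial>gauss_seq.G (v - q) \<partial>P)"
    by (rule nn_integral_increment[OF qv(1-3)]) measurable
  also have "\<dots> = (\<integral>\<^sup>+\<omega>. f1 (drift_free \<theta> t h n \<omega>) * tilt \<theta> t q \<omega> \<partial>P)"
  proof (intro nn_integral_cong)
    fix \<omega>
    have "(\<integral>\<^sup>+x. ?g (\<omega>, x) \<partial>GG.G) =
      (\<integral>\<^sup>+x. (f ((drift_free \<theta> t h n \<omega>)(n := x - \<theta> * h)) * ennreal (exp (\<theta> * x - \<theta>\<^sup>2 / 2 * h))) * tilt \<theta> t q \<omega> \<partial>GG.G)"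
      by (intro nn_integral_cong) (simp add: mult_ac)
    also have "\<dots> = f1 (drift_free \<theta> t h n \<omega>) * tilt \<theta> t q \<omega>"
    proof (subst nn_integral_multc)
      have "(\<lambda>x. (drift_free \<theta> t h n \<omega>)(n := x - \<theta> * h)) \<in> borel \<rightarrow>\<^sub>M GG.GS"
        by (rule GG.measurable_GS_I) (simp add: fun_upd_def)
      then show "(\<lambda>x. f ((drift_free \<theta> t h n \<omega>)(n := x - \<theta> * h)) * ennreal (exp (\<theta> * x - \<theta>\<^sup>2 / 2 * h))) \<in> borel_measurable GG.G"
        by simp
    qed (simp only: shift)
    finally show "(\<integral>\<^sup>+x. ?g (\<omega>, x) \<partial>gauss_seq.G (v - q)) = f1 (drift_free \<theta> t h n \<omega>) * tilt \<theta> t q \<omega>"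
      unfolding vq .
  qed
  also have "\<dots> = (\<integral>\<^sup>+x. f1 (\<lambda>i. if i < n then x i else 0) \<partial>GG.GS)"
    unfolding q_def using le by (intro Suc.IH) auto
  also have "\<dots> = (\<integral>\<^sup>+x. \<integral>\<^sup>+\<omega>. f ((\<lambda>i. if i < n then \<omega> i else 0)(n := x)) \<partial>GG.GS \<partial>GG.G)"
    unfolding f1_def
    by (rule Fubini'[symmetric]) measurable
  \<comment> \<open>A redundant integral over \<open>\<omega>'\<close> turns \<open>x\<close> into
    coordinate 0 of a sequence, so that the two splitting formulas, read backwards, reassemble a
    single sequence.\<close>
  also have "\<dots> = (\<integral>\<^sup>+x. \<integral>\<^sup>+\<omega>'. \<integral>\<^sup>+\<omega>. f ((\<lambda>i. if i < n then \<omega> i else 0)(n := case_nat x \<omega>' 0)) \<partial>GG.GS \<partial>GG.GS \<partial>GG.G)"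
    by (simp add: GG.GS.emeasure_space_1[simplified])
  also have "\<dots> = (\<integral>\<^sup>+\<omega>'. \<integral>\<^sup>+\<omega>. f ((\<lambda>i. if i < n then \<omega> i else 0)(n := \<omega>' 0)) \<partial>GG.GS \<partial>GG.GS)"
    by (rule GG.nn_integral_GS_Suc[symmetric]) measurable
  also have "\<dots> = (\<integral>\<^sup>+\<omega>'. \<integral>\<^sup>+\<omega>. f (\<lambda>i. if i < Suc n then comb_seq n \<omega> \<omega>' i else 0) \<partial>GG.GS \<partial>GG.GS)"
  proof (intro nn_integral_cong arg_cong[where f = f])
    fix \<omega> \<omega>' :: "nat \<Rightarrow> real"
    show "(\<lambda>i. if i < n then \<omega> i else 0)(n := \<omega>' 0) = (\<lambda>i. if i < Suc n then comb_seq n \<omega> \<omega>' i else 0)"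
      using comb_seq_add[of n \<omega> \<omega>' 0] by (auto simp: fun_eq_iff comb_seq_less less_Suc_eq)
  qed
  also have "\<dots> = (\<integral>\<^sup>+x. f (\<lambda>i. if i < Suc n then x i else 0) \<partial>GG.GS)"
    by (rule GG.nn_integral_GS_split[symmetric]) measurable
  finally show ?case unfolding v_def .
qed

section \<open>The supremum as a limit of grid maxima\<close>

text \<open>For \<open>\<beta> = \<delta> + \<sigma>^2 / 2\<close> this is the reciprocal of
  \<open>K_proc\<close>.\<close>

definition GBM :: "real \<Rightarrow> real \<Rightarrow> real \<Rightarrow> real \<Rightarrow> 'a \<Rightarrow> real" where
  "GBM \<beta> \<sigma> t r \<omega> = exp (\<beta> * (r - t) - \<sigma> * (W r \<omega> - W t \<omega>))"

definition U_sup :: "real \<Rightarrow> real \<Rightarrow> real \<Rightarrow> (real \<Rightarrow> real) \<Rightarrow> real \<Rightarrow> real \<Rightarrow> 'a \<Rightarrow> real" where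
  "U_sup \<beta> \<sigma> k Z t s \<omega> =
     (SUP r\<in>{t..s}. k * integral {t..r} (\<lambda>r. GBM \<beta> \<sigma> t r \<omega>) - GBM \<beta> \<sigma> t r \<omega> * Z r)"

definition U_grid :: "real \<Rightarrow> real \<Rightarrow> real \<Rightarrow> (real \<Rightarrow> real) \<Rightarrow> real \<Rightarrow> real \<Rightarrow> nat \<Rightarrow> 'a \<Rightarrow> real" where
  "U_grid \<beta> \<sigma> k Z t h i \<omega> =
     k * h * (\<Sum>j<i. GBM \<beta> \<sigma> t (t + real j * h) \<omega>) - GBM \<beta> \<sigma> t (t + real i * h) \<omega> * Z (t + real i * h)"

definition U_grid_max :: "real \<Rightarrow> real \<Rightarrow> real \<Rightarrow> (real \<Rightarrow> real) \<Rightarrow> real \<Rightarrow> real \<Rightarrow> nat \<Rightarrow> 'a \<Rightarrow> real" where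
  "U_grid_max \<beta> \<sigma> k Z t s n \<omega> = Max ((\<lambda>i. U_grid \<beta> \<sigma> k Z t ((s - t) / real n) i \<omega>) ` {..n})"

lemma GBM_measurable: "0 \<le> t \<Longrightarrow> t \<le> r \<Longrightarrow> r \<le> q \<Longrightarrow> q \<le> T \<Longrightarrow> GBM \<beta> \<sigma> t r \<in> borel_measurable (F q)"
  unfolding GBM_def using W_measurable_F[of r q] W_measurable_F[of t q] by measurable

lemma U_grid_measurable:
  assumes "0 \<le> t" "0 \<le> h" "t + real i * h \<le> q" "q \<le> T"
  shows "U_grid \<beta> \<sigma> k Z t h i \<in> borel_measurable (F q)"
proof -
  have "GBM \<beta> \<sigma> t (t + real j * h) \<in> borel_measurable (F q)" if "j \<le> i" for j
  proof (rule GBM_measurable)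
    have "real j * h \<le> real i * h" using that assms by (intro mult_right_mono) auto
    then show "t + real j * h \<le> q" using assms by linarith
  qed (use assms in auto)
  then show ?thesis
    unfolding U_grid_def
    by (intro borel_measurable_diff borel_measurable_times borel_measurable_sum borel_measurable_const) auto
qed

lemma U_grid_max_measurable:
  assumes "0 \<le> t" "t \<le> s" "s \<le> T"
  shows "U_grid_max \<beta> \<sigma> k Z t s n \<in> borel_measurable (F s)"
  unfolding U_grid_max_def
proof (rule borel_measurable_Max)
  fix i assume "i \<in> {..n}"
  then have "real i * ((s - t) / real n) \<le> real n * ((s - t) / real n)"
    using assms by (intro mult_right_mono) auto
  also have "\<dots> \<le> s - t" using assms by simp
  finally have "real i * ((s - t) / real n) \<le> s - t" .
  then show "U_grid \<beta> \<sigma> k Z t ((s - t) / real n) i \<in> borel_measurable (F s)"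
    using assms by (intro U_grid_measurable) auto
qed simp

lemma U_grid_max_tendsto:
  assumes ts: "0 \<le> t" "t < s" "s \<le> T" and k: "0 < k" and Z: "continuous_on {t..s} Z"
    and W: "continuous_on {0..T} (\<lambda>r. W r \<omega>)"
  shows "(\<lambda>n. U_grid_max \<beta> \<sigma> k Z t s n \<omega>) \<longlonglongrightarrow> U_sup \<beta> \<sigma> k Z t s \<omega>"
proof -
  have "continuous_on {t..s} (\<lambda>r. W r \<omega>)"
    using W by (rule continuous_on_subset) (use ts in auto)
  then have "continuous_on {t..s} (\<lambda>r. GBM \<beta> \<sigma> t r \<omega>)"
    unfolding GBM_def by (intro continuous_intros)
  then show ?thesis
    unfolding U_grid_max_def U_grid_def U_sup_def
    by (intro grid_max_tendsto_SUP ts k continuous_on_mult Z)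
qed

text \<open>The drift removed from the increments reappears in the exponent as
  \<open>- \<sigma> * \<theta>\<close>.\<close>

lemma U_grid_eq_V:
  assumes walk: "gauss_walk h \<sigma> k" and i: "i \<le> n" and z: "z i = Z (t + real i * h)"
  shows "U_grid \<beta> \<sigma> k Z t h i \<omega> = gauss_walk.V h (\<beta> - \<sigma> * \<theta>) \<sigma> k z i (drift_free \<theta> t h n \<omega>)"
proof -
  interpret gauss_walk h "\<beta> - \<sigma> * \<theta>" \<sigma> k by (rule walk)
  have "X j (drift_free \<theta> t h n \<omega>) = GBM \<beta> \<sigma> t (t + real j * h) \<omega>" if "j \<le> n" for j
    unfolding X_def GBM_def sum_drift_free[OF that] by (simp add: algebra_simps)
  then show ?thesis
    using i by (simp add: U_grid_def V_def z)
qed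

lemma AE_continuous_null_set:
  obtains N where "N \<in> null_sets P" "\<And>A. A \<subseteq> N \<Longrightarrow> A \<in> sets (F T)"
    "\<And>\<omega>. \<omega> \<in> space P \<Longrightarrow> \<omega> \<notin> N \<Longrightarrow> continuous_on {0..T} (\<lambda>r. W r \<omega>)"
proof -
  from continuous_W obtain N where N: "N \<in> null_sets P" "{\<omega> \<in> space P. \<not> continuous_on {0..T} (\<lambda>r. W r \<omega>)} \<subseteq> N"
    by (auto simp: eventually_ae_filter)
  have "A \<in> sets (F T)" if "A \<subseteq> N" for A
    using null_sets_F[OF N(1) that] mono_F[of 0 T] T_pos by auto
  then show ?thesis using N by (intro that[of N]) auto
qed

lemma U_sup_measurable:
  assumes ts: "0 \<le> t" "t < s" "s \<le> T" and k: "0 < k" and Z: "continuous_on {t..s} Z"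
  shows "U_sup \<beta> \<sigma> k Z t s \<in> borel_measurable (F T)"
proof -
  obtain N where N: "N \<in> null_sets P" "\<And>A. A \<subseteq> N \<Longrightarrow> A \<in> sets (F T)"
    "\<And>\<omega>. \<omega> \<in> space P \<Longrightarrow> \<omega> \<notin> N \<Longrightarrow> continuous_on {0..T} (\<lambda>r. W r \<omega>)"
    by (rule AE_continuous_null_set) blast
  let ?S = "U_sup \<beta> \<sigma> k Z t s"
  have NT: "N \<in> sets (F T)" by (rule N(2)) simp
  have sp: "space (F T) = space P" using T_pos by (intro space_F) auto
  \<comment> \<open>Where the path is discontinuous the grid maxima need not converge. The default 0
    on \<open>N\<close> restores a pointwise limit, and completeness makes every subset of
    \<open>N\<close> measurable, hence also the uncontrolled part of the preimage.\<close>
  define S' where "S' = (\<lambda>\<omega>. if \<omega> \<in> N then 0 else ?S \<omega>)"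
  have S': "S' \<in> borel_measurable (F T)"
  proof (rule borel_measurable_LIMSEQ_real)
    fix n
    have "U_grid_max \<beta> \<sigma> k Z t s n \<in> borel_measurable (F T)"
      using U_grid_max_measurable[of t s \<beta> \<sigma> k Z n] mono_F[of s T] ts space_F[of s] sp
      by (auto simp: measurable_def)
    then show "(\<lambda>\<omega>. if \<omega> \<in> N then 0 else U_grid_max \<beta> \<sigma> k Z t s n \<omega>) \<in> borel_measurable (F T)"
      using NT by measurable
  next
    fix \<omega> assume "\<omega> \<in> space (F T)"
    then show "(\<lambda>n. if \<omega> \<in> N then 0 else U_grid_max \<beta> \<sigma> k Z t s n \<omega>) \<longlonglongrightarrow> S' \<omega>"
      using U_grid_max_tendsto[OF ts k Z N(3)] sp by (cases "\<omega> \<in> N") (auto simp: S'_def)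
  qed
  show ?thesis
  proof (rule measurableI)
    fix A :: "real set" assume "A \<in> sets borel"
    then have "S' -` A \<inter> space (F T) \<in> sets (F T)" by (rule measurable_sets[OF S'])
    moreover have "?S -` A \<inter> space (F T) \<inter> N \<in> sets (F T)" by (rule N(2)) auto
    moreover have "?S -` A \<inter> space (F T) = ((S' -` A \<inter> space (F T)) - N) \<union> (?S -` A \<inter> space (F T) \<inter> N)"
      by (auto simp: S'_def)
    ultimately show "?S -` A \<inter> space (F T) \<in> sets (F T)" using NT by (metis sets.Un sets.Diff)
  qed simp
qed

lemma emeasure_tilt_U_sup:
  fixes \<beta> \<sigma> k \<theta> zmin \<Lambda> :: real
  assumes ts: "0 \<le> t" "t < s" "s \<le> T" and \<sigma>: "0 < \<sigma>" and k: "0 < k" and Z: "continuous_on {t..s} Z"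
    and zmin: "0 < zmin" and \<Lambda>: "0 \<le> \<Lambda>" and ge: "\<And>r. r \<in> {t..s} \<Longrightarrow> zmin \<le> Z r"
    and growth: "\<And>x y. t \<le> x \<Longrightarrow> x \<le> y \<Longrightarrow> y \<le> s \<Longrightarrow> Z y \<le> exp (\<Lambda> * (y - x)) * Z x"
  obtains C where "0 \<le> C" "\<And>u v. u < v \<Longrightarrow>
    emeasure (density P (tilt \<theta> t T)) {\<omega> \<in> space P. u < U_sup \<beta> \<sigma> k Z t s \<omega> \<and> U_sup \<beta> \<sigma> k Z t s \<omega> < v} \<le> ennreal (C * (v - u))"
proof -
  define L where "L = s - t"
  have L: "0 < L" using ts by (simp add: L_def)
  obtain C where C: "0 \<le> C" and bound: "\<And>\<epsilon>. 0 < \<epsilon> \<Longrightarrow> \<forall>\<^sub>F l in sequentially. \<forall>z u v.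
      (\<forall>i. zmin \<le> z i) \<longrightarrow> (\<forall>i. z (Suc i) \<le> exp (\<Lambda> * (L / real (4 * l))) * z i) \<longrightarrow> u \<le> v \<longrightarrow>
      emeasure (gauss_seq.GS (L / real (4 * l)))
        {\<omega>. (\<exists>i\<le>4 * l. u < gauss_walk.V (L / real (4 * l)) (\<beta> - \<sigma> * \<theta>) \<sigma> k z i \<omega>) \<and>
             (\<forall>i\<le>4 * l. gauss_walk.V (L / real (4 * l)) (\<beta> - \<sigma> * \<theta>) \<sigma> k z i \<omega> < v)} \<le> ennreal (C * (v - u) + \<epsilon>)"
    by (rule emeasure_max_V_uniform[OF L \<sigma> k zmin, of \<Lambda> "\<beta> - \<sigma> * \<theta>"]) (rule that)
  let ?S = "U_sup \<beta> \<sigma> k Z t s"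
  let ?M = "\<lambda>l. U_grid_max \<beta> \<sigma> k Z t s (4 * l)"
  let ?Q = "density P (tilt \<theta> t T)"
  have tilt_P[measurable]: "tilt \<theta> t T \<in> borel_measurable P"
    by (rule measurable_F_imp_P[of T], use ts in simp, rule tilt_measurable) (use ts in auto)
  have M_F: "{\<omega> \<in> space (F s). u < ?M l \<omega> \<and> ?M l \<omega> < v} \<in> sets (F s)" for l u v
  proof -
    have [measurable]: "?M l \<in> borel_measurable (F s)"
      by (rule U_grid_max_measurable) (use ts in auto)
    show ?thesis by measurable
  qed
  have sp: "space (F s) = space P" using ts by (intro space_F) auto
  have M_P: "{\<omega> \<in> space P. u < ?M l \<omega> \<and> ?M l \<omega> < v} \<in> sets P" for l u v
    using M_F[of u l v] subalgebra_F[of s] ts unfolding sp by (auto simp: subalgebra_def)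
  have grid_bound: "\<forall>\<^sub>F l in sequentially. emeasure ?Q {\<omega> \<in> space P. u < ?M l \<omega> \<and> ?M l \<omega> < v} \<le> ennreal (C * (v - u) + \<epsilon>)"
    if uv: "u < v" and \<epsilon>: "0 < \<epsilon>" for u v \<epsilon>
    using bound[OF \<epsilon>] eventually_ge_at_top[of 1]
  proof eventually_elim
    case (elim l)
    define h where "h = L / real (4 * l)"
    define z where "z = (\<lambda>i. Z (min (t + real i * h) s))"
      \<comment> \<open>frozen after \<open>s\<close>, because the growth condition on \<open>z\<close> is required at all indices\<close>
    have h: "0 < h" using L elim by (simp add: h_def)
    have lh: "t + real (4 * l) * h = s" using elim by (simp add: h_def L_def)
    interpret gauss_walk h "\<beta> - \<sigma> * \<theta>" \<sigma> k
      by unfold_locales (use h \<sigma> k in auto)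
    let ?E = "{x. (\<exists>i\<le>4 * l. u < V z i x) \<and> (\<forall>i\<le>4 * l. V z i x < v)}"
    have E[measurable]: "?E \<in> sets GS" by (rule sets_GS_Collect) measurable
    have grid: "t + real i * h \<le> s" if "i \<le> 4 * l" for i
    proof -
      have "real i * h \<le> real (4 * l) * h" using that h by (intro mult_right_mono) auto
      then show ?thesis using lh by linarith
    qed
    have V_eq: "U_grid \<beta> \<sigma> k Z t h i \<omega> = V z i (drift_free \<theta> t h (4 * l) \<omega>)" if "i \<le> 4 * l" for i \<omega>
      using that grid[OF that] h gauss_walk_axioms by (intro U_grid_eq_V) (auto simp: z_def min_def)
    have mem: "drift_free \<theta> t h (4 * l) \<omega> \<in> ?E \<longleftrightarrow> u < ?M l \<omega> \<and> ?M l \<omega> < v" for \<omega>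
    proof -
      have "u < ?M l \<omega> \<longleftrightarrow> (\<exists>i\<le>4 * l. u < U_grid \<beta> \<sigma> k Z t h i \<omega>)"
        unfolding U_grid_max_def L_def[symmetric] h_def[symmetric] by (subst Max_gr_iff) auto
      moreover have "?M l \<omega> < v \<longleftrightarrow> (\<forall>i\<le>4 * l. U_grid \<beta> \<sigma> k Z t h i \<omega> < v)"
        unfolding U_grid_max_def L_def[symmetric] h_def[symmetric] by (subst Max_less_iff) auto
      ultimately show ?thesis by (simp add: V_eq cong: conj_cong)
    qed
    \<comment> \<open>Indices up to \<open>4 * l\<close> involve only the first \<open>4 * l\<close>
      increments.\<close>
    have trunc: "(\<lambda>i. if i < 4 * l then x i else 0) \<in> ?E \<longleftrightarrow> x \<in> ?E" for x
    proof -
      have "X i (\<lambda>i. if i < 4 * l then x i else 0) = X i x" if "i \<le> 4 * l" for i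
        using that by (simp add: X_def)
      then have "V z i (\<lambda>i. if i < 4 * l then x i else 0) = V z i x" if "i \<le> 4 * l" for i
        using that by (simp add: V_def)
      then show ?thesis by (simp cong: conj_cong)
    qed
    have "emeasure ?Q {\<omega> \<in> space P. u < ?M l \<omega> \<and> ?M l \<omega> < v}
      = (\<integral>\<^sup>+\<omega>. indicator {\<omega> \<in> space P. u < ?M l \<omega> \<and> ?M l \<omega> < v} \<omega> * tilt \<theta> t T \<omega> \<partial>P)"
      using M_P[of u l v] by (subst emeasure_density) (auto simp: mult.commute)
    \<comment> \<open>The grid event belongs to \<open>F s\<close>, so the martingale property moves
      the weight from \<open>T\<close> back to \<open>s\<close>, the last grid time.\<close>
    also have "\<dots> = (\<integral>\<^sup>+\<omega>. indicator {\<omega> \<in> space P. u < ?M l \<omega> \<and> ?M l \<omega> < v} \<omega> * tilt \<theta> t s \<omega> \<partial>P)"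
      using ts M_F[of u l v] unfolding sp by (intro nn_integral_tilt) auto
    also have "\<dots> = (\<integral>\<^sup>+\<omega>. indicator ?E (drift_free \<theta> t h (4 * l) \<omega>) * tilt \<theta> t (t + real (4 * l) * h) \<omega> \<partial>P)"
      unfolding lh
    proof (intro nn_integral_cong)
      fix \<omega> assume "\<omega> \<in> space P"
      then have "\<omega> \<in> {\<omega> \<in> space P. u < ?M l \<omega> \<and> ?M l \<omega> < v} \<longleftrightarrow> drift_free \<theta> t h (4 * l) \<omega> \<in> ?E"
        unfolding mem by simp
      then show "indicator {\<omega> \<in> space P. u < ?M l \<omega> \<and> ?M l \<omega> < v} \<omega> * tilt \<theta> t s \<omega> =
          indicator ?E (drift_free \<theta> t h (4 * l) \<omega>) * tilt \<theta> t s \<omega>"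
        by (simp only: indicator_def)
    qed
    also have "\<dots> = (\<integral>\<^sup>+x. indicator ?E (\<lambda>i. if i < 4 * l then x i else 0) \<partial>GS)"
      using h ts lh by (intro nn_integral_drift_free) auto
    also have "\<dots> = (\<integral>\<^sup>+x. indicator ?E x \<partial>GS)"
      using trunc by (intro nn_integral_cong) (simp add: indicator_def del: mem_Collect_eq)
    also have "\<dots> = emeasure GS ?E" by simp
    also have "\<dots> \<le> ennreal (C * (v - u) + \<epsilon>)"
    proof -
      have "zmin \<le> z i" for i unfolding z_def using ts h by (intro ge) auto
      moreover have "z (Suc i) \<le> exp (\<Lambda> * h) * z i" for i
      proof -
        let ?x = "min (t + real i * h) s" and ?y = "min (t + real (Suc i) * h) s"
        have xy: "t \<le> ?x" "?x \<le> ?y" "?y \<le> s" "?y - ?x \<le> h"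
          using ts h by (auto simp: algebra_simps)
        have "Z ?y \<le> exp (\<Lambda> * (?y - ?x)) * Z ?x" using xy by (intro growth) auto
        also have "\<dots> \<le> exp (\<Lambda> * h) * Z ?x"
          using xy \<Lambda> ge[of ?x] zmin by (intro mult_right_mono) (auto intro!: mult_left_mono)
        finally show ?thesis by (simp add: z_def)
      qed
      ultimately show ?thesis using elim(1) uv unfolding h_def[symmetric] by auto
    qed
    finally show ?case .
  qed
  obtain N where N: "N \<in> null_sets P" "\<And>A. A \<subseteq> N \<Longrightarrow> A \<in> sets (F T)"
    "\<And>\<omega>. \<omega> \<in> space P \<Longrightarrow> \<omega> \<notin> N \<Longrightarrow> continuous_on {0..T} (\<lambda>r. W r \<omega>)"
    by (rule AE_continuous_null_set) blast
  have "emeasure ?Q {\<omega> \<in> space P. u < ?S \<omega> \<and> ?S \<omega> < v} \<le> ennreal (C * (v - u))" if uv: "u < v" for u v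
  proof (rule ennreal_le_epsilon)
    fix \<epsilon> :: real assume \<epsilon>: "0 < \<epsilon>"
    let ?A = "{\<omega> \<in> space P. u < ?S \<omega> \<and> ?S \<omega> < v}"
    have "?S \<in> borel_measurable P"
      using T_pos by (intro measurable_F_imp_P[OF _ U_sup_measurable[OF ts k Z]]) auto
    then have A: "?A \<in> sets P" by measurable
    have "emeasure ?Q ?A = emeasure ?Q (?A - N)"
    proof (rule emeasure_Diff_null_set[symmetric])
      show "N \<in> null_sets ?Q"
        using N(1) AE_not_in[OF N(1)] by (subst null_sets_density_iff) (auto simp: null_sets_def)
    qed (use A in simp)
    also have "\<dots> \<le> ennreal (C * (v - u) + \<epsilon>)"
    \<comment> \<open>Off \<open>N\<close> the grid maxima converge, and the strict inequalities
      hold for all fine grids once they hold in the limit.\<close>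
    proof (rule emeasure_le_of_eventually[OF _ _ grid_bound[OF uv \<epsilon>]])
      fix \<omega> assume \<omega>: "\<omega> \<in> ?A - N"
      have "(\<lambda>n. U_grid_max \<beta> \<sigma> k Z t s n \<omega>) \<longlonglongrightarrow> ?S \<omega>"
        using \<omega> by (intro U_grid_max_tendsto ts k Z N(3)) auto
      then have "(\<lambda>l. ?M l \<omega>) \<longlonglongrightarrow> ?S \<omega>"
        by (rule filterlim_compose) (auto intro!: filterlim_subseq simp: strict_mono_def)
      then have "\<forall>\<^sub>F l in sequentially. u < ?M l \<omega>" "\<forall>\<^sub>F l in sequentially. ?M l \<omega> < v"
        using \<omega> by (auto intro: order_tendstoD)
      then show "\<forall>\<^sub>F l in sequentially. \<omega> \<in> {\<omega> \<in> space P. u < ?M l \<omega> \<and> ?M l \<omega> < v}"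
        by eventually_elim (use \<omega> in auto)
    qed (use M_P in simp)
    finally show "emeasure ?Q ?A \<le> ennreal (C * (v - u)) + ennreal \<epsilon>"
      using C uv \<epsilon> by simp
  qed
  with C show ?thesis by (rule that)
qed

end

section \<open>Specialisation to the supremum of U and the three measures\<close>

lemma sup_U_eq_U_sup:
  assumes "filtered_brownian_motion P F T W"
  shows "sup_U \<mu> \<delta> \<sigma> v Z W t s = filtered_brownian_motion.U_sup W (\<delta> + \<sigma>\<^sup>2 / 2) \<sigma> (\<mu> * v) Z t s"
proof -
  interpret filtered_brownian_motion P F T W by fact
  have "inverse (K_proc \<delta> \<sigma> W t r \<omega>) = GBM (\<delta> + \<sigma>\<^sup>2 / 2) \<sigma> t r \<omega>" for r \<omega>
    by (simp add: K_proc_def GBM_def exp_minus[symmetric] algebra_simps)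
  then show ?thesis by (simp add: fun_eq_iff sup_U_def U_proc_def U_sup_def)
qed

lemma nu_mean_pos:
  assumes "0 < m" "n \<ge> 1" "\<And>i. i \<in> {1..n} \<Longrightarrow> a i \<in> {m..M} \<and> c i \<in> {m..M}"
  shows "0 < nu_mean n a c"
proof -
  have "0 < a i / (2 * c i)" if "i \<in> {1..n}" for i
  proof -
    have "0 < a i" "0 < c i" using assms(1) assms(3)[OF that] by auto
    then show ?thesis by simp
  qed
  then have "0 < (\<Sum>i = 1..n. a i / (2 * c i))"
    using assms(2) by (intro sum_pos) auto
  then show ?thesis using assms(2) by (simp add: nu_mean_def)
qed

theorem lemma4p3:
  fixes P :: "'a measure" and F :: "real \<Rightarrow> 'a measure" and W :: "real \<Rightarrow> 'a \<Rightarrow> real"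
    and T m M \<mu> \<sigma> \<delta> t z s :: real
    and n :: nat and a c :: "nat \<Rightarrow> real"
    and \<Phi> Z :: "real \<Rightarrow> real"
  assumes "filtered_brownian_motion P F T W"
    and "0 < m" and "m < M"
    and "\<mu> \<in> {m..M}" and "\<sigma> \<in> {m..M}" and "\<delta> \<in> {m..M}" and "\<delta> \<in> {0<..<1}"
    and "n \<ge> 1"
    and "\<And>i. i \<in> {1..n} \<Longrightarrow> a i \<in> {m..M} \<and> c i \<in> {m..M}"
    and "\<exists>L. L-lipschitz_on UNIV \<Phi>" and "\<Phi> 0 \<ge> 0"
    and "t \<in> {0..<T}" and "z > 0"
    and "solves_Phi_ode \<Phi> T t z Z"
    and "s \<in> {t<..T}"
  shows "\<exists>p pQ1 pQ2.
      has_density P (sup_U \<mu> \<delta> \<sigma> (nu_mean n a c) Z W t s) p \<and>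
      has_density (Q1_measure P F T W \<sigma> t) (sup_U \<mu> \<delta> \<sigma> (nu_mean n a c) Z W t s) pQ1 \<and>
      has_density (Q2_measure P F T W \<sigma> t) (sup_U \<mu> \<delta> \<sigma> (nu_mean n a c) Z W t s) pQ2 \<and>
      locally_bounded p \<and> locally_bounded pQ1 \<and> locally_bounded pQ2"
proof -
  interpret filtered_brownian_motion P F T W by fact
  have \<sigma>: "0 < \<sigma>" and ts: "0 \<le> t" "t < s" "s \<le> T" "t < T" using assms by auto
  define k where "k = \<mu> * nu_mean n a c"
  have "0 < \<mu>" using assms by auto
  then have k: "0 < k" unfolding k_def using nu_mean_pos[of m n a M c] assms by simp
  obtain L where L: "L-lipschitz_on UNIV \<Phi>" using assms by auto
  obtain zmin \<Lambda> where Z: "0 < zmin" "0 \<le> \<Lambda>" "\<And>r. r \<in> {t..T} \<Longrightarrow> zmin \<le> Z r"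
    "\<And>x y. t \<le> x \<Longrightarrow> x \<le> y \<Longrightarrow> y \<le> T \<Longrightarrow> Z y \<le> exp (\<Lambda> * (y - x)) * Z x"
    "continuous_on {t..T} Z"
    using solves_Phi_ode_bounds[OF assms(14) L assms(11,13) ts(4)] by blast
  have Zs: "continuous_on {t..s} Z" using Z(5) by (rule continuous_on_subset) (use ts in auto)
  have ge: "zmin \<le> Z r" if "r \<in> {t..s}" for r
    using that ts by (intro Z(3)) auto
  have growth: "Z y \<le> exp (\<Lambda> * (y - x)) * Z x" if "t \<le> x" "x \<le> y" "y \<le> s" for x y
    using that ts by (intro Z(4)) auto
  let ?S = "sup_U \<mu> \<delta> \<sigma> (nu_mean n a c) Z W t s"
  have S_eq: "?S = U_sup (\<delta> + \<sigma>\<^sup>2 / 2) \<sigma> k Z t s"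
    unfolding k_def by (rule sup_U_eq_U_sup[OF assms(1)])
  have S_FT: "?S \<in> borel_measurable (F T)"
    unfolding S_eq by (rule U_sup_measurable[OF ts(1-3) k Zs])
  have sp: "space (F T) = space P" using T_pos by (intro space_F) auto
  have sub: "subalgebra P (F T)" using T_pos by (intro subalgebra_F) auto
  have S_P: "?S \<in> borel_measurable P" by (rule measurable_from_subalg[OF sub S_FT])
  have bound: "\<exists>C\<ge>0. \<forall>u v. u < v \<longrightarrow> emeasure (density P (tilt \<theta> t T)) {\<omega> \<in> space P. u < ?S \<omega> \<and> ?S \<omega> < v} \<le> ennreal (C * (v - u))" for \<theta>
    unfolding S_eq
    by (rule emeasure_tilt_U_sup[where \<theta> = \<theta> and \<beta> = "\<delta> + \<sigma>\<^sup>2 / 2", OF ts(1-3) \<sigma> k Zs Z(1,2) ge growth]) blast+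
  have "\<exists>p. has_density P ?S p \<and> locally_bounded p"
  proof -
    have "tilt 0 t T = (\<lambda>_. 1)" by (simp add: tilt_def fun_eq_iff)
    then have "density P (tilt 0 t T) = P" by (simp add: density_1)
    from bound[of 0, unfolded this] obtain C where C: "0 \<le> C"
      "\<And>u v. u < v \<Longrightarrow> emeasure P {\<omega> \<in> space P. u < ?S \<omega> \<and> ?S \<omega> < v} \<le> ennreal (C * (v - u))"
      by blast
    show ?thesis
      by (rule has_bounded_density_of_intervals[OF S_P C]) blast+
  qed
  moreover
  have "\<exists>p. has_density (density (restr_to_subalg P (F T)) (tilt \<theta> t T)) ?S p \<and> locally_bounded p" for \<theta>
  proof -
    let ?Q = "density (restr_to_subalg P (F T)) (tilt \<theta> t T)"
    have tilt[measurable]: "tilt \<theta> t T \<in> borel_measurable (F T)"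
      using ts by (intro tilt_measurable) auto
    have tilt_P: "tilt \<theta> t T \<in> borel_measurable P"
      by (rule measurable_from_subalg[OF sub tilt])
    \<comment> \<open>The tilted measure lives on \<open>F T\<close>, the interval bound on the full
      \<open>\<sigma>\<close>-algebra of \<open>P\<close>; both give the same mass to events of
      \<open>F T\<close>, and the supremum is measurable there.\<close>
    have eq: "emeasure ?Q A = emeasure (density P (tilt \<theta> t T)) A" if A: "A \<in> sets (F T)" for A
    proof -
      have AP: "A \<in> sets P" using A sub by (auto simp: subalgebra_def)
      have "emeasure ?Q A = (\<integral>\<^sup>+\<omega>. tilt \<theta> t T \<omega> * indicator A \<omega> \<partial>restr_to_subalg P (F T))"
        using A by (intro emeasure_density) (auto simp: sets_restr_to_subalg[OF sub] measurable_in_subalg[OF sub])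
      also have "\<dots> = (\<integral>\<^sup>+\<omega>. tilt \<theta> t T \<omega> * indicator A \<omega> \<partial>P)"
        by (intro nn_integral_subalgebra2[OF sub] borel_measurable_times_ennreal tilt borel_measurable_indicator A)
      also have "\<dots> = emeasure (density P (tilt \<theta> t T)) A"
        using tilt_P AP by (intro emeasure_density[symmetric])
      finally show ?thesis .
    qed
    have S_Q: "?S \<in> borel_measurable ?Q"
      using S_FT measurable_in_subalg[OF sub] by simp
    have "{\<omega> \<in> space P. u < ?S \<omega> \<and> ?S \<omega> < v} \<in> sets (F T)" for u v
      using S_FT unfolding sp[symmetric] by measurable
    then have eq': "emeasure ?Q {\<omega> \<in> space ?Q. u < ?S \<omega> \<and> ?S \<omega> < v} =
        emeasure (density P (tilt \<theta> t T)) {\<omega> \<in> space P. u < ?S \<omega> \<and> ?S \<omega> < v}" for u v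
      by (simp add: eq space_restr_to_subalg)
    from bound[of \<theta>] obtain C where C: "0 \<le> C"
      "\<And>u v. u < v \<Longrightarrow> emeasure ?Q {\<omega> \<in> space ?Q. u < ?S \<omega> \<and> ?S \<omega> < v} \<le> ennreal (C * (v - u))"
      unfolding eq' by blast
    show ?thesis
      by (rule has_bounded_density_of_intervals[OF S_Q C]) blast+
  qed
  moreover have "Q1_measure P F T W \<sigma> t = density (restr_to_subalg P (F T)) (tilt (- \<sigma>) t T)"
    by (simp add: Q1_measure_def tilt_def[abs_def])
  moreover have "Q2_measure P F T W \<sigma> t = density (restr_to_subalg P (F T)) (tilt \<sigma> t T)"
    by (simp add: Q2_measure_def tilt_def[abs_def])
  ultimately show ?thesis by metis
qed

end
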